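(* Let $H$ be a real separable Hilbert space, $T>0$, and $\phi=\phi_1+\phi_2:H\to(-\infty,\infty]$ with $\phi_1$ proper, convex, lower semicontinuous and $\partial\phi_1$ single-valued (where nonempty), $\phi_2\in C^{1,1}(H)$, such that $\phi$ has compact sublevel sets and satisfies the chain rule stated in the context. Let $y_0\in D(\phi)$, $U\ne\emptyset$ compact in $L^2(0,T;H)$, $X:=L^2(0,T;H)\times H^1(0,T;H)$ with $\tau$ = strong $\times$ weak topology, $F:X\to[0,\infty]$ $\tau$-lower semicontinuous with $F(u,y)<\infty$ only if $u\in U$, and $E_\varepsilon:=F+\varepsilon^{-1}G_{\rm DG}$. Then $\min E_\varepsilon$ admits a solution for all $\varepsilon>0$; $E_\varepsilon$ $\Gamma$-converges w.r.t. $\tau$ to $E_0$, with $E_0=F$ on $\{G_{\rm DG}=0\}$ and $E_0=\infty$ otherwise; every sequence of quasiminimizers has a subsequence $\tau$-converging to a minimizer of $E_0$; and if $E_0$ has a unique minimizer, every sequence of quasiminimizers $\tau$-converges to it.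
   Context: $\partial\phi$ is the Fréchet subdifferential: $\xi\in\partial\phi(y)$ iff $y\in D(\phi)$ and $\liminf_{w\to y}\frac{\phi(w)-\phi(y)-(\xi,w-y)}{\|w-y\|}\ge0$; here $\partial\phi=\partial\phi_1+D\phi_2$ is single-valued on $D(\partial\phi)=\{y:\partial\phi(y)\ne\emptyset\}$. Chain rule: if $y\in H^1(0,T;H)$, $\xi\in L^2(0,T;H)$ and $\xi(t)\in\partial\phi(y(t))$ for a.e. $t$, then $\phi\circ y$ is absolutely continuous on $[0,T]$ and $(\phi\circ y)'=(\xi,y')$ a.e. De Giorgi functional: for $(u,y)\in X$, $G_{\rm DG}(u,y)=\int_0^T\big(\frac12\|y'\|^2+\frac12\|\partial\phi(y)-u\|^2-(u,y')\big)\,dt+\phi(y(T))-\phi(y_0)$ if $y(t)\in D(\partial\phi)$ for a.e. $t$ and $y(0)=y_0$, and $G_{\rm DG}(u,y)=\infty$ otherwise. For each $u\in L^2(0,T;H)$, $G_{\rm DG}(u,y)=0$ iff $y\in H^1(0,T;H)$ solves $y'+\partial\phi(y)\ni u$ a.e., $y(0)=y_0$. Quasiminimizers: $\lim(E_\varepsilon(x_\varepsilon)-\inf E_\varepsilon)=0$; $\Gamma$-convergence is sequential. *)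

theory Defs
  imports "HOL-Analysis.Analysis"
begin

definition proper_fun :: "('a \<Rightarrow> ereal) \<Rightarrow> bool" where
  "proper_fun f \<longleftrightarrow> (\<exists>x. f x \<noteq> \<infinity>) \<and> (\<forall>x. f x \<noteq> -\<infinity>)"

definition convex_fun :: "('a::real_vector \<Rightarrow> ereal) \<Rightarrow> bool" where
  "convex_fun f \<longleftrightarrow> (\<forall>x y t. 0 < t \<and> t < 1 \<longrightarrow>
      f (t *\<^sub>R x + (1 - t) *\<^sub>R y) \<le> ereal t * f x + ereal (1 - t) * f y)"

definition lsc_fun :: "('a::topological_space \<Rightarrow> ereal) \<Rightarrow> bool" where
  "lsc_fun f \<longleftrightarrow> (\<forall>x. f x \<le> Liminf (at x) f)"

definition dom_fun :: "('a \<Rightarrow> ereal) \<Rightarrow> 'a set" where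
  "dom_fun f = {x. f x < \<infinity>}"

definition frechet_subdiff :: "('a::real_inner \<Rightarrow> ereal) \<Rightarrow> 'a \<Rightarrow> 'a set" where
  "frechet_subdiff f y = {\<xi>. y \<in> dom_fun f \<and>
      Liminf (at y) (\<lambda>w. (f w - f y - ereal (inner \<xi> (w - y))) / ereal (norm (w - y))) \<ge> 0}"

definition dom_subdiff :: "('a::real_inner \<Rightarrow> ereal) \<Rightarrow> 'a set" where
  "dom_subdiff f = {y. frechet_subdiff f y \<noteq> {}}"

definition subdiff_fun :: "('a::real_inner \<Rightarrow> ereal) \<Rightarrow> 'a \<Rightarrow> 'a" where
  "subdiff_fun f y = (THE \<xi>. \<xi> \<in> frechet_subdiff f y)"

definition C11 :: "('a::real_normed_vector \<Rightarrow> real) \<Rightarrow> bool" where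
  "C11 f \<longleftrightarrow> (\<forall>x. f differentiable (at x)) \<and>
     (\<exists>L. \<forall>x y. onorm (\<lambda>h. frechet_derivative f (at x) h - frechet_derivative f (at y) h)
                 \<le> L * norm (x - y))"

text \<open>L^2(0,T;H) (representatives; a.e.-equal functions are identified through the topology).\<close>
definition L2fun :: "real \<Rightarrow> (real \<Rightarrow> 'a::{banach,second_countable_topology}) set" where
  "L2fun T = {u. u \<in> borel_measurable (lebesgue_on {0..T}) \<and>
                 integrable (lebesgue_on {0..T}) (\<lambda>t. (norm (u t))\<^sup>2)}"

definition L2dist :: "real \<Rightarrow> (real \<Rightarrow> 'a::{banach,second_countable_topology}) \<Rightarrow> (real \<Rightarrow> 'a) \<Rightarrow> real" where
  "L2dist T u v = sqrt (LINT t|lebesgue_on {0..T}. (norm (u t - v t))\<^sup>2)"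

definition L2_top :: "real \<Rightarrow> (real \<Rightarrow> 'a::{banach,second_countable_topology}) topology" where
  "L2_top T = topology (\<lambda>S. S \<subseteq> L2fun T \<and>
       (\<forall>u\<in>S. \<exists>e>0. {v \<in> L2fun T. L2dist T u v < e} \<subseteq> S))"

text \<open>H^1(0,T;H), each class represented by its continuous (absolutely continuous)
  representative on [0,T], extended by 0 outside [0,T].\<close>
definition H1fun :: "real \<Rightarrow> (real \<Rightarrow> 'a::{banach,second_countable_topology}) set" where
  "H1fun T = {y. (\<forall>t. t \<notin> {0..T} \<longrightarrow> y t = 0) \<and>
      (\<exists>y' \<in> L2fun T. \<forall>t\<in>{0..T}. y t = y 0 + integral\<^sup>L (lebesgue_on {0..t}) y')}"

text \<open>Weak derivative y' (unique up to a.e. equality).\<close>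
definition h1deriv :: "real \<Rightarrow> (real \<Rightarrow> 'a::{banach,second_countable_topology}) \<Rightarrow> real \<Rightarrow> 'a" where
  "h1deriv T y = (SOME y'. y' \<in> L2fun T \<and>
      (\<forall>t\<in>{0..T}. y t = y 0 + integral\<^sup>L (lebesgue_on {0..t}) y'))"

definition H1inner :: "real \<Rightarrow> (real \<Rightarrow> 'a::{real_inner,banach,second_countable_topology}) \<Rightarrow> (real \<Rightarrow> 'a) \<Rightarrow> real" where
  "H1inner T y z = (LINT t|lebesgue_on {0..T}. inner (y t) (z t)) +
                   (LINT t|lebesgue_on {0..T}. inner (h1deriv T y t) (h1deriv T z t))"

text \<open>Weak topology of the Hilbert space H^1(0,T;H): initial topology of the
  continuous linear functionals, i.e. of y \<mapsto> (y,z)_{H^1}, z \<in> H^1.\<close>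
definition H1w_top :: "real \<Rightarrow> (real \<Rightarrow> 'a::{real_inner,banach,second_countable_topology}) topology" where
  "H1w_top T = subtopology
      (topology_generated_by {{y \<in> H1fun T. H1inner T y z \<in> V} | z V. z \<in> H1fun T \<and> open V})
      (H1fun T)"

definition Xset :: "real \<Rightarrow> ((real \<Rightarrow> 'a::{real_inner,banach,second_countable_topology}) \<times> (real \<Rightarrow> 'a)) set" where
  "Xset T = L2fun T \<times> H1fun T"

definition tau :: "real \<Rightarrow> ((real \<Rightarrow> 'a::{real_inner,banach,second_countable_topology}) \<times> (real \<Rightarrow> 'a)) topology" where
  "tau T = prod_topology (L2_top T) (H1w_top T)"

definition Xeq :: "real \<Rightarrow> ((real \<Rightarrow> 'a::{real_inner,banach,second_countable_topology}) \<times> (real \<Rightarrow> 'a))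
                    \<Rightarrow> ((real \<Rightarrow> 'a) \<times> (real \<Rightarrow> 'a)) \<Rightarrow> bool" where
  "Xeq T x x' \<longleftrightarrow> (AE t in lebesgue_on {0..T}. fst x t = fst x' t) \<and> snd x = snd x'"

definition abs_cont_on :: "real \<Rightarrow> real \<Rightarrow> (real \<Rightarrow> real) \<Rightarrow> bool" where
  "abs_cont_on a b g \<longleftrightarrow> (\<forall>e>0. \<exists>d>0. \<forall>(n::nat) (s::nat \<Rightarrow> real) t.
      (\<forall>i<n. a \<le> s i \<and> s i \<le> t i \<and> t i \<le> b) \<and>
      (\<forall>i<n. \<forall>j<n. i \<noteq> j \<longrightarrow> t i \<le> s j \<or> t j \<le> s i) \<and>
      (\<Sum>i<n. t i - s i) < d \<longrightarrow> (\<Sum>i<n. \<bar>g (t i) - g (s i)\<bar>) < e)"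

definition chain_rule :: "real \<Rightarrow> ('a::{real_inner,banach,second_countable_topology} \<Rightarrow> ereal) \<Rightarrow> bool" where
  "chain_rule T f \<longleftrightarrow> (\<forall>y \<in> H1fun T. \<forall>\<xi> \<in> L2fun T.
      (AE t in lebesgue_on {0..T}. \<xi> t \<in> frechet_subdiff f (y t)) \<longrightarrow>
      (\<forall>t\<in>{0..T}. \<bar>f (y t)\<bar> \<noteq> \<infinity>) \<and>
      abs_cont_on 0 T (\<lambda>t. real_of_ereal (f (y t))) \<and>
      (AE t in lebesgue_on {0..T}.
         ((\<lambda>s. real_of_ereal (f (y s))) has_real_derivative inner (\<xi> t) (h1deriv T y t))
           (at t within {0..T})))"

definition G_DG :: "real \<Rightarrow> ('a::{real_inner,banach,second_countable_topology} \<Rightarrow> ereal) \<Rightarrow> 'a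
                    \<Rightarrow> (real \<Rightarrow> 'a) \<times> (real \<Rightarrow> 'a) \<Rightarrow> ereal" where
  "G_DG T f y0 x = (let u = fst x; y = snd x in
     if (AE t in lebesgue_on {0..T}. y t \<in> dom_subdiff f) \<and> y 0 = y0 then
       enn2ereal (\<integral>\<^sup>+ t. ennreal ((norm (h1deriv T y t))\<^sup>2 / 2 +
                                 (norm (subdiff_fun f (y t) - u t))\<^sup>2 / 2) \<partial>(lebesgue_on {0..T}))
       - ereal (LINT t|lebesgue_on {0..T}. inner (u t) (h1deriv T y t))
       + f (y T) - f y0
     else \<infinity>)"

definition E_eps :: "real \<Rightarrow> ('a::{real_inner,banach,second_countable_topology} \<Rightarrow> ereal) \<Rightarrow> 'a
      \<Rightarrow> ((real \<Rightarrow> 'a) \<times> (real \<Rightarrow> 'a) \<Rightarrow> ennreal) \<Rightarrow> real \<Rightarrow> (real \<Rightarrow> 'a) \<times> (real \<Rightarrow> 'a) \<Rightarrow> ereal" where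
  "E_eps T f y0 F \<epsilon> x = enn2ereal (F x) + ereal (1 / \<epsilon>) * G_DG T f y0 x"

definition E_0 :: "real \<Rightarrow> ('a::{real_inner,banach,second_countable_topology} \<Rightarrow> ereal) \<Rightarrow> 'a
      \<Rightarrow> ((real \<Rightarrow> 'a) \<times> (real \<Rightarrow> 'a) \<Rightarrow> ennreal) \<Rightarrow> (real \<Rightarrow> 'a) \<times> (real \<Rightarrow> 'a) \<Rightarrow> ereal" where
  "E_0 T f y0 F x = (if G_DG T f y0 x = 0 then enn2ereal (F x) else \<infinity>)"

definition lsc_top :: "'b topology \<Rightarrow> ('b \<Rightarrow> ennreal) \<Rightarrow> bool" where
  "lsc_top X f \<longleftrightarrow> (\<forall>c. openin X {x \<in> topspace X. c < f x})"

definition is_minimizer :: "'b set \<Rightarrow> ('b \<Rightarrow> ereal) \<Rightarrow> 'b \<Rightarrow> bool" where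
  "is_minimizer S f x \<longleftrightarrow> x \<in> S \<and> (\<forall>x'\<in>S. f x \<le> f x')"

definition gamma_conv :: "'b topology \<Rightarrow> (real \<Rightarrow> 'b \<Rightarrow> ereal) \<Rightarrow> ('b \<Rightarrow> ereal) \<Rightarrow> bool" where
  "gamma_conv X E E0 \<longleftrightarrow> (\<forall>\<epsilon>::nat \<Rightarrow> real. (\<forall>n. \<epsilon> n > 0) \<and> \<epsilon> \<longlonglongrightarrow> 0 \<longrightarrow>
     (\<forall>x xs. (\<forall>n. xs n \<in> topspace X) \<and> limitin X xs x sequentially \<longrightarrow>
         E0 x \<le> liminf (\<lambda>n. E (\<epsilon> n) (xs n))) \<and>
     (\<forall>x \<in> topspace X. \<exists>xs. (\<forall>n. xs n \<in> topspace X) \<and> limitin X xs x sequentially \<and>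
         limsup (\<lambda>n. E (\<epsilon> n) (xs n)) \<le> E0 x))"

text \<open>Sequences of quasiminimizers: eps_n \<rightarrow> 0+, E_{eps_n}(x_n) - inf E_{eps_n} \<rightarrow> 0
  (with E_{eps_n}(x_n) eventually finite, so the difference is meaningful).\<close>
definition quasimin_seq :: "'b set \<Rightarrow> (real \<Rightarrow> 'b \<Rightarrow> ereal) \<Rightarrow> (nat \<Rightarrow> real) \<Rightarrow> (nat \<Rightarrow> 'b) \<Rightarrow> bool" where
  "quasimin_seq S E \<epsilon> xs \<longleftrightarrow> (\<forall>n. \<epsilon> n > 0) \<and> \<epsilon> \<longlonglongrightarrow> 0 \<and> (\<forall>n. xs n \<in> S) \<and>
     (\<forall>\<^sub>F n in sequentially. E (\<epsilon> n) (xs n) < \<infinity>) \<and>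
     ((\<lambda>n. E (\<epsilon> n) (xs n) - (INF x\<in>S. E (\<epsilon> n) x)) \<longlonglongrightarrow> 0)"

end

theory Submission
  imports Defs "HOL-Library.Diagonal_Subsequence"
begin

text \<open>By the chain rule, \<open>G_DG (u, y)\<close> is half the squared \<open>L\<^sup>2\<close> norm of
  \<open>y' + \<partial>\<phi>(y) - u\<close> whenever it is finite; in particular it is nonnegative. A bound on \<open>G_DG\<close> with
  controls in a compact set bounds \<open>y'\<close> and \<open>\<partial>\<phi>(y)\<close> in \<open>L\<^sup>2\<close> and, again by the chain rule, confines
  all trajectories to one compact sublevel of \<open>\<phi>\<close>. Weakly convergent velocities therefore give
  trajectories converging strongly at every time, the graph of \<open>\<partial>\<phi>\<close> is closed under strong
  convergence of \<open>y\<close> and weak convergence of \<open>\<partial>\<phi>(y)\<close>, and \<open>G_DG\<close> is lower semicontinuous with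
  compact sublevels. Existence of minimizers is the direct method. For the \<open>\<Gamma>\<close>-limit, bounded
  \<open>E_eps\<close> forces \<open>G_DG\<close> to vanish in the limit, and constant recovery sequences suffice. Quasiminimizers
  have bounded \<open>G_DG\<close> even if \<open>E_0\<close> is identically infinite: comparison with a fixed point of finite
  energy bounds \<open>\<epsilon> * E_eps\<close>.\<close>

section \<open>Semi-inner product spaces and weak compactness\<close>

text \<open>Two obstacles shape the proof. The chain rule asks for a measurable, square integrable
  selection of the subdifferential along \<open>y\<close>, while finiteness of \<open>G_DG\<close>
  only bounds a nonnegative integral. Measurability has to come from the state space: the
  single-valued subdifferential is a Borel map. The chain rule then yields an absolutely continuous
  energy with an a.e. derivative, and turning this into an integral identity takes a fundamental
  theorem of calculus, proved here with gauges. The Frechet condition is local and does not pass to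
  limits as it stands. For a convex function plus a differentiable one it is equivalent to a global
  inequality in which the gradient of \<open>\<phi>2\<close> shifts the subgradient. Limits are
  taken in that form, with the energy alone on the smaller side, because only its lower
  semicontinuity is available. Controls are representatives, so their topology does not separate
  a.e. equal functions and limits are unique only up to \<open>Xeq\<close>. Trajectories are
  continuous on the interval and zero outside, so their weak limits are unique.\<close>

lemma quadratic_nonneg_imp_zero:
  fixes p q :: real
  assumes "\<And>s. 0 \<le> s * p + s\<^sup>2 * q"
  shows "p = 0"
proof (rule ccontr)
  assume "p \<noteq> 0"
  \<comment> \<open>The value at s = -p/K is p^2 (q - K) / K^2, negative for nonzero p; adding 1
    keeps K positive and strictly above q.\<close>
  define K where "K = \<bar>q\<bar> + 1"
  have K: "K > 0" "q < K" by (auto simp: K_def)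
  have "0 \<le> (- p / K) * p + (- p / K)\<^sup>2 * q" using assms .
  then have "0 \<le> ((- p / K) * p + (- p / K)\<^sup>2 * q) * K\<^sup>2" by simp
  also have "\<dots> = p\<^sup>2 * (q - K)" using K by (simp add: field_simps power2_eq_square)
  finally show False using \<open>p \<noteq> 0\<close> K by (simp add: zero_le_mult_iff)
qed

text \<open>Square integrable functions are handled through representatives, so the form \<open>ip\<close> may be
  degenerate and the vector space structure is given only by the combinations
  \<open>comb a x b y = a x + b y\<close>.\<close>

locale semi_hilbert =
  fixes V :: "'b set" and ip :: "'b \<Rightarrow> 'b \<Rightarrow> real" and comb :: "real \<Rightarrow> 'b \<Rightarrow> real \<Rightarrow> 'b \<Rightarrow> 'b"
  assumes comb_in: "x \<in> V \<Longrightarrow> y \<in> V \<Longrightarrow> comb a x b y \<in> V"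
    and ip_comb: "x \<in> V \<Longrightarrow> y \<in> V \<Longrightarrow> z \<in> V \<Longrightarrow> ip (comb a x b y) z = a * ip x z + b * ip y z"
    and ip_commute: "x \<in> V \<Longrightarrow> y \<in> V \<Longrightarrow> ip x y = ip y x"
    and ip_nonneg: "x \<in> V \<Longrightarrow> 0 \<le> ip x x"
    and ip_complete: "(\<And>n::nat. X n \<in> V) \<Longrightarrow>
        (\<And>e. e > 0 \<Longrightarrow> \<exists>N. \<forall>m\<ge>N. \<forall>n\<ge>N.
            ip (comb 1 (X m) (-1) (X n)) (comb 1 (X m) (-1) (X n)) < e) \<Longrightarrow>
        \<exists>x\<in>V. (\<lambda>n. ip (comb 1 (X n) (-1) x) (comb 1 (X n) (-1) x)) \<longlonglongrightarrow> 0"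
begin

lemma ip_comb_right:
  "x \<in> V \<Longrightarrow> y \<in> V \<Longrightarrow> z \<in> V \<Longrightarrow> ip z (comb a x b y) = a * ip z x + b * ip z y"
  by (metis comb_in ip_comb ip_commute)

lemma nsq_comb:
  assumes "x \<in> V" "y \<in> V"
  shows "ip (comb a x b y) (comb a x b y) = a\<^sup>2 * ip x x + 2 * a * b * ip x y + b\<^sup>2 * ip y y"
  using assms ip_commute[OF assms]
  by (simp add: ip_comb ip_comb_right comb_in algebra_simps power2_eq_square)

text \<open>Degeneracy makes \<open>ip y y = 0\<close> a genuine case: nonnegativity of the form on
  s x + y for all s then forces \<open>ip x y = 0\<close>. Otherwise the test vector is (ip y y) x -
  (ip x y) y.\<close>

lemma cauchy_schwarz:
  assumes "x \<in> V" "y \<in> V"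
  shows "(ip x y)\<^sup>2 \<le> ip x x * ip y y"
proof (cases "ip y y = 0")
  case True
  have "0 \<le> s * (2 * ip x y) + s\<^sup>2 * (ip x x)" for s
    using ip_nonneg[OF comb_in[OF assms, of s 1]] nsq_comb[OF assms, of s 1] True by (simp add: algebra_simps)
  then have "ip x y = 0" using quadratic_nonneg_imp_zero[of "2 * ip x y" "ip x x"] by simp
  then show ?thesis using True by simp
next
  case False
  have "0 \<le> (ip y y)\<^sup>2 * ip x x + 2 * ip y y * (- ip x y) * ip x y + (- ip x y)\<^sup>2 * ip y y"
    using ip_nonneg[OF comb_in[OF assms, of "ip y y" "- ip x y"]]
      nsq_comb[OF assms, of "ip y y" "- ip x y"] by simp
  also have "\<dots> = ip y y * (ip x x * ip y y - (ip x y)\<^sup>2)"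
    by (simp add: algebra_simps power2_eq_square)
  finally show ?thesis using False ip_nonneg[OF assms(2)] by (simp add: zero_le_mult_iff)
qed

definition wconv :: "(nat \<Rightarrow> 'b) \<Rightarrow> 'b \<Rightarrow> bool" where
  "wconv X x \<longleftrightarrow> (\<forall>z\<in>V. (\<lambda>n. ip (X n) z) \<longlonglongrightarrow> ip x z)"

definition sconv :: "(nat \<Rightarrow> 'b) \<Rightarrow> 'b \<Rightarrow> bool" where
  "sconv X x \<longleftrightarrow> (\<lambda>n. ip (comb 1 (X n) (-1) x) (comb 1 (X n) (-1) x)) \<longlonglongrightarrow> 0"

text \<open>Splitting Z n into z and Z n - z leaves an error that Cauchy-Schwarz bounds by the norm
  of Z n - z. The bound on X n is an explicit premise, so no uniform boundedness principle
  enters.\<close>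

lemma wconv_sconv_ip:
  assumes X: "\<And>n. X n \<in> V" and Z: "\<And>n. Z n \<in> V" and z: "z \<in> V"
    and bd: "\<And>n. ip (X n) (X n) \<le> M" and w: "wconv X x" and s: "sconv Z z"
  shows "(\<lambda>n. ip (X n) (Z n)) \<longlonglongrightarrow> ip x z"
proof -
  define d where "d n = comb 1 (Z n) (-1) z" for n
  have dV: "d n \<in> V" for n unfolding d_def by (intro comb_in Z z)
  have "(\<lambda>n. (ip (X n) (d n))\<^sup>2) \<longlonglongrightarrow> 0"
  proof (rule tendsto_sandwich[OF always_eventually always_eventually tendsto_const])
    show "(\<lambda>n. M * ip (d n) (d n)) \<longlonglongrightarrow> 0"
      using s unfolding sconv_def d_def by (rule tendsto_mult_right_zero)
    show "\<forall>n. (ip (X n) (d n))\<^sup>2 \<le> M * ip (d n) (d n)"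
      using cauchy_schwarz[OF X dV] mult_right_mono[OF bd ip_nonneg[OF dV]] order_trans by blast
  qed auto
  then have "(\<lambda>n. ip (X n) (d n)) \<longlonglongrightarrow> 0"
    using tendsto_real_sqrt[of "\<lambda>n. (ip (X n) (d n))\<^sup>2" 0] by (simp add: tendsto_rabs_zero_iff)
  moreover have "ip (X n) (Z n) = ip (X n) z + ip (X n) (d n)" for n
    by (simp add: d_def ip_comb_right X Z z)
  moreover have "(\<lambda>n. ip (X n) z) \<longlonglongrightarrow> ip x z" using w z by (auto simp: wconv_def)
  ultimately show ?thesis
    using tendsto_add[of "\<lambda>n. ip (X n) z" "ip x z" sequentially "\<lambda>n. ip (X n) (d n)" 0] by simp
qed

lemma sconv_ip:
  assumes "\<And>n. X n \<in> V" "x \<in> V" "z \<in> V" "sconv X x"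
  shows "(\<lambda>n. ip (X n) z) \<longlonglongrightarrow> ip x z"
proof -
  have "(\<lambda>n. ip z (X n)) \<longlonglongrightarrow> ip z x"
    using wconv_sconv_ip[of "\<lambda>_. z" X x "ip z z" z] assms by (auto simp: wconv_def)
  then show ?thesis using assms by (simp add: ip_commute)
qed

lemma sconv_nsq:
  assumes "\<And>n. X n \<in> V" "x \<in> V" "sconv X x"
  shows "(\<lambda>n. ip (X n) (X n)) \<longlonglongrightarrow> ip x x"
proof -
  have "(\<lambda>n. ip (comb 1 (X n) (-1) x) (comb 1 (X n) (-1) x) + 2 * ip (X n) x - ip x x)
      \<longlonglongrightarrow> 0 + 2 * ip x x - ip x x"
    using assms sconv_ip[OF assms(1,2,2,3)] unfolding sconv_def by (intro tendsto_intros)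
  then show ?thesis by (simp add: nsq_comb assms)
qed

text \<open>Weak lower semicontinuity of the squared norm, read off from the expansion of the
  nonnegative quantity \<open>ip (X n - x) (X n - x)\<close>. In the applications a subsequence has
  already made the squared norms converge.\<close>

lemma wconv_nsq_le:
  assumes "\<And>n. X n \<in> V" "x \<in> V" "wconv X x" "(\<lambda>n. ip (X n) (X n)) \<longlonglongrightarrow> a"
  shows "ip x x \<le> a"
proof -
  have "(\<lambda>n. ip (X n) (X n) - 2 * ip (X n) x + ip x x) \<longlonglongrightarrow> a - 2 * ip x x + ip x x"
    using assms unfolding wconv_def by (intro tendsto_intros) auto
  moreover have "0 \<le> ip (X n) (X n) - 2 * ip (X n) x + ip x x" for n
    using ip_nonneg[OF comb_in[OF assms(1)[of n] assms(2), of 1 "-1"]] nsq_comb[OF assms(1)[of n] assms(2), of 1 "-1"]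
    by simp
  ultimately have "0 \<le> a - 2 * ip x x + ip x x" by (intro LIMSEQ_le_const) auto
  then show ?thesis by simp
qed

text \<open>The representative minimises \<open>ip w w - 2 * l w\<close> over \<open>W\<close>; minimising sequences are Cauchy by
  the parallelogram identity.\<close>

lemma riesz_on_subspace:
  assumes W: "W \<subseteq> V" "W \<noteq> {}" and Wc: "\<And>a x b y. x \<in> W \<Longrightarrow> y \<in> W \<Longrightarrow> comb a x b y \<in> W"
    and l_lin: "\<And>a x b y. x \<in> W \<Longrightarrow> y \<in> W \<Longrightarrow> l (comb a x b y) = a * l x + b * l y"
    and l_bd: "\<And>x. x \<in> W \<Longrightarrow> (l x)\<^sup>2 \<le> M * ip x x"
  obtains v ws where "v \<in> V" "\<And>n::nat. ws n \<in> W" "sconv ws v" "\<And>w. w \<in> W \<Longrightarrow> ip v w = l w"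
proof -
  define J where "J w = ip w w - 2 * l w" for w
  have J_lower: "- \<bar>M\<bar> - 1 \<le> J w" if "w \<in> W" for w
  proof -
    have n: "0 \<le> ip w w" using that W ip_nonneg by auto
    have "(l w)\<^sup>2 \<le> \<bar>M\<bar> * ip w w" 
      using l_bd[OF that] mult_right_mono[OF abs_ge_self[of M] n] by linarith
    also have "\<dots> \<le> ((\<bar>M\<bar> + ip w w) / 2)\<^sup>2"
      using sum_squares_bound[of "\<bar>M\<bar>" "ip w w"] by (simp add: power2_eq_square field_simps)
    finally have "\<bar>l w\<bar> \<le> \<bar>(\<bar>M\<bar> + ip w w) / 2\<bar>" by (simp only: abs_le_square_iff)
    then show ?thesis using n by (simp add: J_def)
  qed
  define j where "j = (INF w\<in>W. J w)"
  have bdd: "bdd_below (J ` W)" using J_lower by (auto intro!: bdd_belowI2)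
  have j_le: "j \<le> J w" if "w \<in> W" for w unfolding j_def by (rule cINF_lower[OF bdd that])
  have "\<exists>w\<in>W. J w < j + 1 / real (Suc n)" for n
    using cINF_less_iff[OF W(2) bdd, of "j + 1 / real (Suc n)"] by (simp add: j_def)
  then obtain ws where ws: "\<And>n. ws n \<in> W" "\<And>n. J (ws n) < j + 1 / real (Suc n)" by metis
  have wsV: "ws n \<in> V" for n using ws W by auto
  have Jlim: "(\<lambda>n. J (ws n)) \<longlonglongrightarrow> j"
  proof (rule tendsto_sandwich[of "\<lambda>_. j"])
    show "(\<lambda>n. j + 1 / real (Suc n)) \<longlonglongrightarrow> j"
      using tendsto_add[OF tendsto_const LIMSEQ_inverse_real_of_nat, of j] by (simp add: inverse_eq_divide)
    show "\<forall>\<^sub>F n in sequentially. J (ws n) \<le> j + 1 / real (Suc n)"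
      using ws(2) by (intro always_eventually allI less_imp_le)
    show "\<forall>\<^sub>F n in sequentially. j \<le> J (ws n)"
      using j_le ws(1) by (intro always_eventually allI) auto
  qed auto
  have par: "ip (comb 1 (ws m) (-1) (ws n)) (comb 1 (ws m) (-1) (ws n)) \<le> 2 * (J (ws m) - j) + 2 * (J (ws n) - j)" for m n
  proof -
    have "j \<le> J (comb (1/2) (ws m) (1/2) (ws n))" by (intro j_le Wc ws)
    also have "\<dots> = (1/4) * ip (ws m) (ws m) + (1/2) * ip (ws m) (ws n) + (1/4) * ip (ws n) (ws n) - l (ws m) - l (ws n)"
      unfolding J_def nsq_comb[OF wsV wsV] l_lin[OF ws(1) ws(1)] by (simp add: power2_eq_square algebra_simps)
    finally show ?thesis unfolding nsq_comb[OF wsV wsV] J_def by simp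
  qed
  have "\<exists>x\<in>V. (\<lambda>n. ip (comb 1 (ws n) (-1) x) (comb 1 (ws n) (-1) x)) \<longlonglongrightarrow> 0"
  proof (rule ip_complete[OF wsV])
    fix e :: real assume "e > 0"
    then have "\<forall>\<^sub>F n in sequentially. J (ws n) < j + e / 4"
      using order_tendstoD(2)[OF Jlim, of "j + e/4"] by simp
    then obtain N where N: "\<And>n. n \<ge> N \<Longrightarrow> J (ws n) < j + e / 4" by (auto simp: eventually_sequentially)
    show "\<exists>N. \<forall>m\<ge>N. \<forall>n\<ge>N. ip (comb 1 (ws m) (-1) (ws n)) (comb 1 (ws m) (-1) (ws n)) < e"
    proof (intro exI allI impI)
      fix m n assume "N \<le> m" "N \<le> n"
      then have "J (ws m) < j + e / 4" "J (ws n) < j + e / 4" using N by auto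
      then have "2 * (J (ws m) - j) + 2 * (J (ws n) - j) < e" by (simp add: field_simps)
      then show "ip (comb 1 (ws m) (-1) (ws n)) (comb 1 (ws m) (-1) (ws n)) < e"
        using par[of m n] by (rule le_less_trans[rotated])
    qed
  qed
  then obtain v where v: "v \<in> V" "sconv ws v" by (auto simp: sconv_def)
  have "ip v w = l w" if w: "w \<in> W" for w
  proof -
    have wV: "w \<in> V" using w W by auto
    \<comment> \<open>The limit v may lie outside W, where \<open>J\<close> says nothing, so
      optimality is tested by perturbing the minimising sequence by s w and letting n tend to
      infinity.\<close>
    have "0 \<le> s * (2 * (ip v w - l w)) + s\<^sup>2 * ip w w" for s
    proof -
      have "(\<lambda>n. J (ws n) + 2 * s * (ip (ws n) w - l w) + s\<^sup>2 * ip w w) \<longlonglongrightarrow> j + 2 * s * (ip v w - l w) + s\<^sup>2 * ip w w"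
        by (intro tendsto_intros Jlim sconv_ip[OF wsV v(1) wV v(2)])
      moreover have "j \<le> J (ws n) + 2 * s * (ip (ws n) w - l w) + s\<^sup>2 * ip w w" for n
      proof -
        have "j \<le> J (comb 1 (ws n) s w)" by (intro j_le Wc ws w)
        also have "\<dots> = J (ws n) + 2 * s * (ip (ws n) w - l w) + s\<^sup>2 * ip w w"
          unfolding J_def nsq_comb[OF wsV wV] l_lin[OF ws(1) w] by (simp add: algebra_simps)
        finally show ?thesis .
      qed
      ultimately have "j \<le> j + 2 * s * (ip v w - l w) + s\<^sup>2 * ip w w" by (intro LIMSEQ_le_const) auto
      then show ?thesis by (simp add: algebra_simps)
    qed
    from quadratic_nonneg_imp_zero[OF this] show ?thesis by simp
  qed
  with v ws show ?thesis using that by blast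
qed

section \<open>Weak sequential compactness of bounded sequences\<close>

inductive_set comb_span :: "'b set \<Rightarrow> 'b set" for S :: "'b set" where
  base: "x \<in> S \<Longrightarrow> x \<in> comb_span S"
| step: "x \<in> comb_span S \<Longrightarrow> y \<in> comb_span S \<Longrightarrow> comb a x b y \<in> comb_span S"

text \<open>A diagonal subsequence converges against every \<open>X k\<close>, hence against their
  span W, and the limit functional on W is represented by some v. A general z is replaced by its
  projection onto the closure of W, so projection takes the place of a countable dense
  family.\<close>

lemma weak_sequential_compactness:
  assumes X: "\<And>n::nat. X n \<in> V" and bd: "\<And>n. ip (X n) (X n) \<le> M"
  obtains r x where "strict_mono r" "x \<in> V" "wconv (X \<circ> r) x"
proof -
  have ip_bd: "(ip (X n) z)\<^sup>2 \<le> M * ip z z" if "z \<in> V" for n z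
    using cauchy_schwarz[OF X that, of n] mult_right_mono[OF bd ip_nonneg[OF that], of n] by linarith
  have bdd_range: "bounded (range (\<lambda>n. ip (X n) z))" if "z \<in> V" for z
  proof (rule boundedI, clarify)
    fix n show "norm (ip (X n) z) \<le> sqrt (M * ip z z)"
      using real_le_rsqrt[of "\<bar>ip (X n) z\<bar>"] ip_bd[OF that, of n] by simp
  qed
  define P where "P k s \<longleftrightarrow> convergent (\<lambda>n. ip (X (s n)) (X k))" for k and s :: "nat \<Rightarrow> nat"
  interpret D: subseqs P
  proof
    fix k and s :: "nat \<Rightarrow> nat"
    have "bounded (range (\<lambda>n. ip (X (s n)) (X k)))"
      by (rule bounded_subset[OF bdd_range[OF X]]) auto
    then obtain l r where "strict_mono r" "((\<lambda>n. ip (X (s n)) (X k)) \<circ> r) \<longlonglongrightarrow> l"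
      using bounded_imp_convergent_subsequence by blast
    then show "\<exists>r'. strict_mono r' \<and> P k (s \<circ> r')"
      unfolding P_def by (auto simp: o_def convergent_def)
  qed
  define r where "r = D.diagseq"
  have r: "strict_mono r" unfolding r_def by (rule D.subseq_diagseq)
  have conv_k: "convergent (\<lambda>n. ip (X (r n)) (X k))" for k
  proof -
    \<comment> \<open>The diagonal sequence is a subsequence of the k-th refinement only from index
      \<open>Suc k\<close> on, which does not affect convergence.\<close>
    have "P k (r \<circ> ((+) (Suc k)))" unfolding r_def
    proof (rule D.diagseq_holds)
      fix q s :: "nat \<Rightarrow> nat" and n assume "strict_mono q" "P n s"
      then show "P n (s \<circ> q)"
        using convergent_subseq_convergent[of "\<lambda>i. ip (X (s i)) (X n)" q] by (simp add: P_def o_def)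
    qed
    then have "convergent (\<lambda>n. ip (X (r (n + Suc k))) (X k))" by (simp add: P_def o_def add.commute)
    then show ?thesis using convergent_ignore_initial_segment[of "\<lambda>n. ip (X (r n)) (X k)" "Suc k"] by simp
  qed
  define W where "W = comb_span (range X)"
  have WV: "w \<in> V" if "w \<in> W" for w using that unfolding W_def by induction (auto intro: X comb_in)
  have Wc: "comb a x b y \<in> W" if "x \<in> W" "y \<in> W" for a x b y using that unfolding W_def by (rule comb_span.step)
  have XW: "X n \<in> W" for n unfolding W_def by (auto intro: comb_span.base)
  have convW: "convergent (\<lambda>n. ip (X (r n)) w)" if "w \<in> W" for w
    using that unfolding W_def
  proof induction
    case (base x) then show ?case using conv_k by auto
  next
    case (step x y a b)
    have "ip (X (r n)) (comb a x b y) = a * ip (X (r n)) x + b * ip (X (r n)) y" for n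
      using WV step.hyps by (intro ip_comb_right X) (auto simp: W_def)
    then show ?case using step.IH by (simp add: convergent_add convergent_mult convergent_const)
  qed
  define l where "l w = lim (\<lambda>n. ip (X (r n)) w)" for w
  have l: "(\<lambda>n. ip (X (r n)) w) \<longlonglongrightarrow> l w" if "w \<in> W" for w
    using convW[OF that] unfolding l_def by (simp add: convergent_LIMSEQ_iff)
  have Wne: "W \<noteq> {}" using XW by auto
  have l_lin: "l (comb a x b y) = a * l x + b * l y" if "x \<in> W" "y \<in> W" for a x b y
  proof -
    have "(\<lambda>n. ip (X (r n)) (comb a x b y)) \<longlonglongrightarrow> a * l x + b * l y"
      using that by (simp add: ip_comb_right X WV) (intro tendsto_intros l that)
    then show ?thesis using l[OF Wc[OF that]] LIMSEQ_unique by blast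
  qed
  have l_bd: "(l w)\<^sup>2 \<le> M * ip w w" if "w \<in> W" for w
    by (rule LIMSEQ_le_const2[OF tendsto_power[OF l[OF that]]]) (use ip_bd[OF WV[OF that]] in auto)
  obtain v vs where v: "v \<in> V" "\<And>n::nat. vs n \<in> W" "sconv vs v" "\<And>w. w \<in> W \<Longrightarrow> ip v w = l w"
    by (rule riesz_on_subspace[of W l M]) (use WV Wne Wc l_lin l_bd in auto)
  have "(\<lambda>n. ip (X (r n)) z) \<longlonglongrightarrow> ip v z" if z: "z \<in> V" for z
  proof -
    \<comment> \<open>Riesz for the functional \<open>ip z\<close> on W produces the orthogonal
      projection p of z, together with points of W approximating it.\<close>
    obtain p ps where p: "p \<in> V" "\<And>n::nat. ps n \<in> W" "sconv ps p" "\<And>w. w \<in> W \<Longrightarrow> ip p w = ip z w"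
    proof (rule riesz_on_subspace[of W "ip z" "ip z z"])
      show "(ip z x)\<^sup>2 \<le> ip z z * ip x x" if "x \<in> W" for x using cauchy_schwarz[OF z WV[OF that]] .
    qed (use WV Wne Wc z in \<open>auto simp: ip_comb_right\<close>)
    have psV: "ps i \<in> V" and vsV: "vs i \<in> V" for i using p v WV by auto
    \<comment> \<open>Since v is itself a limit of points of W, the orthogonality of z - p to W
      extends to v.\<close>
    have "(\<lambda>n. ip (vs n) z) \<longlonglongrightarrow> ip v p"
      using sconv_ip[OF vsV v(1) p(1) v(3)] p(4) v(2) by (simp add: ip_commute vsV p(1) z)
    then have vp: "ip v p = ip v z" using sconv_ip[OF vsV v(1) z v(3)] LIMSEQ_unique by blast
    have zp: "ip (X n) z = ip (X n) p" for n using p(4)[OF XW] by (simp add: ip_commute X p(1) z)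
    \<comment> \<open>Replacing p by \<open>ps i\<close> costs an error uniform in n, which allows
      the limits in i and n to be exchanged. The constant \<open>\<bar>M\<bar> + ip v v\<close>
      dominates the squared norms of all \<open>X n\<close> and of v at once.\<close>
    have unif: "\<exists>i. \<forall>n. \<bar>ip (X n) p - ip (X n) (ps i)\<bar> < e \<and> \<bar>ip v p - ip v (ps i)\<bar> < e" if "e > 0" for e
    proof -
      define d where "d i = ip (comb 1 (ps i) (-1) p) (comb 1 (ps i) (-1) p)" for i
      have "(\<lambda>i. (\<bar>M\<bar> + ip v v) * d i) \<longlonglongrightarrow> 0"
        using p(3) unfolding sconv_def d_def by (rule tendsto_mult_right_zero)
      from order_tendstoD(2)[OF this, of "e\<^sup>2"] that
      obtain i where i: "(\<bar>M\<bar> + ip v v) * d i < e\<^sup>2" by (auto simp: eventually_sequentially)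
      have d0: "0 \<le> d i" unfolding d_def by (intro ip_nonneg comb_in psV p)
      have *: "\<bar>ip x p - ip x (ps i)\<bar> < e" if x: "x \<in> V" "ip x x \<le> \<bar>M\<bar> + ip v v" for x
      proof -
        have "(ip x p - ip x (ps i))\<^sup>2 = (ip x (comb 1 (ps i) (-1) p))\<^sup>2"
          by (simp add: ip_comb_right x psV p(1) power2_commute)
        also have "\<dots> \<le> ip x x * d i" unfolding d_def by (intro cauchy_schwarz x comb_in psV p)
        also have "\<dots> \<le> (\<bar>M\<bar> + ip v v) * d i" using x d0 mult_right_mono by blast
        also have "\<dots> < e\<^sup>2" by fact
        finally show ?thesis using \<open>e > 0\<close> power2_less_imp_less[of "\<bar>ip x p - ip x (ps i)\<bar>" e] by simp
      qed
      have "ip (X n) (X n) \<le> \<bar>M\<bar> + ip v v" for n using bd[of n] ip_nonneg[OF v(1)] by linarith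
      then show ?thesis using * X v(1) by (intro exI[of _ i]) auto
    qed
    have "(\<lambda>n. ip (X (r n)) p) \<longlonglongrightarrow> ip v p"
    proof (rule LIMSEQ_I)
      fix e :: real assume e: "e > 0"
      then obtain i where i: "\<And>n. \<bar>ip (X n) p - ip (X n) (ps i)\<bar> < e/3" "\<bar>ip v p - ip v (ps i)\<bar> < e/3"
        using unif[of "e/3"] by auto
      have "(\<lambda>n. ip (X (r n)) (ps i)) \<longlonglongrightarrow> ip v (ps i)" using l[OF p(2)] v(4)[OF p(2)] by simp
      from LIMSEQ_D[OF this, of "e/3"] e
      obtain N where N: "\<And>n. n \<ge> N \<Longrightarrow> \<bar>ip (X (r n)) (ps i) - ip v (ps i)\<bar> < e/3" by auto
      show "\<exists>no. \<forall>n\<ge>no. norm (ip (X (r n)) p - ip v p) < e"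
      proof (intro exI allI impI)
        fix n assume "N \<le> n"
        then show "norm (ip (X (r n)) p - ip v p) < e"
          using N[of n] i(1)[of "r n"] i(2) unfolding real_norm_def by linarith
      qed
    qed
    then show ?thesis using vp zp by simp
  qed
  then show ?thesis using that[OF r v(1)] by (auto simp: wconv_def o_def)
qed

lemma wconv_subseq: "wconv X x \<Longrightarrow> strict_mono r \<Longrightarrow> wconv (X \<circ> r) x"
  unfolding wconv_def using LIMSEQ_subseq_LIMSEQ[of "\<lambda>n. ip (X n) _" _ r] by (simp add: o_def)

lemma sconv_subseq: "sconv X x \<Longrightarrow> strict_mono r \<Longrightarrow> sconv (X \<circ> r) x"
  unfolding sconv_def
  using LIMSEQ_subseq_LIMSEQ[of "\<lambda>n. ip (comb 1 (X n) (-1) x) (comb 1 (X n) (-1) x)" 0 r]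
  by (simp add: o_def)

text \<open>Young's inequality from the square of x - y/2. The weight 1/4 lets half the squared
  velocity norm absorb the coupling of control and velocity in the a priori bounds.\<close>

lemma ip_le_nsq:
  assumes "x \<in> V" "y \<in> V"
  shows "ip x y \<le> ip x x + ip y y / 4"
  using ip_nonneg[OF comb_in[OF assms, of 1 "-1/2"]] nsq_comb[OF assms, of 1 "-1/2"]
  by (simp add: power2_eq_square)

lemma nsq_add_le:
  assumes "x \<in> V" "y \<in> V"
  shows "ip (comb 1 x 1 y) (comb 1 x 1 y) \<le> 2 * ip x x + 2 * ip y y"
  using ip_nonneg[OF comb_in[OF assms, of 1 "-1"]] nsq_comb[OF assms, of 1 "-1"] nsq_comb[OF assms, of 1 1]
  by simp

lemma wconv_comb:
  assumes "\<And>n. X n \<in> V" "x \<in> V" "\<And>n. Z n \<in> V" "z \<in> V" "wconv X x" "wconv Z z"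
  shows "wconv (\<lambda>n. comb a (X n) b (Z n)) (comb a x b z)"
  using assms unfolding wconv_def by (auto simp: ip_comb intro!: tendsto_intros)

lemma sconv_imp_wconv:
  assumes "\<And>n. X n \<in> V" "x \<in> V" "sconv X x"
  shows "wconv X x"
  using sconv_ip[OF assms(1,2) _ assms(3)] by (auto simp: wconv_def)

end

section \<open>The space of square integrable functions\<close>

definition L2ip :: "real \<Rightarrow> (real \<Rightarrow> 'a::{real_inner,banach,second_countable_topology}) \<Rightarrow> (real \<Rightarrow> 'a) \<Rightarrow> real" where
  "L2ip T u v = (LINT t|lebesgue_on {0..T}. inner (u t) (v t))"

definition L2comb :: "real \<Rightarrow> (real \<Rightarrow> 'a::real_vector) \<Rightarrow> real \<Rightarrow> (real \<Rightarrow> 'a) \<Rightarrow> real \<Rightarrow> 'a" where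
  "L2comb a u b v = (\<lambda>t. a *\<^sub>R u t + b *\<^sub>R v t)"

lemma finite_measure_interval: "finite_measure (lebesgue_on {0..T::real})"
  by (rule finite_measure_lebesgue_on) simp

lemma integrable_const_interval [simp]: "integrable (lebesgue_on {0..T::real}) (\<lambda>_. c)"
  using finite_measure.integrable_const[OF finite_measure_interval] .

lemma L2fun_measurable: "u \<in> L2fun T \<Longrightarrow> u \<in> borel_measurable (lebesgue_on {0..T})"
  by (simp add: L2fun_def)

lemma L2fun_integrable_nsq: "u \<in> L2fun T \<Longrightarrow> integrable (lebesgue_on {0..T}) (\<lambda>t. (norm (u t))\<^sup>2)"
  by (simp add: L2fun_def)

lemma integrable_inner_L2fun:
  fixes u v :: "real \<Rightarrow> 'a::{real_inner,banach,second_countable_topology}"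
  assumes "u \<in> L2fun T" "v \<in> L2fun T"
  shows "integrable (lebesgue_on {0..T}) (\<lambda>t. inner (u t) (v t))"
proof (rule Bochner_Integration.integrable_bound)
  show "integrable (lebesgue_on {0..T}) (\<lambda>t. (norm (u t))\<^sup>2 + (norm (v t))\<^sup>2)"
    using assms by (intro Bochner_Integration.integrable_add L2fun_integrable_nsq)
  show "(\<lambda>t. inner (u t) (v t)) \<in> borel_measurable (lebesgue_on {0..T})"
    using assms[THEN L2fun_measurable] by measurable
  have "norm (inner a b) \<le> norm ((norm a)\<^sup>2 + (norm b)\<^sup>2)" for a b :: 'a
    using Cauchy_Schwarz_ineq2[of a b] sum_squares_bound[of "norm a" "norm b"]
    by simp
  then show "AE t in lebesgue_on {0..T}. norm (inner (u t) (v t)) \<le> norm ((norm (u t))\<^sup>2 + (norm (v t))\<^sup>2)"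
    by simp
qed

lemma norm_sq_add_le:
  fixes a b :: "'a::real_inner"
  shows "(norm (a + b))\<^sup>2 \<le> 2 * (norm a)\<^sup>2 + 2 * (norm b)\<^sup>2"
proof -
  have "(norm (a + b))\<^sup>2 \<le> (norm a + norm b)\<^sup>2" by (intro power_mono norm_triangle_ineq) auto
  also have "\<dots> \<le> 2 * (norm a)\<^sup>2 + 2 * (norm b)\<^sup>2"
    using sum_squares_bound[of "norm a" "norm b"] by (simp add: power2_sum)
  finally show ?thesis .
qed

lemma L2comb_in:
  fixes u v :: "real \<Rightarrow> 'a::{real_inner,banach,second_countable_topology}"
  assumes "u \<in> L2fun T" "v \<in> L2fun T"
  shows "L2comb a u b v \<in> L2fun T"
proof -
  have meas: "L2comb a u b v \<in> borel_measurable (lebesgue_on {0..T})"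
    using assms[THEN L2fun_measurable] unfolding L2comb_def by measurable
  moreover have "integrable (lebesgue_on {0..T}) (\<lambda>t. (norm (L2comb a u b v t))\<^sup>2)"
  proof (rule Bochner_Integration.integrable_bound)
    show "integrable (lebesgue_on {0..T}) (\<lambda>t. 2 * a\<^sup>2 * (norm (u t))\<^sup>2 + 2 * b\<^sup>2 * (norm (v t))\<^sup>2)"
      using assms by (intro Bochner_Integration.integrable_add integrable_mult_right L2fun_integrable_nsq)
    show "(\<lambda>t. (norm (L2comb a u b v t))\<^sup>2) \<in> borel_measurable (lebesgue_on {0..T})"
      using meas by measurable
    show "AE t in lebesgue_on {0..T}. norm ((norm (L2comb a u b v t))\<^sup>2)
        \<le> norm (2 * a\<^sup>2 * (norm (u t))\<^sup>2 + 2 * b\<^sup>2 * (norm (v t))\<^sup>2)"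
    proof (rule AE_I2)
      fix t show "norm ((norm (L2comb a u b v t))\<^sup>2)
        \<le> norm (2 * a\<^sup>2 * (norm (u t))\<^sup>2 + 2 * b\<^sup>2 * (norm (v t))\<^sup>2)"
        using norm_sq_add_le[of "a *\<^sub>R u t" "b *\<^sub>R v t"]
        by (simp add: L2comb_def power_mult_distrib mult.assoc)
    qed
  qed
  ultimately show ?thesis by (simp add: L2fun_def)
qed

lemma L2fun_diff: "u \<in> L2fun T \<Longrightarrow> v \<in> L2fun T \<Longrightarrow> (\<lambda>t. u t - v t) \<in> L2fun T"
  for u v :: "real \<Rightarrow> 'a::{real_inner,banach,second_countable_topology}"
  using L2comb_in[of u T v 1 "-1"] by (simp add: L2comb_def)

lemma L2fun_add: "u \<in> L2fun T \<Longrightarrow> v \<in> L2fun T \<Longrightarrow> (\<lambda>t. u t + v t) \<in> L2fun T"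
  for u v :: "real \<Rightarrow> 'a::{real_inner,banach,second_countable_topology}"
  using L2comb_in[of u T v 1 1] by (simp add: L2comb_def)

lemma L2fun_bounded:
  fixes u :: "real \<Rightarrow> 'a::{banach,second_countable_topology}"
  assumes "u \<in> borel_measurable (lebesgue_on {0..T})" "\<And>t. t \<in> {0..T} \<Longrightarrow> norm (u t) \<le> B"
  shows "u \<in> L2fun T"
proof -
  have "integrable (lebesgue_on {0..T}) (\<lambda>t. (norm (u t))\<^sup>2)"
  proof (rule finite_measure.integrable_const_bound[OF finite_measure_interval])
    show "AE t in lebesgue_on {0..T}. norm ((norm (u t))\<^sup>2) \<le> B\<^sup>2"
      using assms(2) by (intro AE_I2) (auto intro!: power_mono)
  qed (use assms(1) in measurable)
  then show ?thesis using assms(1) by (simp add: L2fun_def)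
qed

lemma integrable_L2fun:
  fixes u :: "real \<Rightarrow> 'a::{banach,second_countable_topology}"
  assumes "u \<in> L2fun T"
  shows "integrable (lebesgue_on {0..T}) u"
proof (rule Bochner_Integration.integrable_bound)
  show "integrable (lebesgue_on {0..T}) (\<lambda>t. 1 + (norm (u t))\<^sup>2)"
    using assms by (intro Bochner_Integration.integrable_add L2fun_integrable_nsq) auto
  have "norm a \<le> norm (1 + (norm a)\<^sup>2)" for a :: 'a
    using sum_squares_bound[of 1 "norm a"] norm_ge_zero[of a] by (simp del: norm_ge_zero)
  then show "AE t in lebesgue_on {0..T}. norm (u t) \<le> norm (1 + (norm (u t))\<^sup>2)" by simp
qed (use assms L2fun_measurable in auto)

lemma L2ip_self: "L2ip T u u = (LINT t|lebesgue_on {0..T}. (norm (u t))\<^sup>2)"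
  by (simp add: L2ip_def power2_norm_eq_inner)

lemma nn_integral_L2ip:
  assumes "u \<in> L2fun T"
  shows "(\<integral>\<^sup>+t. ennreal ((norm (u t))\<^sup>2) \<partial>lebesgue_on {0..T}) = ennreal (L2ip T u u)"
  unfolding L2ip_self using assms by (intro nn_integral_eq_integral L2fun_integrable_nsq) auto

text \<open>The Riesz-Fischer argument: a fast subsequence has increments whose L^1 norms are
  summable, so it converges almost everywhere, and Fatou's lemma turns the Cauchy bounds into L^2
  convergence of the whole sequence.\<close>

lemma L2_complete:
  fixes X :: "nat \<Rightarrow> real \<Rightarrow> 'a::{real_inner,banach,second_countable_topology}"
  assumes X: "\<And>n. X n \<in> L2fun T"
    and cauchy: "\<And>e. e > 0 \<Longrightarrow> \<exists>N. \<forall>m\<ge>N. \<forall>n\<ge>N.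
        L2ip T (\<lambda>t. X m t - X n t) (\<lambda>t. X m t - X n t) < e"
  shows "\<exists>v\<in>L2fun T. (\<lambda>n. L2ip T (\<lambda>t. X n t - v t) (\<lambda>t. X n t - v t)) \<longlonglongrightarrow> 0"
proof -
  let ?M = "lebesgue_on {0..T}"
  define q where "q m n = L2ip T (\<lambda>t. X m t - X n t) (\<lambda>t. X m t - X n t)" for m n
  note [measurable] = L2fun_measurable[OF X]
  have XX: "(\<lambda>t. X m t - X n t) \<in> L2fun T" for m n by (intro L2fun_diff X)
  have "\<exists>r. \<forall>k. (\<forall>m\<ge>r k. q m (r k) < (1/4)^k) \<and> r k < r (Suc k)"
  proof (rule dependent_nat_choice)
    show "\<exists>n. \<forall>m\<ge>n. q m n < (1/4)^0"
      using cauchy[of 1] unfolding q_def by fastforce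
    fix x k assume "\<forall>m\<ge>x. q m x < (1/4)^k"
    obtain N where N: "\<forall>m\<ge>N. \<forall>n\<ge>N. q m n < (1/4)^Suc k"
      using cauchy[of "(1/4)^Suc k"] unfolding q_def by auto
    show "\<exists>y. (\<forall>m\<ge>y. q m y < (1/4)^Suc k) \<and> x < y"
      by (rule exI[of _ "N + x + 1"]) (use N in auto)
  qed
  then obtain r where r: "\<And>k m. m \<ge> r k \<Longrightarrow> q m (r k) < (1/4)^k" "\<And>k. r k < r (Suc k)" by blast
  define f where "f k t = X (r (Suc k)) t - X (r k) t" for k t
  have fL2: "f k \<in> L2fun T" for k unfolding f_def by (rule XX)
  have f_int: "(\<integral>\<^sup>+t. ennreal (norm (f k t)) \<partial>?M) \<le> ennreal ((1 + \<bar>T\<bar>) * (1/2)^k)" for k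
  proof -
    have "(\<integral>\<^sup>+t. ennreal (norm (f k t)) \<partial>?M) = ennreal (LINT t|?M. norm (f k t))"
      using integrable_L2fun[OF fL2] by (intro nn_integral_eq_integral) auto
    also have "(LINT t|?M. norm (f k t)) \<le> (LINT t|?M. 2^k * (norm (f k t))\<^sup>2 + (1/2)^k)"
    proof (rule integral_mono)
      \<comment> \<open>The weight 2^k balances the two terms: squared distances below 4^-k and the
        constant term both contribute order 2^-k after integration.\<close>
      show "norm (f k t) \<le> 2^k * (norm (f k t))\<^sup>2 + (1/2)^k" for t
      proof -
        define a :: real where "a = 2^k"
        have a: "a > 0" "(1/2)^k = 1 / a" by (auto simp: a_def power_one_over)
        have "a * norm (f k t) \<le> (a * norm (f k t))\<^sup>2 + 1"
          using sum_squares_bound[of "a * norm (f k t)" 1] mult_nonneg_nonneg[OF less_imp_le[OF a(1)] norm_ge_zero[of "f k t"]] by simp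
        then show ?thesis unfolding a(2) a_def[symmetric] using a(1) by (simp add: field_simps power2_eq_square)
      qed
      show "integrable ?M (\<lambda>t. 2^k * (norm (f k t))\<^sup>2 + (1/2)^k)"
        by (intro Bochner_Integration.integrable_add integrable_mult_right L2fun_integrable_nsq fL2) simp
    qed (use integrable_L2fun[OF fL2] in auto)
    also have "\<dots> = 2^k * q (r (Suc k)) (r k) + measure ?M {0..T} * (1/2)^k"
      unfolding q_def L2ip_self f_def[symmetric]
      by (subst Bochner_Integration.integral_add) (auto intro: integrable_mult_right L2fun_integrable_nsq fL2)
    also have "\<dots> \<le> 2^k * (1/4)^k + \<bar>T\<bar> * (1/2)^k"
    proof (rule add_mono)
      show "2^k * q (r (Suc k)) (r k) \<le> 2^k * (1/4)^k"
        using r(1)[of k "r (Suc k)"] r(2)[of k] by simp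
      show "measure ?M {0..T} * (1/2)^k \<le> \<bar>T\<bar> * (1/2)^k"
        by (intro mult_right_mono) (auto simp: measure_restrict_space)
    qed
    also have "\<dots> = (1 + \<bar>T\<bar>) * (1/2)^k" by (simp add: algebra_simps flip: power_mult_distrib)
    finally show ?thesis by (simp add: ennreal_leI)
  qed
  have "(\<integral>\<^sup>+t. (\<Sum>k. ennreal (norm (f k t))) \<partial>?M) = (\<Sum>k. \<integral>\<^sup>+t. ennreal (norm (f k t)) \<partial>?M)"
    by (rule nn_integral_suminf) (simp add: f_def)
  also have "\<dots> \<le> (\<Sum>k. ennreal ((1 + \<bar>T\<bar>) * (1/2)^k))"
    by (intro suminf_le f_int) auto
  also have "\<dots> = ennreal (\<Sum>k. (1 + \<bar>T\<bar>) * (1/2)^k)"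
    by (rule suminf_ennreal2) (auto intro!: summable_mult summable_geometric)
  finally have "(\<integral>\<^sup>+t. (\<Sum>k. ennreal (norm (f k t))) \<partial>?M) \<noteq> \<infinity>" by (auto simp: top_unique)
  then have "AE t in ?M. (\<Sum>k. ennreal (norm (f k t))) \<noteq> \<infinity>"
    by (intro nn_integral_PInf_AE) (auto simp: f_def)
  then have AE_conv: "AE t in ?M. convergent (\<lambda>k. X (r k) t)"
  proof (rule AE_mp, intro AE_I2 impI)
    fix t assume "(\<Sum>k. ennreal (norm (f k t))) \<noteq> \<infinity>"
    then have "summable (\<lambda>k. norm (f k t))" by (intro summable_suminf_not_top) auto
    then have "summable (\<lambda>k. f k t)" by (rule summable_norm_cancel)
    then have "convergent (\<lambda>n. \<Sum>k<n. f k t)" by (simp add: summable_iff_convergent)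
    then have "convergent (\<lambda>n. X (r n) t - X (r 0) t)"
      by (simp add: f_def sum_lessThan_telescope[of "\<lambda>k. X (r k) t"])
    from convergent_add[OF this convergent_const[of "X (r 0) t"]]
    show "convergent (\<lambda>k. X (r k) t)" by simp
  qed
  define v where "v t = lim (\<lambda>k. X (r k) t)" for t
  have v_meas [measurable]: "v \<in> borel_measurable ?M" unfolding v_def by measurable
  have v_lim: "AE t in ?M. (\<lambda>k. X (r k) t) \<longlonglongrightarrow> v t"
    using AE_conv unfolding v_def by (auto simp: convergent_LIMSEQ_iff)
  have r_ge: "k \<le> r k" for k by (rule seq_suble) (simp add: strict_mono_Suc_iff r(2))
  \<comment> \<open>Fatou along the a.e. convergent subsequence: a bound on the distance of X n to
    all late terms passes to its distance to v.\<close>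
  have bound: "(\<integral>\<^sup>+t. ennreal ((norm (X n t - v t))\<^sup>2) \<partial>?M) \<le> ennreal e"
    if "\<And>m. m \<ge> N \<Longrightarrow> q m n \<le> e" for n N e
  proof -
    have "(\<integral>\<^sup>+t. ennreal ((norm (X n t - v t))\<^sup>2) \<partial>?M)
        = (\<integral>\<^sup>+t. liminf (\<lambda>k. ennreal ((norm (X (r k) t - X n t))\<^sup>2)) \<partial>?M)"
    proof (rule nn_integral_cong_AE, rule AE_mp[OF v_lim], intro AE_I2 impI)
      fix t assume "(\<lambda>k. X (r k) t) \<longlonglongrightarrow> v t"
      then have "(\<lambda>k. ennreal ((norm (X (r k) t - X n t))\<^sup>2)) \<longlonglongrightarrow> ennreal ((norm (v t - X n t))\<^sup>2)"
        by (intro tendsto_intros)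
      then show "ennreal ((norm (X n t - v t))\<^sup>2) = liminf (\<lambda>k. ennreal ((norm (X (r k) t - X n t))\<^sup>2))"
        using lim_imp_Liminf[OF sequentially_bot] by (metis norm_minus_commute)
    qed
    also have "\<dots> \<le> liminf (\<lambda>k. \<integral>\<^sup>+t. ennreal ((norm (X (r k) t - X n t))\<^sup>2) \<partial>?M)"
      by (rule nn_integral_liminf) measurable
    also have "\<dots> = liminf (\<lambda>k. ennreal (q (r k) n))"
      by (simp add: q_def nn_integral_L2ip[OF XX])
    also have "\<dots> \<le> liminf (\<lambda>k. ennreal e)"
    proof (rule Liminf_mono)
      show "\<forall>\<^sub>F k in sequentially. ennreal (q (r k) n) \<le> ennreal e"
        using eventually_ge_at_top[of N] by eventually_elim (intro ennreal_leI that, use r_ge le_trans in blast)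
    qed
    finally show ?thesis by (simp add: Liminf_const)
  qed
  have diffL2: "(\<lambda>t. X n t - v t) \<in> L2fun T \<and> L2ip T (\<lambda>t. X n t - v t) (\<lambda>t. X n t - v t) \<le> e"
    if b: "\<And>m. m \<ge> N \<Longrightarrow> q m n \<le> e" and e: "0 \<le> e" for n N e
  proof -
    have "integrable ?M (\<lambda>t. (norm (X n t - v t))\<^sup>2)"
    proof (rule integrableI_bounded)
      show "(\<integral>\<^sup>+ t. ennreal (norm ((norm (X n t - v t))\<^sup>2)) \<partial>?M) < \<infinity>"
        using bound[OF b, of N] by (simp add: le_less_trans)
    qed measurable
    then have *: "(\<lambda>t. X n t - v t) \<in> L2fun T" by (simp add: L2fun_def)
    then show ?thesis using nn_integral_L2ip[OF *] bound[OF b, of N] e by simp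
  qed
  obtain N1 where N1: "\<forall>m\<ge>N1. \<forall>n\<ge>N1. q m n < 1" using cauchy[of 1] unfolding q_def by auto
  have "(\<lambda>t. X N1 t - v t) \<in> L2fun T" using diffL2[of N1 N1 1] N1 less_imp_le by auto
  from L2fun_diff[OF X[of N1] this] have vL2: "v \<in> L2fun T" by simp
  have "(\<lambda>n. L2ip T (\<lambda>t. X n t - v t) (\<lambda>t. X n t - v t)) \<longlonglongrightarrow> 0"
  proof (rule LIMSEQ_I)
    fix e :: real assume e: "e > 0"
    obtain N where N: "\<forall>m\<ge>N. \<forall>n\<ge>N. q m n < e/2" using cauchy[of "e/2"] e unfolding q_def by auto
    show "\<exists>no. \<forall>n\<ge>no. norm (L2ip T (\<lambda>t. X n t - v t) (\<lambda>t. X n t - v t) - 0) < e"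
    proof (intro exI allI impI)
      fix n assume "N \<le> n"
      then have "L2ip T (\<lambda>t. X n t - v t) (\<lambda>t. X n t - v t) \<le> e/2"
        using diffL2[of N n "e/2"] N e less_imp_le by auto
      moreover have "0 \<le> L2ip T (\<lambda>t. X n t - v t) (\<lambda>t. X n t - v t)" by (simp add: L2ip_self)
      ultimately show "norm (L2ip T (\<lambda>t. X n t - v t) (\<lambda>t. X n t - v t) - 0) < e" using e by simp
    qed
  qed
  with vL2 show ?thesis by blast
qed

interpretation L2: semi_hilbert "L2fun T" "L2ip T" L2comb for T
proof
  fix x y z :: "real \<Rightarrow> 'a" and a b assume xyz: "x \<in> L2fun T" "y \<in> L2fun T" "z \<in> L2fun T"
  show "L2ip T (L2comb a x b y) z = a * L2ip T x z + b * L2ip T y z"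
    unfolding L2ip_def L2comb_def inner_add_left inner_scaleR_left
    using integrable_inner_L2fun[OF xyz(1,3)] integrable_inner_L2fun[OF xyz(2,3)] by simp
next
  fix X :: "nat \<Rightarrow> real \<Rightarrow> 'a"
  assume "\<And>n. X n \<in> L2fun T" "\<And>e. e > 0 \<Longrightarrow> \<exists>N. \<forall>m\<ge>N. \<forall>n\<ge>N.
      L2ip T (L2comb 1 (X m) (-1) (X n)) (L2comb 1 (X m) (-1) (X n)) < e"
  then show "\<exists>x\<in>L2fun T. (\<lambda>n. L2ip T (L2comb 1 (X n) (-1) x) (L2comb 1 (X n) (-1) x)) \<longlonglongrightarrow> 0"
    using L2_complete[of X T] by (simp add: L2comb_def)
qed (auto simp: L2comb_in L2ip_self, simp add: L2ip_def inner_commute)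

text \<open>The same theory on the state space supplies gradients by Riesz representation and weak
  limits of bounded subgradients.\<close>

interpretation Hilb: semi_hilbert "UNIV :: 'a::{real_inner,banach} set" inner "\<lambda>a x b y. a *\<^sub>R x + b *\<^sub>R y"
proof
  fix X :: "nat \<Rightarrow> 'a"
  assume c: "\<And>e. e > 0 \<Longrightarrow> \<exists>N. \<forall>m\<ge>N. \<forall>n\<ge>N.
      inner (1 *\<^sub>R X m + (-1) *\<^sub>R X n) (1 *\<^sub>R X m + (-1) *\<^sub>R X n) < e"
  have "Cauchy X"
  proof (rule CauchyI)
    fix e :: real assume e: "0 < e"
    then obtain N where N: "\<And>m n. m \<ge> N \<Longrightarrow> n \<ge> N \<Longrightarrow> (norm (X m - X n))\<^sup>2 < e\<^sup>2"
      using c[of "e\<^sup>2"] by (auto simp: power2_norm_eq_inner)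
    then show "\<exists>M. \<forall>m\<ge>M. \<forall>n\<ge>M. norm (X m - X n) < e"
      using e by (intro exI[of _ N] allI impI power2_less_imp_less[of _ e]) auto
  qed
  then obtain x where "X \<longlonglongrightarrow> x" by (auto simp: Cauchy_convergent_iff convergent_def)
  then have "(\<lambda>n. (norm (X n - x))\<^sup>2) \<longlonglongrightarrow> (norm (x - x))\<^sup>2" by (intro tendsto_intros)
  then show "\<exists>x\<in>UNIV. (\<lambda>n. inner (1 *\<^sub>R X n + (-1) *\<^sub>R x) (1 *\<^sub>R X n + (-1) *\<^sub>R x)) \<longlonglongrightarrow> 0"
    by (auto simp: power2_norm_eq_inner)
qed (auto simp: inner_add_left, simp add: inner_commute)

section \<open>Sobolev functions and the topologies\<close>

text \<open>Moving the time t from the measure into an indicator lets all times share one measure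
  space, so that integrals up to t become L^2 pairings on the whole interval.\<close>

lemma integral_lebesgue_on_initial:
  fixes v :: "real \<Rightarrow> 'a::{banach,second_countable_topology}"
  assumes "t \<in> {0..T}"
  shows "integral\<^sup>L (lebesgue_on {0..t}) v = (LINT s|lebesgue_on {0..T}. indicator {0..t} s *\<^sub>R v s)"
proof -
  have "indicator {0..T} s *\<^sub>R indicator {0..t} s *\<^sub>R v s = indicator {0..t} s *\<^sub>R v s" for s
    using assms by (auto simp: indicator_def)
  then show ?thesis by (simp add: integral_restrict_space del: scaleR_scaleR scaleR_cancel_right)
qed

text \<open>Half-lines form an intersection-stable generator of the Borel sets, so the integral
  vanishes over every Borel set, then over every Lebesgue set, and a density with this property is
  zero almost everywhere.\<close>

lemma AE_zero_if_indefinite_integral_zero: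
  fixes v :: "real \<Rightarrow> 'a::{banach,second_countable_topology}"
  assumes T: "0 \<le> T" and int: "integrable (lebesgue_on {0..T}) v"
    and zero: "\<And>t. t \<in> {0..T} \<Longrightarrow> integral\<^sup>L (lebesgue_on {0..t}) v = 0"
  shows "AE t in lebesgue_on {0..T}. v t = 0"
proof -
  \<comment> \<open>Extension by zero to the whole line reduces integrals over half-lines to the
    assumed integrals over initial intervals.\<close>
  define f where "f s = indicator {0..T} s *\<^sub>R v s" for s
  have f: "integrable lebesgue f" unfolding f_def using int by (simp add: integrable_restrict_space)
  have f_ind: "integrable lebesgue (\<lambda>s. indicator A s *\<^sub>R f s)" if "A \<in> sets lebesgue" for A
    using f that by (rule integrable_mult_indicator[rotated])
  have f_int: "(LINT s|lebesgue. f s) = 0"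
    using zero[of T] T by (simp add: f_def integral_restrict_space)
  have borel0: "(LINT s|lebesgue. indicator A s *\<^sub>R f s) = 0" if "A \<in> sets borel" for A
  proof -
    have "Int_stable (range (\<lambda>a::real. {..a}))" by (auto simp: Int_stable_def)
    moreover have "range (\<lambda>a::real. {..a}) \<subseteq> Pow UNIV" by simp
    moreover have "A \<in> sigma_sets UNIV (range (\<lambda>a::real. {..a}))"
      using that by (simp add: borel_eq_atMost)
    ultimately show ?thesis
    proof (induction rule: sigma_sets_induct_disjoint)
      case (basic A)
      then obtain a where a: "A = {..a}" by auto
      consider "a < 0" | "a \<in> {0..T}" | "a > T" using T by fastforce
      then show ?case
      proof cases
        case 1
        then have "(\<lambda>s. indicator A s *\<^sub>R f s) = (\<lambda>s. 0)" by (auto simp: a f_def indicator_def)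
        then show ?thesis by simp
      next
        case 2
        then have "(\<lambda>s. indicator A s *\<^sub>R f s) = (\<lambda>s. indicator {0..a} s *\<^sub>R v s)"
          by (auto simp: a f_def indicator_def)
        then show ?thesis using zero[OF 2] by (simp add: integral_restrict_space)
      next
        case 3
        then have "(\<lambda>s. indicator A s *\<^sub>R f s) = (\<lambda>s. f s)" by (auto simp: a f_def indicator_def)
        then show ?thesis using f_int by simp
      qed
    next
      case empty then show ?case by simp
    next
      case (compl A)
      then have A: "A \<in> sets borel" by (simp add: borel_eq_atMost)
      have "(\<lambda>s. indicator (UNIV - A) s *\<^sub>R f s) = (\<lambda>s. f s - indicator A s *\<^sub>R f s)"
        by (auto simp: indicator_def)
      then show ?case using compl f_int f f_ind[of A] A by simp
    next
      case (union A)
      then have A: "A i \<in> sets borel" for i by (auto simp: borel_eq_atMost)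
      have "(LINT s:(\<Union>i. A i)|lebesgue. f s) = (\<Sum>i. (LINT s:A i|lebesgue. f s))"
      proof (rule lebesgue_integral_countable_add)
        show "A i \<in> sets lebesgue" for i using A by auto
        show "A i \<inter> A j = {}" if "i \<noteq> j" for i j
          using union that by (auto simp: disjoint_family_on_def)
        show "set_integrable lebesgue (\<Union> (range A)) f"
          unfolding set_integrable_def using A by (intro f_ind) auto
      qed
      then show ?case using union by (simp add: set_lebesgue_integral_def)
    qed
  qed
  show ?thesis
  proof (rule sigma_finite_measure.density_zero[OF _ int])
    show "sigma_finite_measure (lebesgue_on {0..T})"
      using finite_measure_interval by (rule finite_measure.axioms)
    fix A :: "real set" assume "A \<in> sets (lebesgue_on {0..T})"
    then have A: "A \<in> sets lebesgue" by (auto simp: sets_restrict_space)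
    \<comment> \<open>A Lebesgue set differs from a Borel set only by part of a null set, which the
      integral does not see.\<close>
    then obtain S N N' where SN: "A = S \<union> N" "N \<subseteq> N'" "N' \<in> null_sets lborel" "S \<in> sets lborel"
      by (rule sets_completionE)
    have N': "N' \<in> null_sets lebesgue" using SN by (simp add: null_sets_completionI)
    have "(LINT s:A|lebesgue_on {0..T}. v s) = (LINT s|lebesgue. indicator A s *\<^sub>R f s)"
      unfolding set_lebesgue_integral_def f_def
      by (simp add: integral_restrict_space mult.commute)
    also have "\<dots> = (LINT s|lebesgue. indicator S s *\<^sub>R f s)"
    proof (rule integral_cong_AE)
      show "(\<lambda>s. indicator A s *\<^sub>R f s) \<in> borel_measurable lebesgue"
        using f_ind[OF A] by auto
      show "(\<lambda>s. indicator S s *\<^sub>R f s) \<in> borel_measurable lebesgue"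
        using f_ind[of S] SN(4) by auto
      show "AE x in lebesgue. indicator A x *\<^sub>R f x = indicator S x *\<^sub>R f x"
        by (rule AE_I'[OF N']) (use SN in \<open>auto simp: indicator_def\<close>)
    qed
    also have "\<dots> = 0" using borel0[of S] SN by simp
    finally show "(LINT s:A|lebesgue_on {0..T}. v s) = 0" .
  qed
qed

lemma integrable_indicator_L2fun:
  fixes v :: "real \<Rightarrow> 'a::{banach,second_countable_topology}"
  assumes "v \<in> L2fun T" "A \<in> sets (lebesgue_on {0..T})"
  shows "integrable (lebesgue_on {0..T}) (\<lambda>s. indicator A s *\<^sub>R v s)"
  using integrable_L2fun[OF assms(1)] assms(2) by (rule integrable_mult_indicator[rotated])

lemma initial_interval_sets: "t \<in> {0..T::real} \<Longrightarrow> {0..t} \<in> sets (lebesgue_on {0..T})"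
  by (auto simp: sets_restrict_space intro!: image_eqI[of _ _ "{0..t}"])

lemma
  assumes "y \<in> H1fun T"
  shows h1deriv_L2fun: "h1deriv T y \<in> L2fun T"
    and h1deriv_integral: "t \<in> {0..T} \<Longrightarrow> y t = y 0 + integral\<^sup>L (lebesgue_on {0..t}) (h1deriv T y)"
proof -
  have "\<exists>y'. y' \<in> L2fun T \<and> (\<forall>t\<in>{0..T}. y t = y 0 + integral\<^sup>L (lebesgue_on {0..t}) y')"
    using assms by (auto simp: H1fun_def)
  from someI_ex[OF this, folded h1deriv_def]
  show "h1deriv T y \<in> L2fun T"
    and "t \<in> {0..T} \<Longrightarrow> y t = y 0 + integral\<^sup>L (lebesgue_on {0..t}) (h1deriv T y)"
    by blast+
qed

lemma H1fun_outside: "y \<in> H1fun T \<Longrightarrow> t \<notin> {0..T} \<Longrightarrow> y t = 0"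
  by (simp add: H1fun_def)

lemma integral_initial_diff:
  fixes u v :: "real \<Rightarrow> 'a::{banach,second_countable_topology}"
  assumes "u \<in> L2fun T" "v \<in> L2fun T" "t \<in> {0..T}"
  shows "integral\<^sup>L (lebesgue_on {0..t}) (\<lambda>s. u s - v s) =
      integral\<^sup>L (lebesgue_on {0..t}) u - integral\<^sup>L (lebesgue_on {0..t}) v"
  unfolding integral_lebesgue_on_initial[OF assms(3)] scaleR_diff_right
  by (intro Bochner_Integration.integral_diff integrable_indicator_L2fun assms initial_interval_sets)

text \<open>\<open>h1deriv\<close> is a Hilbert choice, so it can be identified with a concrete
  density only up to a null set; the two densities have the same indefinite integral.\<close>

lemma h1deriv_AE_unique:
  fixes y :: "real \<Rightarrow> 'a::{real_inner,banach,second_countable_topology}"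
  assumes T: "0 \<le> T" and y: "y \<in> H1fun T" and v: "v \<in> L2fun T"
    and eq: "\<And>t. t \<in> {0..T} \<Longrightarrow> y t = y 0 + integral\<^sup>L (lebesgue_on {0..t}) v"
  shows "AE t in lebesgue_on {0..T}. h1deriv T y t = v t"
proof -
  note d = h1deriv_L2fun[OF y]
  have "AE t in lebesgue_on {0..T}. h1deriv T y t - v t = 0"
  proof (rule AE_zero_if_indefinite_integral_zero[OF T])
    show "integrable (lebesgue_on {0..T}) (\<lambda>t. h1deriv T y t - v t)"
      by (intro integrable_L2fun L2fun_diff d v)
    fix t assume t: "t \<in> {0..T}"
    show "integral\<^sup>L (lebesgue_on {0..t}) (\<lambda>t. h1deriv T y t - v t) = 0"
      using h1deriv_integral[OF y t] eq[OF t] by (simp add: integral_initial_diff[OF d v t])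
  qed
  then show ?thesis by simp
qed

lemma
  fixes y z :: "real \<Rightarrow> 'a::{real_inner,banach,second_countable_topology}"
  assumes T: "0 \<le> T" and y: "y \<in> H1fun T" and z: "z \<in> H1fun T"
  shows H1fun_diff: "(\<lambda>t. y t - z t) \<in> H1fun T"
    and h1deriv_diff: "AE t in lebesgue_on {0..T}. h1deriv T (\<lambda>t. y t - z t) t = h1deriv T y t - h1deriv T z t"
proof -
  note d = h1deriv_L2fun[OF y] h1deriv_L2fun[OF z]
  have eq: "y t - z t = y 0 - z 0 + integral\<^sup>L (lebesgue_on {0..t}) (\<lambda>t. h1deriv T y t - h1deriv T z t)"
    if t: "t \<in> {0..T}" for t
    unfolding integral_initial_diff[OF d t]
    using h1deriv_integral[OF y t] h1deriv_integral[OF z t] by (simp add: algebra_simps)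
  show *: "(\<lambda>t. y t - z t) \<in> H1fun T"
    unfolding H1fun_def mem_Collect_eq
    by (intro conjI allI impI bexI[OF _ L2fun_diff[OF d]] ballI eq)
      (simp_all add: H1fun_outside[OF y] H1fun_outside[OF z])
  show "AE t in lebesgue_on {0..T}. h1deriv T (\<lambda>t. y t - z t) t = h1deriv T y t - h1deriv T z t"
    by (rule h1deriv_AE_unique[OF T * L2fun_diff[OF d]]) (rule eq)
qed

lemma L2fun_indicator_const:
  fixes w :: "'a::{banach,second_countable_topology}"
  assumes "A \<in> sets (lebesgue_on {0..T})"
  shows "(\<lambda>s. indicator A s *\<^sub>R w) \<in> L2fun T"
proof (rule L2fun_bounded)
  show "(\<lambda>s. indicator A s *\<^sub>R w) \<in> borel_measurable (lebesgue_on {0..T})"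
    using assms by measurable
  show "norm (indicator A s *\<^sub>R w) \<le> norm w" for s by (auto simp: indicator_def)
qed

text \<open>Evaluation at time t in direction w is an L^2 pairing of the derivative with an
  indicator. With a common initial value, weakly convergent derivatives thus give weakly convergent
  values at every time.\<close>

lemma inner_H1fun:
  fixes y :: "real \<Rightarrow> 'a::{real_inner,banach,second_countable_topology}"
  assumes y: "y \<in> H1fun T" and t: "t \<in> {0..T}"
  shows "inner (y t) w = inner (y 0) w + L2ip T (h1deriv T y) (\<lambda>s. indicator {0..t} s *\<^sub>R w)"
proof -
  have "inner (y t) w = inner (y 0) w + inner (LINT s|lebesgue_on {0..T}. indicator {0..t} s *\<^sub>R h1deriv T y s) w"
    using h1deriv_integral[OF y t] by (metis inner_add_left integral_lebesgue_on_initial[OF t])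
  also have "inner (LINT s|lebesgue_on {0..T}. indicator {0..t} s *\<^sub>R h1deriv T y s) w
      = (LINT s|lebesgue_on {0..T}. inner (indicator {0..t} s *\<^sub>R h1deriv T y s) w)"
    using integrable_indicator_L2fun[OF h1deriv_L2fun[OF y] initial_interval_sets[OF t]]
    by (simp only: integral_inner_left)
  finally show ?thesis by (simp add: L2ip_def)
qed

lemma continuous_on_indefinite_integral:
  fixes v :: "real \<Rightarrow> 'a::{banach,second_countable_topology}"
  assumes v: "v \<in> L2fun T"
  shows "continuous_on {0..T} (\<lambda>t. integral\<^sup>L (lebesgue_on {0..t}) v)"
  unfolding continuous_on_sequentially o_def
proof (intro allI impI ballI, elim conjE)
  fix r :: "nat \<Rightarrow> real" and t assume t: "t \<in> {0..T}" and r: "\<forall>n. r n \<in> {0..T}" and lim: "r \<longlonglongrightarrow> t"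
  let ?M = "lebesgue_on {0..T}"
  have "(\<lambda>n. LINT s|?M. indicator {0..r n} s *\<^sub>R v s) \<longlonglongrightarrow> (LINT s|?M. indicator {0..t} s *\<^sub>R v s)"
  proof (rule integral_dominated_convergence)
    show "integrable ?M (\<lambda>s. norm (v s))" using integrable_L2fun[OF v] by simp
    show "(\<lambda>s. indicator {0..t} s *\<^sub>R v s) \<in> borel_measurable ?M"
      using integrable_indicator_L2fun[OF v initial_interval_sets[OF t]] by auto
    show "(\<lambda>s. indicator {0..r n} s *\<^sub>R v s) \<in> borel_measurable ?M" for n
      using integrable_indicator_L2fun[OF v initial_interval_sets[of "r n" T]] r by auto
    show "AE s in ?M. norm (indicator {0..r n} s *\<^sub>R v s) \<le> norm (v s)" for n
      by (auto simp: indicator_def)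
    \<comment> \<open>At s = t the indicators need not converge, since r n may approach t from both
      sides; a single point is null.\<close>
    have "AE s in lebesgue. s \<noteq> t" 
      by (rule AE_I'[of "{t}"]) auto
    then have "AE s in ?M. s \<noteq> t" by (simp add: AE_restrict_space_iff) (erule eventually_mono, auto)
    then show "AE s in ?M. (\<lambda>n. indicator {0..r n} s *\<^sub>R v s) \<longlonglongrightarrow> indicator {0..t} s *\<^sub>R v s"
    proof (rule AE_mp, intro AE_I2 impI)
      fix s assume "s \<in> space ?M" "s \<noteq> t"
      then have "s \<ge> 0" by simp
      have "\<forall>\<^sub>F n in sequentially. indicator {0..r n} s = (indicator {0..t} s :: real)"
      proof (cases "s < t")
        case True
        show ?thesis using order_tendstoD(1)[OF lim True]
          by eventually_elim (use True \<open>s \<ge> 0\<close> in \<open>auto simp: indicator_def\<close>)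
      next
        case False
        then have "t < s" using \<open>s \<noteq> t\<close> by simp
        show ?thesis using order_tendstoD(2)[OF lim \<open>t < s\<close>]
          by eventually_elim (use \<open>t < s\<close> in \<open>auto simp: indicator_def\<close>)
      qed
      then have "\<forall>\<^sub>F n in sequentially. indicator {0..r n} s *\<^sub>R v s = indicator {0..t} s *\<^sub>R v s"
        by eventually_elim simp
      then show "(\<lambda>n. indicator {0..r n} s *\<^sub>R v s) \<longlonglongrightarrow> indicator {0..t} s *\<^sub>R v s"
        by (rule tendsto_eventually)
    qed
  qed
  then show "(\<lambda>n. integral\<^sup>L (lebesgue_on {0..r n}) v) \<longlonglongrightarrow> integral\<^sup>L (lebesgue_on {0..t}) v"
    using integral_lebesgue_on_initial[OF t, of v] integral_lebesgue_on_initial[of "r _" T v] r by simp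
qed

lemma H1fun_continuous:
  assumes "y \<in> H1fun T"
  shows "continuous_on {0..T} y"
proof -
  have "continuous_on {0..T} (\<lambda>t. y 0 + integral\<^sup>L (lebesgue_on {0..t}) (h1deriv T y))"
    by (intro continuous_intros continuous_on_indefinite_integral h1deriv_L2fun assms)
  then show ?thesis using h1deriv_integral[OF assms, symmetric] by (rule continuous_on_eq)
qed

lemma H1fun_L2fun:
  assumes "y \<in> H1fun T"
  shows "y \<in> L2fun T"
proof -
  have "compact (y ` {0..T})" by (intro compact_continuous_image H1fun_continuous assms compact_Icc)
  then obtain B where "\<And>t. t \<in> {0..T} \<Longrightarrow> norm (y t) \<le> B"
    using compact_imp_bounded bounded_iff by (metis imageI)
  moreover have "y \<in> borel_measurable (lebesgue_on {0..T})"
    by (intro continuous_imp_measurable_on_sets_lebesgue H1fun_continuous assms) simp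
  ultimately show ?thesis by (intro L2fun_bounded)
qed

lemma indefinite_integral_H1fun:
  fixes v :: "real \<Rightarrow> 'a::{real_inner,banach,second_countable_topology}" and c :: 'a
  assumes T: "0 \<le> T" and v: "v \<in> L2fun T"
  defines "y \<equiv> \<lambda>t. if t \<in> {0..T} then c + integral\<^sup>L (lebesgue_on {0..t}) v else 0"
  shows "y \<in> H1fun T" "y 0 = c" "AE t in lebesgue_on {0..T}. h1deriv T y t = v t"
proof -
  have "(LINT s|lebesgue. indicator {0..0} s *\<^sub>R v s) = 0"
  proof (rule integral_eq_zero_AE)
    show "AE s in lebesgue. indicator {0..0} s *\<^sub>R v s = 0"
      by (rule AE_I'[of "{0}"]) (auto simp: indicator_def)
  qed
  then have "integral\<^sup>L (lebesgue_on {0..0}) v = 0" by (simp add: integral_restrict_space)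
  then show y0: "y 0 = c" using T by (simp add: y_def)
  have eq: "y t = y 0 + integral\<^sup>L (lebesgue_on {0..t}) v" if "t \<in> {0..T}" for t
    unfolding y0 using that by (simp add: y_def)
  show y: "y \<in> H1fun T"
    unfolding H1fun_def mem_Collect_eq
    by (intro conjI allI impI bexI[OF _ v] ballI eq) (auto simp: y_def)
  show "AE t in lebesgue_on {0..T}. h1deriv T y t = v t"
    by (rule h1deriv_AE_unique[OF T y v eq])
qed

section \<open>The H^1 inner product and its weak topology\<close>

lemma H1inner_L2ip: "H1inner T y z = L2ip T y z + L2ip T (h1deriv T y) (h1deriv T z)"
  by (simp add: H1inner_def L2ip_def)

lemma L2ip_AE_cong:
  fixes u v u' v' :: "real \<Rightarrow> 'a::{real_inner,banach,second_countable_topology}"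
  assumes "u \<in> L2fun T" "v \<in> L2fun T" "u' \<in> L2fun T" "v' \<in> L2fun T"
    "AE t in lebesgue_on {0..T}. u t = u' t" "AE t in lebesgue_on {0..T}. v t = v' t"
  shows "L2ip T u v = L2ip T u' v'"
proof -
  note [measurable] = assms(1-4)[THEN L2fun_measurable]
  show ?thesis unfolding L2ip_def using assms(5,6) by (intro integral_cong_AE) auto
qed

text \<open>Testing with the difference d of the two functions makes its L^2 norm vanish. Members of
  \<open>H1fun\<close> are continuous on the interval and zero outside, so a.e. equality becomes
  equality everywhere; weak limits are therefore unique.\<close>

lemma H1inner_nondegenerate:
  fixes y z :: "real \<Rightarrow> 'a::{real_inner,banach,second_countable_topology}"
  assumes T: "0 < T" and y: "y \<in> H1fun T" and z: "z \<in> H1fun T"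
    and eq: "\<And>w. w \<in> H1fun T \<Longrightarrow> H1inner T y w = H1inner T z w"
  shows "y = z"
proof -
  define d where "d = (\<lambda>t. y t - z t)"
  have dH: "d \<in> H1fun T" unfolding d_def using T by (intro H1fun_diff y z) auto
  let ?D = "h1deriv T d"
  have *: "L2ip T d d = L2ip T y d - L2ip T z d"
    using L2.ip_comb[OF y[THEN H1fun_L2fun] z[THEN H1fun_L2fun] dH[THEN H1fun_L2fun], of 1 "-1"]
    by (simp add: L2comb_def d_def)
  have "L2ip T ?D ?D = L2ip T (\<lambda>t. h1deriv T y t - h1deriv T z t) ?D"
    using T y z dH unfolding d_def
    by (intro L2ip_AE_cong h1deriv_diff h1deriv_L2fun L2fun_diff) auto
  then have **: "L2ip T ?D ?D = L2ip T (h1deriv T y) ?D - L2ip T (h1deriv T z) ?D"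
    using L2.ip_comb[OF y[THEN h1deriv_L2fun] z[THEN h1deriv_L2fun] dH[THEN h1deriv_L2fun], of 1 "-1"]
    by (simp add: L2comb_def)
  have "L2ip T d d + L2ip T ?D ?D = 0"
    using eq[OF dH] * ** by (simp add: H1inner_L2ip)
  then have "L2ip T d d = 0"
    using L2.ip_nonneg[OF H1fun_L2fun[OF dH]] L2.ip_nonneg[OF h1deriv_L2fun[OF dH]] by linarith
  then have "AE t in lebesgue_on {0..T}. (norm (d t))\<^sup>2 = 0"
    unfolding L2ip_self using L2fun_integrable_nsq[OF H1fun_L2fun[OF dH]]
    by (subst (asm) integral_nonneg_eq_0_iff_AE) auto
  then have ae: "AE t in lebesgue. t \<in> {0..T} \<longrightarrow> d t = 0" by (simp add: AE_restrict_space_iff)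
  have "d t = 0" if t: "t \<in> {0..T}" for t
  proof (rule ccontr)
    assume "d t \<noteq> 0"
    from H1fun_continuous[OF dH, unfolded continuous_on_iff, rule_format, OF t, of "norm (d t)"] \<open>d t \<noteq> 0\<close>
    obtain e where e: "e > 0" "\<And>s. s \<in> {0..T} \<Longrightarrow> dist s t < e \<Longrightarrow> dist (d s) (d t) < norm (d t)" by auto
    \<comment> \<open>By continuity d does not vanish near t; clipping that neighbourhood to the
      time interval leaves positive length because T > 0, also when t is an endpoint.\<close>
    define a b where "a = max 0 (t - e/2)" and "b = min T (t + e/2)"
    have ab: "a < b" using t e T by (auto simp: a_def b_def)
    have "d s \<noteq> 0 \<and> s \<in> {0..T}" if "s \<in> {a..b}" for s
    proof -
      have "s \<in> {0..T}" "dist s t < e" using that e(1) by (auto simp: a_def b_def dist_real_def)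
      then show ?thesis using e(2)[of s] by auto
    qed
    with ae have "AE s in lebesgue. s \<notin> {a..b}" by (auto elim!: eventually_mono)
    then have "{a..b} \<in> null_sets lebesgue" by (subst AE_iff_null_sets) auto
    then have "emeasure lebesgue {a..b} = 0" by (rule null_setsD1)
    then show False using ab by simp
  qed
  then have "y t = z t" for t
    using H1fun_outside[OF y, of t] H1fun_outside[OF z, of t] by (cases "t \<in> {0..T}") (auto simp: d_def)
  then show ?thesis by auto
qed

lemma zero_L2fun: "(\<lambda>_. 0) \<in> L2fun T" by (simp add: L2fun_def)

lemma zero_H1fun: "(\<lambda>_. 0) \<in> H1fun T"
  unfolding H1fun_def using zero_L2fun by (auto intro!: bexI[of _ "\<lambda>_. 0"])

lemma topspace_H1w_top: "topspace (H1w_top T) = H1fun T"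
  unfolding H1w_top_def using zero_H1fun by (auto intro!: exI[of _ UNIV])

text \<open>Eventual membership is stable under finite intersections and arbitrary unions, so
  induction over the generation of open sets reduces convergence to the subbasis.\<close>

lemma limitin_topology_generated_by:
  assumes "l \<in> \<Union>S" "\<And>A. A \<in> S \<Longrightarrow> l \<in> A \<Longrightarrow> eventually (\<lambda>x. f x \<in> A) F"
  shows "limitin (topology_generated_by S) f l F"
proof -
  have "l \<in> A \<longrightarrow> eventually (\<lambda>x. f x \<in> A) F" if "generate_topology_on S A" for A
    using that
  proof induction
    case (Int a b) then show ?case by (auto simp: eventually_conj_iff)
  next
    case (UN K)
    show ?case
    proof
      assume "l \<in> \<Union>K"
      then obtain k where k: "k \<in> K" "l \<in> k" by blast
      with UN.IH have "eventually (\<lambda>x. f x \<in> k) F" by blast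
      then show "eventually (\<lambda>x. f x \<in> \<Union>K) F" by eventually_elim (use k in blast)
    qed
  next
    case (Basis s) then show ?case using assms(2) by auto
  qed simp
  then show ?thesis using assms(1) by (auto simp: limitin_def dest: openin_topology_generated_by)
qed

lemma limitin_H1w_top_iff:
  "limitin (H1w_top T) ys y F \<longleftrightarrow> y \<in> H1fun T \<and> (\<forall>\<^sub>F n in F. ys n \<in> H1fun T) \<and>
     (\<forall>z\<in>H1fun T. ((\<lambda>n. H1inner T (ys n) z) \<longlongrightarrow> H1inner T y z) F)" (is "?L = ?R")
proof
  assume L: ?L
  let ?S = "{{y \<in> H1fun T. H1inner T y z \<in> V} | z V. z \<in> H1fun T \<and> open V}"
  have L': "limitin (topology_generated_by ?S) ys y F" and y: "y \<in> H1fun T" and ev: "\<forall>\<^sub>F n in F. ys n \<in> H1fun T"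
    using L unfolding H1w_top_def limitin_subtopology by auto
  have "((\<lambda>n. H1inner T (ys n) z) \<longlongrightarrow> H1inner T y z) F" if z: "z \<in> H1fun T" for z
  proof (rule topological_tendstoI)
    fix V assume V: "open V" "H1inner T y z \<in> V"
    have "openin (topology_generated_by ?S) {y \<in> H1fun T. H1inner T y z \<in> V}"
      by (rule topology_generated_by_Basis) (use z V in blast)
    then have "\<forall>\<^sub>F n in F. ys n \<in> {y \<in> H1fun T. H1inner T y z \<in> V}"
      using L' y V by (auto simp: limitin_def)
    then show "\<forall>\<^sub>F n in F. H1inner T (ys n) z \<in> V" by eventually_elim auto
  qed
  with y ev show ?R by blast
next
  assume R: ?R
  show ?L unfolding H1w_top_def limitin_subtopology
  proof (intro conjI limitin_topology_generated_by)
    show "y \<in> \<Union> {{y \<in> H1fun T. H1inner T y z \<in> V} |z V. z \<in> H1fun T \<and> open V}"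
      by (rule UnionI[of "{y \<in> H1fun T. H1inner T y (\<lambda>_. 0) \<in> UNIV}"])
        (use R zero_H1fun open_UNIV in blast, use R in auto)
    fix A assume "A \<in> {{y \<in> H1fun T. H1inner T y z \<in> V} |z V. z \<in> H1fun T \<and> open V}" and yA: "y \<in> A"
    then obtain z V where A: "A = {y \<in> H1fun T. H1inner T y z \<in> V}" "z \<in> H1fun T" "open V" by blast
    have "\<forall>\<^sub>F n in F. H1inner T (ys n) z \<in> V" using R A yA by (intro topological_tendstoD) auto
    with R show "\<forall>\<^sub>F n in F. ys n \<in> A" by (auto simp: A eventually_conj_iff)
  qed (use R in auto)
qed

section \<open>The strong topology of L^2\<close>

lemma L2dist_L2ip: "L2dist T u v = sqrt (L2ip T (\<lambda>t. u t - v t) (\<lambda>t. u t - v t))"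
  for u v :: "real \<Rightarrow> 'a::{real_inner,banach,second_countable_topology}"
  by (simp add: L2dist_def L2ip_self)

lemma L2dist_commute: "L2dist T u v = L2dist T v u"
  by (simp add: L2dist_def norm_minus_commute)

lemma L2dist_self [simp]: "L2dist T u u = 0"
  by (simp add: L2dist_def)

lemma L2dist_nonneg [simp]: "0 \<le> L2dist T u v"
  by (simp add: L2dist_def)

lemma L2dist_triangle:
  fixes u v w :: "real \<Rightarrow> 'a::{real_inner,banach,second_countable_topology}"
  assumes "u \<in> L2fun T" "v \<in> L2fun T" "w \<in> L2fun T"
  shows "L2dist T u w \<le> L2dist T u v + L2dist T v w"
proof -
  define p q where "p = (\<lambda>t. u t - v t)" and "q = (\<lambda>t. v t - w t)"
  have pq: "p \<in> L2fun T" "q \<in> L2fun T" unfolding p_def q_def by (intro L2fun_diff assms)+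
  note nn = L2.ip_nonneg[OF pq(1)] L2.ip_nonneg[OF pq(2)]
  have "L2ip T p q \<le> sqrt (L2ip T p p * L2ip T q q)"
    using L2.cauchy_schwarz[OF pq] by (rule real_le_rsqrt)
  then have "L2ip T p p + 2 * L2ip T p q + L2ip T q q \<le> (sqrt (L2ip T p p) + sqrt (L2ip T q q))\<^sup>2"
    using nn by (simp add: power2_sum real_sqrt_mult)
  moreover have "L2ip T (L2comb 1 p 1 q) (L2comb 1 p 1 q) = L2ip T p p + 2 * L2ip T p q + L2ip T q q"
    using L2.nsq_comb[OF pq, of 1 1] by simp
  moreover have "L2comb 1 p 1 q = (\<lambda>t. u t - w t)" by (auto simp: L2comb_def p_def q_def)
  ultimately show ?thesis
    using nn unfolding L2dist_L2ip p_def[symmetric] q_def[symmetric] by (auto intro: real_le_lsqrt)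
qed

lemma openin_L2_top:
  fixes S :: "(real \<Rightarrow> 'a::{banach,second_countable_topology}) set"
  shows "openin (L2_top T) S \<longleftrightarrow> S \<subseteq> L2fun T \<and> (\<forall>u\<in>S. \<exists>e>0. {v \<in> L2fun T. L2dist T u v < e} \<subseteq> S)"
proof -
  define P where "P S \<longleftrightarrow> S \<subseteq> L2fun T \<and> (\<forall>u\<in>S. \<exists>e>0. {v \<in> L2fun T. L2dist T u v < e} \<subseteq> S)"
    for S :: "(real \<Rightarrow> 'a) set"
  have "P (A \<inter> B)" if AB: "P A" "P B" for A B
    unfolding P_def
  proof (intro conjI ballI)
    show "A \<inter> B \<subseteq> L2fun T" using that by (auto simp: P_def)
    fix u assume "u \<in> A \<inter> B"
    then obtain d e where "d > 0" "{v \<in> L2fun T. L2dist T u v < d} \<subseteq> A"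
        "e > 0" "{v \<in> L2fun T. L2dist T u v < e} \<subseteq> B"
      using AB unfolding P_def by blast
    then show "\<exists>e>0. {v \<in> L2fun T. L2dist T u v < e} \<subseteq> A \<inter> B"
      by (intro exI[of _ "min d e"]) auto
  qed
  moreover have "P (\<Union>\<K>)" if "\<forall>K\<in>\<K>. P K" for \<K>
    using that unfolding P_def by (meson Sup_least Union_iff Union_upper order_trans)
  ultimately have "istopology P" by (simp add: istopology_def)
  then show ?thesis unfolding L2_top_def P_def by (simp add: topology_inverse')
qed

lemma topspace_L2_top: "topspace (L2_top T) = L2fun T"
proof -
  have "openin (L2_top T) (L2fun T)" unfolding openin_L2_top by (auto intro: exI[of _ 1])
  then show ?thesis using openin_L2_top openin_subset openin_topspace by (metis subset_antisym)
qed

lemma openin_L2_ball: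
  fixes u :: "real \<Rightarrow> 'a::{real_inner,banach,second_countable_topology}"
  assumes "u \<in> L2fun T"
  shows "openin (L2_top T) {v \<in> L2fun T. L2dist T u v < e}"
  unfolding openin_L2_top
proof (intro conjI ballI)
  fix v assume v: "v \<in> {v \<in> L2fun T. L2dist T u v < e}"
  show "\<exists>d>0. {w \<in> L2fun T. L2dist T v w < d} \<subseteq> {v \<in> L2fun T. L2dist T u v < e}"
  proof (intro exI[of _ "e - L2dist T u v"] conjI subsetI)
    fix w assume "w \<in> {w \<in> L2fun T. L2dist T v w < e - L2dist T u v}"
    then show "w \<in> {v \<in> L2fun T. L2dist T u v < e}"
      using L2dist_triangle[OF assms, of v w] v by auto
  qed (use v in auto)
qed auto

lemma limitin_L2_top_iff:
  fixes u :: "real \<Rightarrow> 'a::{real_inner,banach,second_countable_topology}"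
  shows "limitin (L2_top T) us u F \<longleftrightarrow>
    u \<in> L2fun T \<and> (\<forall>\<^sub>F n in F. us n \<in> L2fun T) \<and> ((\<lambda>n. L2dist T u (us n)) \<longlongrightarrow> 0) F" (is "?L = ?R")
proof
  assume L: ?L
  then have u: "u \<in> L2fun T" by (simp add: limitin_def topspace_L2_top)
  have ev: "\<forall>\<^sub>F n in F. us n \<in> L2fun T \<and> L2dist T u (us n) < e" if "e > 0" for e
  proof -
    have "\<forall>\<^sub>F n in F. us n \<in> {v \<in> L2fun T. L2dist T u v < e}"
      using L openin_L2_ball[OF u, of e] u that unfolding limitin_def by auto
    then show ?thesis by eventually_elim auto
  qed
  have "((\<lambda>n. L2dist T u (us n)) \<longlongrightarrow> 0) F"
    unfolding tendsto_iff
  proof (intro allI impI)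
    fix e :: real assume "e > 0"
    from ev[OF this] show "\<forall>\<^sub>F n in F. dist (L2dist T u (us n)) 0 < e"
      by eventually_elim (auto simp: dist_real_def)
  qed
  moreover have "\<forall>\<^sub>F n in F. us n \<in> L2fun T" using ev[of 1] by (auto elim: eventually_mono)
  ultimately show ?R using u by blast
next
  assume R: ?R
  show ?L unfolding limitin_def topspace_L2_top
  proof (intro conjI allI impI, use R in blast, elim conjE)
    fix S assume S: "openin (L2_top T) S" "u \<in> S"
    then obtain e where e: "e > 0" "{v \<in> L2fun T. L2dist T u v < e} \<subseteq> S" unfolding openin_L2_top by blast
    have "\<forall>\<^sub>F n in F. L2dist T u (us n) < e" using R e(1) by (intro order_tendstoD(2)) auto
    moreover have "\<forall>\<^sub>F n in F. us n \<in> L2fun T" using R by blast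
    ultimately show "\<forall>\<^sub>F n in F. us n \<in> S" by eventually_elim (use e in auto)
  qed
qed

text \<open>If no point of U were a cluster point, every u in U would have a ball that the sequence
  avoids after some index \<open>N u\<close>; a finite subcover makes this impossible. This argument
  works for the pseudometric \<open>L2dist\<close>.\<close>

lemma compactin_L2_top_subsequence:
  fixes us :: "nat \<Rightarrow> real \<Rightarrow> 'a::{real_inner,banach,second_countable_topology}"
  assumes U: "compactin (L2_top T) U" and us: "\<And>n. us n \<in> U"
  obtains r u where "strict_mono r" "u \<in> U" "limitin (L2_top T) (us \<circ> r) u sequentially"
proof -
  have UL: "U \<subseteq> L2fun T" using U by (simp add: compactin_def topspace_L2_top)
  have "\<exists>u\<in>U. \<forall>e>0. \<forall>N. \<exists>n>N. L2dist T u (us n) < e"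
  proof (rule ccontr)
    assume "\<not> ?thesis"
    then obtain e N where eN: "\<And>u. u \<in> U \<Longrightarrow> e u > 0" "\<And>u n. u \<in> U \<Longrightarrow> n > N u \<Longrightarrow> \<not> L2dist T u (us n) < e u"
      by metis
    define B where "B u = {v \<in> L2fun T. L2dist T u v < e u}" for u
    have "(\<forall>C\<in>B ` U. openin (L2_top T) C) \<and> U \<subseteq> \<Union> (B ` U)"
      using UL eN(1) by (auto simp: B_def intro!: openin_L2_ball)
    then obtain \<F> where "finite \<F>" "\<F> \<subseteq> B ` U" "U \<subseteq> \<Union>\<F>"
      using U unfolding compactin_def by meson
    then obtain S where S: "finite S" "S \<subseteq> U" "U \<subseteq> \<Union> (B ` S)" by (metis finite_subset_image)
    \<comment> \<open>An index beyond every \<open>N u\<close> of the finite subcover.\<close>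
    define m where "m = Suc (\<Sum>u\<in>S. N u)"
    obtain u where u: "u \<in> S" "us m \<in> B u" using S us[of m] by blast
    have "N u \<le> (\<Sum>u\<in>S. N u)" using S(1) u(1) by (simp add: member_le_sum)
    then show False using eN(2)[of u m] u S by (auto simp: m_def B_def)
  qed
  then obtain u where u: "u \<in> U" and near: "\<And>e N. e > 0 \<Longrightarrow> \<exists>n>N. L2dist T u (us n) < e" by blast
  have "\<exists>r. \<forall>k. L2dist T u (us (r k)) < 1 / real (Suc k) \<and> r k < r (Suc k)"
  proof (rule dependent_nat_choice)
    show "\<exists>n. L2dist T u (us n) < 1 / real (Suc 0)" using near[of 1 0] by auto
    show "\<exists>n. L2dist T u (us n) < 1 / real (Suc (Suc k)) \<and> m < n" for m k
      using near[of "1 / real (Suc (Suc k))" m] by auto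
  qed
  then obtain r where r: "\<And>k. L2dist T u (us (r k)) < 1 / real (Suc k)" "\<And>k. r k < r (Suc k)" by blast
  have "(\<lambda>k. L2dist T u (us (r k))) \<longlonglongrightarrow> 0"
  proof (rule tendsto_sandwich[of "\<lambda>_. 0"])
    show "(\<lambda>k. 1 / real (Suc k)) \<longlonglongrightarrow> 0" using LIMSEQ_inverse_real_of_nat by (simp add: inverse_eq_divide)
  qed (use r(1) less_imp_le in \<open>auto intro!: always_eventually\<close>)
  then have "limitin (L2_top T) (us \<circ> r) u sequentially"
    unfolding limitin_L2_top_iff using UL u us by (auto intro!: always_eventually)
  moreover have "strict_mono r" using r(2) by (simp add: strict_mono_Suc_iff)
  ultimately show ?thesis using that u by blast
qed

lemma L2dist_tendsto_sconv:
  fixes u :: "real \<Rightarrow> 'a::{real_inner,banach,second_countable_topology}"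
  assumes "(\<lambda>n. L2dist T u (us n)) \<longlonglongrightarrow> 0"
  shows "L2.sconv T us u"
proof -
  have "(\<lambda>n. (L2dist T (us n) u)\<^sup>2) \<longlonglongrightarrow> 0\<^sup>2"
    using tendsto_power[OF assms, of 2] by (simp add: L2dist_commute)
  moreover have "(L2dist T (us n) u)\<^sup>2 = L2ip T (L2comb 1 (us n) (-1) u) (L2comb 1 (us n) (-1) u)" for n
    by (simp add: L2dist_L2ip L2comb_def L2ip_self)
  ultimately show ?thesis by (simp add: L2.sconv_def)
qed

section \<open>Absolutely continuous functions\<close>

text \<open>\<open>abs_cont_on\<close> numbers its intervals by naturals, while tagged divisions are
  finite sets of pairs; a bijection with an initial segment mediates.\<close>

lemma abs_cont_on_finite_family:
  assumes ac: "abs_cont_on a b g" and e: "e > 0"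
  shows "\<exists>d>0. \<forall>(I :: 'i set) s t. finite I \<longrightarrow>
      (\<forall>i\<in>I. a \<le> s i \<and> s i \<le> t i \<and> t i \<le> b) \<longrightarrow>
      (\<forall>i\<in>I. \<forall>j\<in>I. i \<noteq> j \<longrightarrow> t i \<le> s j \<or> t j \<le> s i) \<longrightarrow>
      (\<Sum>i\<in>I. t i - s i) < d \<longrightarrow> (\<Sum>i\<in>I. \<bar>g (t i) - g (s i)\<bar>) < e"
proof -
  from ac[unfolded abs_cont_on_def, rule_format, OF e]
  obtain d where d: "d > 0" "\<forall>(n::nat) s t.
      (\<forall>i<n. a \<le> s i \<and> s i \<le> t i \<and> t i \<le> b) \<and>
      (\<forall>i<n. \<forall>j<n. i \<noteq> j \<longrightarrow> t i \<le> s j \<or> t j \<le> s i) \<and>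
      (\<Sum>i<n. t i - s i) < d \<longrightarrow> (\<Sum>i<n. \<bar>g (t i) - g (s i)\<bar>) < e"
    by (elim exE conjE, intro that)
  show ?thesis
  proof (intro exI[of _ d] conjI allI impI d(1))
    fix I :: "'i set" and s t
    assume fin: "finite I" and st: "\<forall>i\<in>I. a \<le> s i \<and> s i \<le> t i \<and> t i \<le> b"
      and dj: "\<forall>i\<in>I. \<forall>j\<in>I. i \<noteq> j \<longrightarrow> t i \<le> s j \<or> t j \<le> s i"
      and sm: "(\<Sum>i\<in>I. t i - s i) < d"
    obtain h where h: "bij_betw h {..<card I} I"
      using ex_bij_betw_nat_finite[OF fin] by (auto simp: atLeast0LessThan)
    have hI: "h i \<in> I" if "i < card I" for i using h that by (auto simp: bij_betw_def)
    have hinj: "h i \<noteq> h j" if "i < card I" "j < card I" "i \<noteq> j" for i j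
      using h that by (auto simp: bij_betw_def inj_on_def)
    have "(\<Sum>i<card I. \<bar>g (t (h i)) - g (s (h i))\<bar>) < e"
    proof (rule d(2)[rule_format], intro conjI allI impI)
      show "(\<Sum>i<card I. t (h i) - s (h i)) < d"
        using sm sum.reindex_bij_betw[OF h, of "\<lambda>i. t i - s i"] by simp
    qed (use st dj hI hinj in blast)+
    then show "(\<Sum>i\<in>I. \<bar>g (t i) - g (s i)\<bar>) < e"
      using sum.reindex_bij_betw[OF h, of "\<lambda>i. \<bar>g (t i) - g (s i)\<bar>"] by simp
  qed
qed

text \<open>Subintervals tagged in the exceptional null set are forced by the gauge into an open set of
  small measure, where absolute continuity controls the increments.\<close>

lemma abs_cont_on_has_integral:
  fixes g g' :: "real \<Rightarrow> real"
  assumes ab: "a \<le> b" and ac: "abs_cont_on A B g" and AB: "A \<le> a" "b \<le> B" and N: "negligible N"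
    and der: "\<And>t. t \<in> {a..b} - N \<Longrightarrow> (g has_real_derivative g' t) (at t within {a..b})"
  shows "(g' has_integral (g b - g a)) {a..b}"
proof -
  \<comment> \<open>With the integrand reset to 0 on the null set, a subinterval tagged there
    contributes only its increment of g.\<close>
  define f where "f t = (if t \<in> N then 0 else g' t)" for t
  have "(f has_integral (g b - g a)) {a..b}"
    unfolding has_integral_real
  proof (intro allI impI)
    fix e :: real assume e: "e > 0"
    \<comment> \<open>The denominator b - a + 1 instead of b - a keeps the estimate strict and
      covers a = b.\<close>
    define e1 where "e1 = e / 2 / (b - a + 1)"
    have e1: "e1 > 0" "e1 * (b - a) < e / 2" using e ab by (auto simp: e1_def field_simps)
    have e2: "e / 2 > 0" using e by simp
    from abs_cont_on_finite_family[OF ac e2, where ?'i = "real \<times> real set"]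
    obtain d where d: "d > 0" "\<forall>(I :: (real \<times> real set) set) s t. finite I \<longrightarrow>
      (\<forall>i\<in>I. A \<le> s i \<and> s i \<le> t i \<and> t i \<le> B) \<longrightarrow>
      (\<forall>i\<in>I. \<forall>j\<in>I. i \<noteq> j \<longrightarrow> t i \<le> s j \<or> t j \<le> s i) \<longrightarrow>
      (\<Sum>i\<in>I. t i - s i) < d \<longrightarrow> (\<Sum>i\<in>I. \<bar>g (t i) - g (s i)\<bar>) < e / 2"
      by (elim exE conjE, intro that)
    obtain O' where O': "open O'" "N \<subseteq> O'" "O' - N \<in> lmeasurable" "emeasure lebesgue (O' - N) < ennreal d"
      using sets_lebesgue_outer_open[OF negligible_imp_sets[OF N] d(1)] .
    have O'_meas: "emeasure lebesgue O' < ennreal d"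
      using O'(4) emeasure_Diff_null_set[of N lebesgue O'] N O'(1) by (simp add: negligible_iff_null_sets)
    have "\<exists>r>0. (t \<in> N \<longrightarrow> ball t r \<subseteq> O') \<and>
        (t \<in> {a..b} - N \<longrightarrow> (\<forall>s\<in>{a..b}. \<bar>s - t\<bar> < r \<longrightarrow> \<bar>g s - g t - g' t * (s - t)\<bar> \<le> e1 * \<bar>s - t\<bar>))" for t
    proof (cases "t \<in> N")
      case True
      then obtain r where "r > 0" "ball t r \<subseteq> O'" using O' open_contains_ball by (metis subsetD)
      then show ?thesis using True by auto
    next
      case False
      show ?thesis
      proof (cases "t \<in> {a..b}")
        case True
        then have "(g has_derivative (*) (g' t)) (at t within {a..b})"
          using der[of t] False by (simp add: has_field_derivative_def)
        then show ?thesis using e1(1) False unfolding has_derivative_within_alt by auto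
      qed (use False in \<open>auto intro: exI[of _ 1]\<close>)
    qed
    then obtain r where r: "\<And>t. r t > 0" "\<And>t. t \<in> N \<Longrightarrow> ball t (r t) \<subseteq> O'"
      "\<And>t s. t \<in> {a..b} - N \<Longrightarrow> s \<in> {a..b} \<Longrightarrow> \<bar>s - t\<bar> < r t \<Longrightarrow> \<bar>g s - g t - g' t * (s - t)\<bar> \<le> e1 * \<bar>s - t\<bar>"
      by metis
    show "\<exists>\<gamma>. gauge \<gamma> \<and> (\<forall>\<D>. \<D> tagged_division_of {a..b} \<and> \<gamma> fine \<D> \<longrightarrow>
        norm ((\<Sum>(x,k)\<in>\<D>. measure lborel k *\<^sub>R f x) - (g b - g a)) < e)"
    proof (intro exI[of _ "\<lambda>t. ball t (r t)"] conjI allI impI)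
      show "gauge (\<lambda>t. ball t (r t))" using r(1) by (auto simp: gauge_def)
      fix \<D> assume "\<D> tagged_division_of {a..b} \<and> (\<lambda>t. ball t (r t)) fine \<D>"
      then have D: "\<D> tagged_division_of {a..b}" and fine: "(\<lambda>t. ball t (r t)) fine \<D>" by auto
      have fin: "finite \<D>" using D by auto
      have K: "\<exists>u v. K = {u..v} \<and> u \<le> x \<and> x \<le> v \<and> a \<le> u \<and> v \<le> b \<and> {u..v} \<subseteq> ball x (r x)"
        if xK: "(x, K) \<in> \<D>" for x K
      proof -
        obtain u v where uv: "K = cbox u v" using tagged_division_ofD(4)[OF D xK] by blast
        have "x \<in> K" "K \<subseteq> {a..b}" using tagged_division_ofD(2,3)[OF D xK] by auto
        moreover have "K \<subseteq> ball x (r x)" using fine that by (auto simp: fine_def)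
        ultimately show ?thesis using uv by (intro exI[of _ u] exI[of _ v]) auto
      qed
      define p where "p = (\<lambda>(x::real, k). measure lborel k *\<^sub>R f x - (g (Sup k) - g (Inf k)))"
      have "(\<Sum>(x,k)\<in>\<D>. measure lborel k *\<^sub>R f x) - (g b - g a) = sum p \<D>"
        unfolding additive_tagged_division_1[OF ab D, of g, symmetric] p_def
        by (simp add: sum_subtractf split_def)
      also have "\<dots> = sum p {i \<in> \<D>. fst i \<notin> N} + sum p {i \<in> \<D>. fst i \<in> N}"
        by (subst sum.union_disjoint[symmetric]) (auto intro!: sum.cong simp: fin)
      also have "\<bar>\<dots>\<bar> \<le> (\<Sum>i\<in>{i \<in> \<D>. fst i \<notin> N}. \<bar>p i\<bar>) + (\<Sum>i\<in>{i \<in> \<D>. fst i \<in> N}. \<bar>p i\<bar>)"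
        by (intro order_trans[OF abs_triangle_ineq] add_mono sum_abs)
      also have "\<dots> < e / 2 + e / 2"
      proof (rule add_less_le_mono)
        have "(\<Sum>i\<in>{i \<in> \<D>. fst i \<notin> N}. \<bar>p i\<bar>) \<le> (\<Sum>i\<in>{i \<in> \<D>. fst i \<notin> N}. e1 * measure lborel (snd i))"
        proof (rule sum_mono)
          fix i assume i: "i \<in> {i \<in> \<D>. fst i \<notin> N}"
          obtain x k where xk: "i = (x, k)" by (cases i)
          then obtain u v where uv: "k = {u..v}" "u \<le> x" "x \<le> v" "a \<le> u" "v \<le> b" "{u..v} \<subseteq> ball x (r x)"
            using K[of x k] i by auto
          have x: "x \<in> {a..b} - N" using i xk uv by auto
          have "u \<in> {u..v}" "v \<in> {u..v}" using uv by auto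
          then have "u \<in> ball x (r x)" "v \<in> ball x (r x)" using uv(6) by blast+
          then have "\<bar>u - x\<bar> < r x" "\<bar>v - x\<bar> < r x" by (auto simp: dist_real_def)
          then have "\<bar>g u - g x - g' x * (u - x)\<bar> \<le> e1 * \<bar>u - x\<bar>" "\<bar>g v - g x - g' x * (v - x)\<bar> \<le> e1 * \<bar>v - x\<bar>"
            using r(3)[OF x, of u] r(3)[OF x, of v] uv by simp_all
          then have 1: "\<bar>g u - g x - g' x * (u - x)\<bar> \<le> e1 * (x - u)" "\<bar>g v - g x - g' x * (v - x)\<bar> \<le> e1 * (v - x)"
            using uv by auto
          have "p i = (v - u) * g' x - (g v - g u)"
            using uv x by (simp add: p_def xk f_def)
          \<comment> \<open>Both endpoints are compared with the tag x, where the derivative is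
            known; the two errors add up to e1 times the length.\<close>
          also have "\<dots> = (g u - g x - g' x * (u - x)) - (g v - g x - g' x * (v - x))"
            by (simp add: algebra_simps)
          also have "\<bar>\<dots>\<bar> \<le> e1 * (x - u) + e1 * (v - x)"
            using 1 by linarith
          also have "\<dots> = e1 * (v - u)" by (simp add: algebra_simps)
          finally show "\<bar>p i\<bar> \<le> e1 * measure lborel (snd i)" using uv by (simp add: xk)
        qed
        also have "\<dots> \<le> (\<Sum>i\<in>\<D>. e1 * measure lborel (snd i))"
          using fin e1 by (intro sum_mono2) auto
        also have "\<dots> = e1 * (b - a)"
          using additive_content_tagged_division[of \<D> a b] D ab by (simp add: split_def flip: sum_distrib_left)
        also have "\<dots> < e / 2" by (rule e1(2))
        finally show "(\<Sum>i\<in>{i \<in> \<D>. fst i \<notin> N}. \<bar>p i\<bar>) < e / 2" .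
      next
        \<comment> \<open>Degenerate subintervals have zero increment and must be discarded:
          disjointness of interiors is vacuous for them, so a point interval may lie inside another
          member, violating the ordering that absolute continuity asks for.\<close>
        define I where "I = {i \<in> \<D>. fst i \<in> N \<and> Inf (snd i) < Sup (snd i)}"
        have I: "\<exists>u v. K = {u..v} \<and> u < v \<and> a \<le> u \<and> v \<le> b \<and> Inf K = u \<and> Sup K = v \<and> {u..v} \<subseteq> O'"
          if xK: "(x, K) \<in> I" for x K
        proof -
          obtain u v where uv: "K = {u..v}" "u \<le> x" "x \<le> v" "a \<le> u" "v \<le> b" "{u..v} \<subseteq> ball x (r x)"
            using K[of x K] xK by (auto simp: I_def)
          have "x \<in> N" "Inf K < Sup K" using that by (auto simp: I_def)
          then show ?thesis using uv r(2)[of x] by (intro exI[of _ u] exI[of _ v]) auto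
        qed
        have finI: "finite I" using fin by (simp add: I_def)
        have dis: "{Inf (snd i)<..<Sup (snd i)} \<inter> {Inf (snd j)<..<Sup (snd j)} = {}"
          if ijI: "i \<in> I" "j \<in> I" "i \<noteq> j" for i j
        proof -
          obtain x K y L where ij: "i = (x, K)" "j = (y, L)" by (metis surj_pair)
          have "interior K \<inter> interior L = {}"
            using tagged_division_ofD(5)[OF D, of x K y L] that ij by (auto simp: I_def)
          moreover obtain u v where "K = {u..v}" "Inf K = u" "Sup K = v" using I[of x K] ijI ij by blast
          moreover obtain u' v' where "L = {u'..v'}" "Inf L = u'" "Sup L = v'" using I[of y L] ijI ij by blast
          ultimately show ?thesis using ij by (simp add: interior_atLeastAtMost_real)
        qed
        have "(\<Sum>i\<in>{i \<in> \<D>. fst i \<in> N}. \<bar>p i\<bar>) = (\<Sum>i\<in>I. \<bar>g (Sup (snd i)) - g (Inf (snd i))\<bar>)"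
        proof (rule sum.mono_neutral_cong_right)
          show "finite {i \<in> \<D>. fst i \<in> N}" using fin by simp
          show "I \<subseteq> {i \<in> \<D>. fst i \<in> N}" by (auto simp: I_def)
          show "\<forall>i\<in>{i \<in> \<D>. fst i \<in> N} - I. \<bar>p i\<bar> = 0"
          proof
            fix i assume i: "i \<in> {i \<in> \<D>. fst i \<in> N} - I"
            obtain x k where xk: "i = (x, k)" by (cases i)
            obtain u v where "k = {u..v}" "u \<le> v" using K[of x k] i xk by force
            then show "\<bar>p i\<bar> = 0" using i by (auto simp: xk p_def f_def I_def)
          qed
          show "\<bar>p i\<bar> = \<bar>g (Sup (snd i)) - g (Inf (snd i))\<bar>" if "i \<in> I" for i
            using that by (auto simp: I_def p_def f_def split_def)
        qed
        also have "\<dots> < e / 2"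
        proof (rule d(2)[rule_format, OF finI])
          show "A \<le> Inf (snd i) \<and> Inf (snd i) \<le> Sup (snd i) \<and> Sup (snd i) \<le> B" if "i \<in> I" for i
            using I[of "fst i" "snd i"] that AB by auto
          show "Sup (snd i) \<le> Inf (snd j) \<or> Sup (snd j) \<le> Inf (snd i)" if ij: "i \<in> I" "j \<in> I" "i \<noteq> j" for i j
          proof (rule ccontr)
            assume c: "\<not> ?thesis"
            have "Inf (snd i) < Sup (snd i)" "Inf (snd j) < Sup (snd j)" using ij by (auto simp: I_def)
            with c have "max (Inf (snd i)) (Inf (snd j)) < min (Sup (snd i)) (Sup (snd j))" by auto
            then obtain z where "max (Inf (snd i)) (Inf (snd j)) < z" "z < min (Sup (snd i)) (Sup (snd j))"
              using dense by blast
            then show False using dis[OF ij] by auto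
          qed
          have "ennreal (\<Sum>i\<in>I. Sup (snd i) - Inf (snd i)) = (\<Sum>i\<in>I. emeasure lebesgue {Inf (snd i)<..<Sup (snd i)})"
            using I_def by (subst sum_ennreal[symmetric]) (auto intro!: sum.cong)
          also have "\<dots> = emeasure lebesgue (\<Union>i\<in>I. {Inf (snd i)<..<Sup (snd i)})"
            using dis finI by (intro sum_emeasure) (auto simp: disjoint_family_on_def)
          also have "\<dots> \<le> emeasure lebesgue O'"
          proof (rule emeasure_mono)
            show "(\<Union>i\<in>I. {Inf (snd i)<..<Sup (snd i)}) \<subseteq> O'"
            proof
              fix z assume "z \<in> (\<Union>i\<in>I. {Inf (snd i)<..<Sup (snd i)})"
              then obtain x k where "(x, k) \<in> I" "z \<in> {Inf k<..<Sup k}" by force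
              then show "z \<in> O'" using I[of x k] by force
            qed
            show "O' \<in> sets lebesgue" using O'(1) by simp
          qed
          also have "\<dots> < ennreal d" by (rule O'_meas)
          finally show "(\<Sum>i\<in>I. Sup (snd i) - Inf (snd i)) < d"
            using d(1) by (subst (asm) ennreal_less_iff) (auto intro!: sum_nonneg simp: I_def)
        qed
        finally show "(\<Sum>i\<in>{i \<in> \<D>. fst i \<in> N}. \<bar>p i\<bar>) \<le> e / 2" by simp
      qed
      finally show "norm ((\<Sum>(x,k)\<in>\<D>. measure lborel k *\<^sub>R f x) - (g b - g a)) < e" by simp
    qed
  qed
  then show ?thesis by (rule has_integral_spike[OF N, rotated]) (simp add: f_def)
qed

text \<open>Converts the a.e. derivative supplied by the chain rule into an integral identity.
  Integrability of the derivative identifies the gauge integral with the Lebesgue integral, and the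
  indicator puts the result into the form of an L^2 pairing.\<close>

lemma abs_cont_on_FTC:
  fixes g g' :: "real \<Rightarrow> real"
  assumes t: "t \<in> {a..b}" and ac: "abs_cont_on a b g"
    and der: "AE s in lebesgue_on {a..b}. (g has_real_derivative g' s) (at s within {a..b})"
    and int: "integrable (lebesgue_on {a..b}) g'"
  shows "g t - g a = (LINT s|lebesgue_on {a..b}. indicator {a..t} s * g' s)"
proof -
  define N where "N = {s \<in> {a..b}. \<not> (g has_real_derivative g' s) (at s within {a..b})}"
  have "AE s in lebesgue. s \<in> {a..b} \<longrightarrow> (g has_real_derivative g' s) (at s within {a..b})"
    using der by (simp add: AE_restrict_space_iff)
  then obtain N' where "N' \<in> null_sets lebesgue" "N \<subseteq> N'"
    unfolding eventually_ae_filter N_def by auto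
  then have N: "negligible N" using negligible_iff_null_sets negligible_subset by blast
  have "(g' has_integral (g t - g a)) {a..t}"
  proof (rule abs_cont_on_has_integral[OF _ ac _ _ N])
    show "a \<le> t" "a \<le> a" "t \<le> b" using t by auto
    fix s assume "s \<in> {a..t} - N"
    then have "(g has_real_derivative g' s) (at s within {a..b})" using t by (auto simp: N_def)
    then show "(g has_real_derivative g' s) (at s within {a..t})"
      by (rule has_field_derivative_subset) (use t in auto)
  qed
  moreover have "integrable (lebesgue_on {a..t}) g'"
    using int by (rule integrable_subinterval) (use t in auto)
  then have "(g' has_integral (integral\<^sup>L (lebesgue_on {a..t}) g')) {a..t}"
    by (rule has_integral_integral_lebesgue_on) simp
  ultimately have "g t - g a = integral\<^sup>L (lebesgue_on {a..t}) g'" by (rule has_integral_unique)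
  also have "\<dots> = (LINT s|lebesgue. indicator {a..b} s *\<^sub>R (indicator {a..t} s * g' s))"
    unfolding integral_restrict_space[of "{a..t}" lebesgue, simplified]
    using t by (intro Bochner_Integration.integral_cong) (auto simp: indicator_def)
  also have "\<dots> = (LINT s|lebesgue_on {a..b}. indicator {a..t} s * g' s)"
    by (simp add: integral_restrict_space)
  finally show ?thesis .
qed

section \<open>Subdifferentials\<close>

text \<open>Convexity carries the local inequality at y along the segment to any w, and to first
  order f contributes only its linear part. Conversely, the global inequality bounds the difference
  quotient below by the remainder quotient of f, which tends to zero.\<close>

lemma frechet_subdiff_sum_iff:
  fixes \<phi>1 :: "'a::real_inner \<Rightarrow> ereal" and f :: "'a \<Rightarrow> real"
  assumes conv: "convex_fun \<phi>1" and ninf: "\<And>x. \<phi>1 x \<noteq> -\<infinity>"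
    and der: "(f has_derivative (\<lambda>h. inner g h)) (at y)"
  shows "\<xi> \<in> frechet_subdiff (\<lambda>x. \<phi>1 x + ereal (f x)) y \<longleftrightarrow>
     \<phi>1 y < \<infinity> \<and> (\<forall>w. \<phi>1 y + ereal (inner (\<xi> - g) (w - y)) \<le> \<phi>1 w)" (is "?L \<longleftrightarrow> ?R")
proof (cases "\<phi>1 y < \<infinity>")
  case False
  then show ?thesis by (simp add: frechet_subdiff_def dom_fun_def)
next
  case True
  then obtain p where p: "\<phi>1 y = ereal p" using ninf[of y] by (cases "\<phi>1 y") auto
  define Q where "Q z = (\<phi>1 z + ereal (f z) - (\<phi>1 y + ereal (f y)) - ereal (inner \<xi> (z - y))) / ereal (norm (z - y))" for z
  have L: "?L \<longleftrightarrow> (\<forall>c<0. eventually (\<lambda>z. c < Q z) (at y))"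
    using True by (simp add: frechet_subdiff_def dom_fun_def p le_Liminf_iff Q_def)
  have Qr: "Q z = ereal ((q + f z - (p + f y) - inner \<xi> (z - y)) / norm (z - y))" if "\<phi>1 z = ereal q" "z \<noteq> y" for z q
    using that by (simp add: Q_def p)
  have Qinf: "Q z = \<infinity>" if "\<phi>1 z = \<infinity>" "z \<noteq> y" for z
    using that by (simp add: Q_def p)
  have rem: "eventually (\<lambda>z. \<bar>f z - f y - inner g (z - y)\<bar> \<le> e * norm (z - y)) (at y)" if "e > 0" for e
  proof -
    from der that obtain d where "d > 0" "\<And>z. norm (z - y) < d \<Longrightarrow> norm (f z - f y - inner g (z - y)) \<le> e * norm (z - y)"
      unfolding has_derivative_at_alt by blast
    then show ?thesis unfolding eventually_at by (intro exI[of _ d]) (auto simp: dist_norm)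
  qed
  show ?thesis
  proof
    assume ?L
    have "\<phi>1 y + ereal (inner (\<xi> - g) (w - y)) \<le> \<phi>1 w" for w
    proof (rule ccontr)
      assume "\<not> ?thesis"
      then have lt: "\<phi>1 w < ereal (p + inner (\<xi> - g) (w - y))" by (simp add: p not_le)
      then obtain q where q: "\<phi>1 w = ereal q" using ninf[of w] by (cases "\<phi>1 w") auto
      \<comment> \<open>The deficit of a supposed violation at w. Convexity leaves a deficit t
        \<delta> at the segment point with parameter t; the liminf condition tolerates t \<delta>/2
        and the remainder of f at most t \<delta>/4, a contradiction.\<close>
      define \<delta> where "\<delta> = p + inner (\<xi> - g) (w - y) - q"
      have \<delta>: "\<delta> > 0" using lt q by (simp add: \<delta>_def)
      have wy: "w \<noteq> y" using \<delta> q p by (auto simp: \<delta>_def)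
      define n where "n = norm (w - y)"
      have n: "n > 0" using wy by (simp add: n_def)
      have "ereal (- \<delta> / (2 * n)) < 0" using \<delta> n by simp
      then have "eventually (\<lambda>z. ereal (- \<delta> / (2 * n)) < Q z) (at y)" using \<open>?L\<close> L by blast
      moreover have "eventually (\<lambda>z. \<bar>f z - f y - inner g (z - y)\<bar> \<le> \<delta> / (4 * n) * norm (z - y)) (at y)"
        using \<delta> n by (intro rem) simp
      ultimately have "eventually (\<lambda>z. ereal (- \<delta> / (2 * n)) < Q z \<and>
          \<bar>f z - f y - inner g (z - y)\<bar> \<le> \<delta> / (4 * n) * norm (z - y)) (at y)"
        by (rule eventually_conj)
      then obtain d where d: "d > 0" "\<And>z. z \<noteq> y \<Longrightarrow> dist z y < d \<Longrightarrow> ereal (- \<delta> / (2 * n)) < Q z \<and>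
          \<bar>f z - f y - inner g (z - y)\<bar> \<le> \<delta> / (4 * n) * norm (z - y)"
        unfolding eventually_at by blast
      \<comment> \<open>The bound 1/2 keeps t below 1 for convexity, and d / (2n) keeps the point
        within distance d of y.\<close>
      define t where "t = min (1/2) (d / (2 * n))"
      have t: "0 < t" "t < 1" "t * n < d" using d n by (auto simp: t_def min_def field_simps)
      define z where "z = t *\<^sub>R w + (1 - t) *\<^sub>R y"
      have zy: "z - y = t *\<^sub>R (w - y)" by (simp add: z_def algebra_simps)
      have nz: "norm (z - y) = t * n" using t by (simp add: zy n_def)
      have z1: "z \<noteq> y" using zy t wy by auto
      have z2: "dist z y < d" using nz t by (simp add: dist_norm)
      have "\<phi>1 z \<le> ereal t * \<phi>1 w + ereal (1 - t) * \<phi>1 y"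
        using conv t unfolding convex_fun_def z_def by blast
      then have "\<phi>1 z \<le> ereal (t * q + (1 - t) * p)" by (simp add: p q)
      then obtain s where s: "\<phi>1 z = ereal s" "s \<le> t * q + (1 - t) * p"
        using ninf[of z] by (cases "\<phi>1 z") auto
      have "- \<delta> / (2 * n) < (s + f z - (p + f y) - inner \<xi> (z - y)) / (t * n)"
        using d(2)[OF z1 z2] unfolding Qr[OF s(1) z1] nz by simp
      then have "- \<delta> / (2 * n) * (t * n) < s + f z - (p + f y) - inner \<xi> (z - y)"
        using t n by (simp add: pos_less_divide_eq)
      moreover have "- \<delta> / (2 * n) * (t * n) = - (t * \<delta> / 2)" using n by simp
      moreover have "f z - f y \<le> inner g (z - y) + t * \<delta> / 4"
      proof -
        have "\<bar>f z - f y - inner g (z - y)\<bar> \<le> t * \<delta> / 4"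
          using d(2)[OF z1 z2] n unfolding nz by (simp add: field_simps)
        then show ?thesis by linarith
      qed
      moreover have "s - p - inner \<xi> (z - y) + inner g (z - y) \<le> - (t * \<delta>)"
      proof -
        have "inner \<xi> (z - y) - inner g (z - y) = t * inner (\<xi> - g) (w - y)"
          by (simp add: zy inner_diff_left algebra_simps)
        then show ?thesis using s(2) by (simp add: \<delta>_def algebra_simps)
      qed
      moreover have "t * \<delta> > 0" using t \<delta> by simp
      ultimately show False by linarith
    qed
    with True show ?R by simp
  next
    assume R: ?R
    have "eventually (\<lambda>z. c < Q z) (at y)" if c: "c < 0" for c
    proof -
      obtain e where e: "e > 0" "c < ereal (- e)"
        using ereal_dense2[OF c] by (metis ereal_less(1) minus_minus neg_0_less_iff_less)
      show ?thesis using rem[OF e(1)] eventually_neq_at_within[of y y UNIV]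
      proof eventually_elim
        case (elim z)
        show ?case
        proof (cases "\<phi>1 z")
          case (real q)
          have "p + inner (\<xi> - g) (z - y) \<le> q" using R[THEN conjunct2, rule_format, of z] real p by simp
          then have "- e * norm (z - y) \<le> q + f z - (p + f y) - inner \<xi> (z - y)"
            using elim(1) by (simp add: inner_diff_left abs_le_iff)
          then have "- e \<le> (q + f z - (p + f y) - inner \<xi> (z - y)) / norm (z - y)"
            using elim(2) by (simp add: pos_le_divide_eq)
          then show ?thesis using e(2) unfolding Qr[OF real elim(2)] by (metis ereal_less_eq(3) less_le_trans)
        next
          case PInf then show ?thesis using Qinf[OF PInf elim(2)] c by auto
        qed (use ninf in auto)
      qed
    qed
    then show ?L using L by blast
  qed
qed

text \<open>Riesz representation on the Hilbert space turns derivatives into vectors, and the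
  Lipschitz bound on operator norms passes to these vectors.\<close>

lemma C11_gradient:
  fixes f :: "'a::{real_inner,banach} \<Rightarrow> real"
  assumes "C11 f"
  obtains g where "\<And>x. (f has_derivative (\<lambda>h. inner (g x) h)) (at x)" "continuous_on UNIV g"
proof -
  obtain L where L: "\<And>x y. onorm (\<lambda>h. frechet_derivative f (at x) h - frechet_derivative f (at y) h) \<le> L * norm (x - y)"
    and diff: "\<And>x. f differentiable (at x)"
    using assms unfolding C11_def by blast
  have der: "(f has_derivative frechet_derivative f (at x)) (at x)" for x
    using diff by (simp add: frechet_derivative_works)
  have "\<exists>v. \<forall>h. inner v h = frechet_derivative f (at x) h" for x
  proof -
    interpret bl: bounded_linear "frechet_derivative f (at x)" using der has_derivative_bounded_linear by blast
    obtain K where K: "\<And>h. \<bar>frechet_derivative f (at x) h\<bar> \<le> norm h * K" using bl.bounded by auto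
    obtain v where "\<And>h. h \<in> UNIV \<Longrightarrow> inner v h = frechet_derivative f (at x) h"
    proof (rule Hilb.riesz_on_subspace[of UNIV "frechet_derivative f (at x)" "K\<^sup>2"])
      show "(frechet_derivative f (at x) h)\<^sup>2 \<le> K\<^sup>2 * inner h h" for h
        using power_mono[OF K[of h], of 2] by (simp add: power_mult_distrib power2_norm_eq_inner mult.commute)
    qed (auto simp: bl.add bl.scaleR)
    then show ?thesis by auto
  qed
  then obtain g where g: "\<And>x h. inner (g x) h = frechet_derivative f (at x) h" by metis
  have lip: "norm (g x - g y) \<le> L * norm (x - y)" for x y
  proof -
    let ?D = "\<lambda>h. inner (g x - g y) h"
    have bl: "bounded_linear ?D" by (rule bounded_linear_inner_right)
    have on: "onorm ?D \<le> L * norm (x - y)" using L[of x y] by (simp add: inner_diff_left g)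
    \<comment> \<open>The functional is tested at its own representing vector, where its value is
      the squared norm.\<close>
    have "norm (g x - g y) * norm (g x - g y) \<le> onorm ?D * norm (g x - g y)"
      using onorm[OF bl, of "g x - g y"] by (simp flip: power2_norm_eq_inner power2_eq_square)
    also have "\<dots> \<le> L * norm (x - y) * norm (g x - g y)" using on by (rule mult_right_mono) simp
    finally show ?thesis
      using order_trans[OF onorm_pos_le[OF bl] on] by (cases "g x = g y") auto
  qed
  have "(\<bar>L\<bar>)-lipschitz_on UNIV g"
  proof (rule lipschitz_onI)
    show "dist (g x) (g y) \<le> \<bar>L\<bar> * dist x y" for x y
      using lip[of x y] mult_right_mono[OF abs_ge_self[of L] norm_ge_zero[of "x - y"]] by (simp add: dist_norm)
  qed simp
  then have "continuous_on UNIV g" by (rule lipschitz_on_continuous_on)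
  moreover have "(f has_derivative (\<lambda>h. inner (g x) h)) (at x)" for x using der[of x] by (simp add: g)
  ultimately show ?thesis using that by blast
qed

section \<open>Energies with compact sublevels: lower bound, closed graph and Borel selection of the
  subdifferential\<close>

locale energy =
  fixes \<phi> \<phi>1 :: "'a::{real_inner,banach,second_countable_topology} \<Rightarrow> ereal"
    and \<phi>2 :: "'a \<Rightarrow> real" and g :: "'a \<Rightarrow> 'a"
  assumes phi_eq: "\<phi> = (\<lambda>x. \<phi>1 x + ereal (\<phi>2 x))"
    and phi1_ninf: "\<phi>1 x \<noteq> -\<infinity>"
    and phi1_convex: "convex_fun \<phi>1"
    and phi1_single: "\<xi> \<in> frechet_subdiff \<phi>1 y \<Longrightarrow> \<eta> \<in> frechet_subdiff \<phi>1 y \<Longrightarrow> \<xi> = \<eta>"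
    and phi2_deriv: "(\<phi>2 has_derivative (\<lambda>h. inner (g x) h)) (at x)"
    and grad_cont: "continuous_on UNIV g"
    and sublevel: "compact {x. \<phi> x \<le> ereal c}"
begin

lemma subdiff_iff:
  "\<xi> \<in> frechet_subdiff \<phi> y \<longleftrightarrow> \<phi>1 y < \<infinity> \<and> (\<forall>w. \<phi>1 y + ereal (inner (\<xi> - g y) (w - y)) \<le> \<phi>1 w)"
  unfolding phi_eq by (rule frechet_subdiff_sum_iff[OF phi1_convex phi1_ninf phi2_deriv])

lemma subdiff1_iff:
  "\<xi> \<in> frechet_subdiff \<phi>1 y \<longleftrightarrow> \<phi>1 y < \<infinity> \<and> (\<forall>w. \<phi>1 y + ereal (inner \<xi> (w - y)) \<le> \<phi>1 w)"
  using frechet_subdiff_sum_iff[OF phi1_convex phi1_ninf, of "\<lambda>_. 0" 0 y \<xi>] by (simp flip: zero_ereal_def)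

text \<open>Subtracting the gradient \<open>g y\<close> maps subgradients of \<open>\<phi>\<close>
  at y to subgradients of \<open>\<phi>1\<close>, where uniqueness is assumed.\<close>

lemma subdiff_unique: "\<xi> \<in> frechet_subdiff \<phi> y \<Longrightarrow> \<eta> \<in> frechet_subdiff \<phi> y \<Longrightarrow> \<xi> = \<eta>"
  using phi1_single[of "\<xi> - g y" y "\<eta> - g y"] by (simp add: subdiff_iff subdiff1_iff)

lemma subdiff_fun_eq: "\<xi> \<in> frechet_subdiff \<phi> y \<Longrightarrow> subdiff_fun \<phi> y = \<xi>"
  unfolding subdiff_fun_def using subdiff_unique by blast

lemma subdiff_fun_in: "y \<in> dom_subdiff \<phi> \<Longrightarrow> subdiff_fun \<phi> y \<in> frechet_subdiff \<phi> y"
  using subdiff_fun_eq by (auto simp: dom_subdiff_def)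

lemma phi_ninf: "\<phi> x \<noteq> -\<infinity>"
  using phi1_ninf[of x] by (cases "\<phi>1 x") (auto simp: phi_eq)

lemma phi2_continuous: "continuous_on UNIV \<phi>2"
  using phi2_deriv has_derivative_continuous continuous_at_imp_continuous_on by blast

lemma phi1_eq: "\<phi> x = ereal r \<Longrightarrow> \<phi>1 x = ereal (r - \<phi>2 x)"
  by (cases "\<phi>1 x") (auto simp: phi_eq)

text \<open>A sequence with energies tending to -\<infinity> would stay in one compact sublevel; its
  cluster point would lie in every closed sublevel, contradicting that \<open>\<phi>\<close> never
  takes the value -\<infinity>.\<close>

lemma phi_lower_bound: obtains m where "\<And>x. ereal m \<le> \<phi> x"
proof -
  have "\<exists>n::nat. {x. \<phi> x \<le> ereal (- real n)} = {}"
  proof (rule ccontr)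
    assume "\<not> ?thesis"
    then have "\<exists>x. \<phi> x \<le> ereal (- real n)" for n :: nat by blast
    then obtain xs where xs: "\<And>n::nat. \<phi> (xs n) \<le> ereal (- real n)" by metis
    have le: "\<phi> (xs n) \<le> ereal (- real N)" if "N \<le> n" for n N
      using xs[of n] that by (auto elim!: order_trans)
    have "xs n \<in> {x. \<phi> x \<le> ereal 0}" for n using le[of 0 n] by simp
    then obtain x r where r: "strict_mono r" "(xs \<circ> r) \<longlonglongrightarrow> x"
      using compact_imp_seq_compact[OF sublevel[of 0]] unfolding seq_compact_def by blast
    have x: "\<phi> x \<le> ereal (- real N)" for N
    proof -
      have "\<forall>\<^sub>F n in sequentially. (xs \<circ> r) n \<in> {x. \<phi> x \<le> ereal (- real N)}"
        using eventually_ge_at_top[of N]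
      proof eventually_elim
        case (elim n)
        then show ?case using le[of N "r n"] seq_suble[OF r(1), of n] by simp
      qed
      from Lim_in_closed_set[OF compact_imp_closed[OF sublevel] this sequentially_bot r(2)]
      show ?thesis by simp
    qed
    show False
    proof (cases "\<phi> x")
      case (real r)
      obtain n :: nat where "- r < real n" using reals_Archimedean2 by blast
      then show False using x[of n] real by simp
    qed (use x[of 0] phi_ninf[of x] in auto)
  qed
  then obtain n :: nat where "{x. \<phi> x \<le> ereal (- real n)} = {}" by blast
  then have "ereal (- real n) \<le> \<phi> x" for x by (metis (mono_tags) empty_Collect_eq linear)
  then show ?thesis using that by blast
qed

lemma phi_measurable [measurable]: "\<phi> \<in> borel_measurable borel"
proof (rule borel_measurableI_le)
  fix c :: ereal
  have "closed {x. \<phi> x \<le> c}"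
  proof (cases c)
    case (real r) then show ?thesis using sublevel[of r] compact_imp_closed by auto
  next
    case MInf then show ?thesis using phi_ninf by simp
  qed simp
  then show "{x \<in> space borel. \<phi> x \<le> c} \<in> sets borel" by simp
qed

lemma phi_lsc:
  assumes z: "zs \<longlonglongrightarrow> z" and c: "cs \<longlonglongrightarrow> c" and le: "\<And>n. \<phi> (zs n) \<le> ereal (cs n)"
  shows "\<phi> z \<le> ereal c"
proof (rule ereal_le_epsilon2)
  fix e :: real assume "e > 0"
  then have "\<forall>\<^sub>F n in sequentially. cs n < c + e" using order_tendstoD(2)[OF c, of "c + e"] by simp
  then have ev: "\<forall>\<^sub>F n in sequentially. zs n \<in> {x. \<phi> x \<le> ereal (c + e)}"
  proof eventually_elim
    case (elim n)
    then show ?case using order_trans[OF le[of n], of "ereal (c + e)"] by simp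
  qed
  have "z \<in> {x. \<phi> x \<le> ereal (c + e)}"
    by (rule Lim_in_closed_set[OF compact_imp_closed[OF sublevel] ev sequentially_bot z])
  then show "\<phi> z \<le> ereal c + ereal e" by simp
qed

text \<open>The subgradient inequality is solved for \<open>\<phi> (zs n)\<close>: its upper bound
  converges because weak subgradients are paired with strongly convergent v - zs n, and lower
  semicontinuity handles the other side.\<close>

lemma subdiff_demiclosed:
  assumes z: "zs \<longlonglongrightarrow> z" and \<xi>: "\<And>n. \<xi>s n \<in> frechet_subdiff \<phi> (zs n)"
    and w: "Hilb.wconv \<xi>s \<xi>" and bd: "\<And>n. inner (\<xi>s n) (\<xi>s n) \<le> M"
  shows "\<xi> \<in> frechet_subdiff \<phi> z"
proof -
  have key: "\<phi> z \<le> ereal (q + \<phi>2 z - inner (\<xi> - g z) (v - z))" if q: "\<phi>1 v = ereal q" for v q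
  proof (rule phi_lsc[OF z])
    have "(\<lambda>n. (norm (v - zs n - (v - z)))\<^sup>2) \<longlonglongrightarrow> (norm (v - z - (v - z)))\<^sup>2" by (intro tendsto_intros z)
    then have "Hilb.sconv (\<lambda>n. v - zs n) (v - z)" by (simp add: Hilb.sconv_def power2_norm_eq_inner)
    then have 1: "(\<lambda>n. inner (\<xi>s n) (v - zs n)) \<longlonglongrightarrow> inner \<xi> (v - z)"
      by (intro Hilb.wconv_sconv_ip[OF _ _ _ bd w]) auto
    have gz: "(\<lambda>n. g (zs n)) \<longlonglongrightarrow> g z" and p2: "(\<lambda>n. \<phi>2 (zs n)) \<longlonglongrightarrow> \<phi>2 z"
      using z grad_cont phi2_continuous by (auto simp: continuous_on_eq_continuous_at isCont_tendsto_compose)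
    have "(\<lambda>n. q + \<phi>2 (zs n) - (inner (\<xi>s n) (v - zs n) - inner (g (zs n)) (v - zs n))) \<longlonglongrightarrow>
        q + \<phi>2 z - (inner \<xi> (v - z) - inner (g z) (v - z))"
      by (intro tendsto_intros 1 gz p2 z)
    then show "(\<lambda>n. q + \<phi>2 (zs n) - inner (\<xi>s n - g (zs n)) (v - zs n)) \<longlonglongrightarrow> q + \<phi>2 z - inner (\<xi> - g z) (v - z)"
      by (simp add: inner_diff_left)
    fix n
    have "\<phi>1 (zs n) < \<infinity>" "\<phi>1 (zs n) + ereal (inner (\<xi>s n - g (zs n)) (v - zs n)) \<le> ereal q"
      using \<xi>[of n] q[symmetric] by (auto simp: subdiff_iff)
    then show "\<phi> (zs n) \<le> ereal (q + \<phi>2 (zs n) - inner (\<xi>s n - g (zs n)) (v - zs n))"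
      using phi1_ninf[of "zs n"] by (cases "\<phi>1 (zs n)") (auto simp: phi_eq)
  qed
  \<comment> \<open>Finiteness of \<open>\<phi> z\<close> needs one test point of finite energy;
    \<open>zs 0\<close> is such a point because it has a subgradient.\<close>
  obtain q0 where "\<phi>1 (zs 0) = ereal q0" using \<xi>[of 0] phi1_ninf[of "zs 0"]
    by (cases "\<phi>1 (zs 0)") (auto simp: subdiff_iff)
  from key[OF this] have "\<phi> z < \<infinity>" by auto
  then obtain s where s: "\<phi>1 z = ereal s" using phi1_ninf[of z] by (cases "\<phi>1 z") (auto simp: phi_eq)
  have "\<phi>1 z + ereal (inner (\<xi> - g z) (v - z)) \<le> \<phi>1 v" for v
  proof (cases "\<phi>1 v")
    case (real q) then show ?thesis using key[OF real] s by (simp add: phi_eq)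
  qed (use phi1_ninf[of v] in auto)
  then show ?thesis using s by (simp add: subdiff_iff)
qed

text \<open>Bounded subgradients have weak limit points, so preimages of closed balls under the
  subdifferential are closed; this is what makes the single-valued selection Borel.\<close>

lemma closed_subdiff_preimage: "closed {z. \<exists>\<xi>\<in>frechet_subdiff \<phi> z. \<xi> \<in> cball c r}"
  unfolding closed_sequential_limits
proof (intro allI impI, elim conjE)
  fix zs z assume "\<forall>n. zs n \<in> {z. \<exists>\<xi>\<in>frechet_subdiff \<phi> z. \<xi> \<in> cball c r}" and z: "zs \<longlonglongrightarrow> z"
  then have "\<forall>n. \<exists>\<xi>. \<xi> \<in> frechet_subdiff \<phi> (zs n) \<and> dist c \<xi> \<le> r" by auto
  then obtain \<xi>s where \<xi>s: "\<And>n. \<xi>s n \<in> frechet_subdiff \<phi> (zs n)" "\<And>n. dist c (\<xi>s n) \<le> r" by metis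
  have bd: "inner (\<xi>s n) (\<xi>s n) \<le> (norm c + r)\<^sup>2" for n
  proof -
    have "norm (\<xi>s n) \<le> norm c + dist c (\<xi>s n)"
      using norm_triangle_sub[of "\<xi>s n" c] by (simp add: dist_norm norm_minus_commute)
    then have "norm (\<xi>s n) \<le> norm c + r" using \<xi>s(2)[of n] by linarith
    then show ?thesis by (simp flip: power2_norm_eq_inner add: power_mono)
  qed
  obtain k \<xi> where k: "strict_mono k" "Hilb.wconv (\<xi>s \<circ> k) \<xi>"
    using Hilb.weak_sequential_compactness[of \<xi>s "(norm c + r)\<^sup>2"] bd by auto
  have "\<xi> \<in> frechet_subdiff \<phi> z"
    by (rule subdiff_demiclosed[OF LIMSEQ_subseq_LIMSEQ[OF z k(1)] _ k(2)]) (use \<xi>s bd in auto)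
  \<comment> \<open>Closed balls are weakly closed: the limit is tested against its own displacement
    from the centre.\<close>
  moreover have "dist c \<xi> \<le> r"
  proof -
    have "(\<lambda>n. inner ((\<xi>s \<circ> k) n) (\<xi> - c)) \<longlonglongrightarrow> inner \<xi> (\<xi> - c)" using k(2) by (simp add: Hilb.wconv_def)
    from tendsto_diff[OF this tendsto_const[of "inner c (\<xi> - c)"]]
    have "(\<lambda>n. inner ((\<xi>s \<circ> k) n) (\<xi> - c) - inner c (\<xi> - c)) \<longlonglongrightarrow> inner \<xi> (\<xi> - c) - inner c (\<xi> - c)" .
    moreover have "inner ((\<xi>s \<circ> k) n) (\<xi> - c) - inner c (\<xi> - c) \<le> r * norm (\<xi> - c)" for n
    proof -
      have "inner ((\<xi>s \<circ> k) n) (\<xi> - c) - inner c (\<xi> - c) = inner (\<xi>s (k n) - c) (\<xi> - c)"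
        by (simp add: inner_diff_left)
      also have "\<dots> \<le> norm (\<xi>s (k n) - c) * norm (\<xi> - c)" by (rule norm_cauchy_schwarz)
      also have "\<dots> \<le> r * norm (\<xi> - c)"
        using \<xi>s(2)[of "k n"] by (intro mult_right_mono) (auto simp: dist_norm norm_minus_commute)
      finally show ?thesis .
    qed
    ultimately have "inner \<xi> (\<xi> - c) - inner c (\<xi> - c) \<le> r * norm (\<xi> - c)" by (intro LIMSEQ_le_const2) auto
    then have "norm (\<xi> - c) * norm (\<xi> - c) \<le> r * norm (\<xi> - c)"
      by (simp flip: inner_diff_left add: power2_norm_eq_inner[symmetric] power2_eq_square)
    moreover have "0 \<le> r" using \<xi>s(2)[of 0] zero_le_dist order_trans by blast
    ultimately show ?thesis by (cases "\<xi> = c") (auto simp: dist_norm norm_minus_commute)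
  qed
  ultimately show "z \<in> {z. \<exists>\<xi>\<in>frechet_subdiff \<phi> z. \<xi> \<in> cball c r}" by auto
qed

text \<open>\<open>subdiff_fun\<close> is a definite description, unspecified off the domain; the
  value 0 there gives a total map whose measurability can be proved.\<close>

definition sel :: "'a \<Rightarrow> 'a" where
  "sel z = (if z \<in> dom_subdiff \<phi> then subdiff_fun \<phi> z else 0)"

text \<open>An open set is a countable union of closed balls centred in a dense set, and each ball
  has a closed preimage. Single-valuedness turns "some subgradient lies in the ball" into "the
  selected one does".\<close>

lemma sel_measurable [measurable]: "sel \<in> borel_measurable borel"
proof (rule borel_measurableI)
  fix S :: "'a set" assume S: "open S"
  obtain D :: "'a set" where D: "countable D" "\<And>X. open X \<Longrightarrow> X \<noteq> {} \<Longrightarrow> \<exists>d\<in>D. d \<in> X"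
    using countable_dense_setE by blast
  define C where "C c r = {z. \<exists>\<xi>\<in>frechet_subdiff \<phi> z. \<xi> \<in> cball c r}" for c r
  have C: "C c r \<in> sets borel" for c r unfolding C_def by (intro borel_closed closed_subdiff_preimage)
  define J where "J = {(c, n::nat). c \<in> D \<and> cball c (1 / real (Suc n)) \<subseteq> S}"
  have J: "countable J" by (rule countable_subset[of _ "D \<times> UNIV"]) (use D in \<open>auto simp: J_def\<close>)
  have A: "{z \<in> dom_subdiff \<phi>. subdiff_fun \<phi> z \<in> S} = (\<Union>(c,n)\<in>J. C c (1 / real (Suc n)))"
  proof (intro set_eqI iffI)
    fix z assume "z \<in> {z \<in> dom_subdiff \<phi>. subdiff_fun \<phi> z \<in> S}"
    then have z: "z \<in> dom_subdiff \<phi>" "subdiff_fun \<phi> z \<in> S" by auto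
    then obtain e where e: "e > 0" "ball (subdiff_fun \<phi> z) e \<subseteq> S" using S open_contains_ball by blast
    \<comment> \<open>Half of e, because the centre c may already be one radius away from the
      subgradient and the ball reaches one radius further.\<close>
    obtain n where n: "1 / real (Suc n) < e / 2" using nat_approx_posE[of "e/2"] e by auto
    obtain c where c: "c \<in> D" "c \<in> ball (subdiff_fun \<phi> z) (1 / real (Suc n))"
      using D(2)[of "ball (subdiff_fun \<phi> z) (1 / real (Suc n))"] by auto
    have "cball c (1 / real (Suc n)) \<subseteq> ball (subdiff_fun \<phi> z) e"
    proof
      fix w assume "w \<in> cball c (1 / real (Suc n))"
      then show "w \<in> ball (subdiff_fun \<phi> z) e"
        using dist_triangle[of "subdiff_fun \<phi> z" w c] c n by auto
    qed
    then have "(c, n) \<in> J" using c e by (auto simp: J_def)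
    moreover have "z \<in> C c (1 / real (Suc n))"
      unfolding C_def using subdiff_fun_in[OF z(1)] c by (auto simp: dist_commute intro!: bexI[of _ "subdiff_fun \<phi> z"])
    ultimately show "z \<in> (\<Union>(c,n)\<in>J. C c (1 / real (Suc n)))" by blast
  next
    fix z assume "z \<in> (\<Union>(c,n)\<in>J. C c (1 / real (Suc n)))"
    then obtain c n \<xi> where "(c, n) \<in> J" "\<xi> \<in> frechet_subdiff \<phi> z" "\<xi> \<in> cball c (1 / real (Suc n))"
      by (auto simp: C_def)
    then show "z \<in> {z \<in> dom_subdiff \<phi>. subdiff_fun \<phi> z \<in> S}"
      using subdiff_fun_eq by (auto simp: J_def dom_subdiff_def)
  qed
  have dom: "dom_subdiff \<phi> = (\<Union>n::nat. C 0 (real n))"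
    unfolding dom_subdiff_def C_def using real_arch_simple by fastforce
  have dom_m: "dom_subdiff \<phi> \<in> sets borel" unfolding dom using C by auto
  have A_m: "{z \<in> dom_subdiff \<phi>. subdiff_fun \<phi> z \<in> S} \<in> sets borel"
    unfolding A using C J by (intro sets.countable_UN') auto
  have "sel -` S \<inter> space borel = {z \<in> dom_subdiff \<phi>. subdiff_fun \<phi> z \<in> S} \<union> (if 0 \<in> S then - dom_subdiff \<phi> else {})"
    by (auto simp: sel_def split: if_splits)
  also have "\<dots> \<in> sets borel" using A_m dom_m by auto
  finally show "sel -` S \<inter> space borel \<in> sets borel" .
qed

lemma sel_in: "y \<in> dom_subdiff \<phi> \<Longrightarrow> sel y \<in> frechet_subdiff \<phi> y"
  by (simp add: sel_def subdiff_fun_in)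

end

section \<open>The De Giorgi functional\<close>

text \<open>If convergence fails, infinitely many terms avoid some neighbourhood of x, and their
  enumeration is a subsequence none of whose subsequences converges to x.\<close>

lemma limitin_subsequenceI:
  assumes x: "x \<in> topspace X"
    and sub: "\<And>r :: nat \<Rightarrow> nat. strict_mono r \<Longrightarrow>
      \<exists>s :: nat \<Rightarrow> nat. strict_mono s \<and> limitin X (xs \<circ> r \<circ> s) x sequentially"
  shows "limitin X xs x sequentially"
proof (rule ccontr)
  assume "\<not> ?thesis"
  then obtain U where U: "openin X U" "x \<in> U" "\<not> (\<forall>\<^sub>F n in sequentially. xs n \<in> U)"
    using x unfolding limitin_def by blast
  define A where "A = {n. xs n \<notin> U}"
  have "infinite A"
    using U(3) unfolding A_def by (simp add: frequently_cofinite[symmetric] cofinite_eq_sequentially frequently_def)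
  define r where "r = enumerate A"
  have r: "strict_mono r" unfolding r_def by (rule strict_mono_enumerate) fact
  have rA: "r n \<in> A" for n unfolding r_def by (rule enumerate_in_set) fact
  obtain s :: "nat \<Rightarrow> nat" where s: "limitin X (xs \<circ> r \<circ> s) x sequentially" using sub[OF r] by blast
  then have "\<forall>\<^sub>F n in sequentially. (xs \<circ> r \<circ> s) n \<in> U" using U by (simp add: limitin_def)
  then obtain n where "xs (r (s n)) \<in> U" by (auto simp: eventually_sequentially)
  then show False using rA[of "s n"] by (simp add: A_def)
qed

text \<open>Every subsequence has a strongly convergent one inside K, and its strong limit must
  agree with the weak limit x.\<close>

lemma compact_weak_imp_strong:
  fixes X :: "nat \<Rightarrow> 'a::real_inner"
  assumes K: "compact K" and X: "\<And>n. X n \<in> K"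
    and weak: "\<And>w. (\<lambda>n. inner (X n) w) \<longlonglongrightarrow> inner x w"
  shows "X \<longlonglongrightarrow> x"
proof -
  have "limitin euclidean X x sequentially"
  proof (rule limitin_subsequenceI)
    fix r :: "nat \<Rightarrow> nat" assume r: "strict_mono r"
    have "\<forall>n. (X \<circ> r) n \<in> K" using X by simp
    then obtain l s where s: "strict_mono s" "(X \<circ> r \<circ> s) \<longlonglongrightarrow> l"
      using compact_imp_seq_compact[OF K] unfolding seq_compact_def by metis
    have "inner l w = inner x w" for w
    proof (rule LIMSEQ_unique)
      show "(\<lambda>n. inner ((X \<circ> r \<circ> s) n) w) \<longlonglongrightarrow> inner l w" by (intro tendsto_intros s)
      show "(\<lambda>n. inner ((X \<circ> r \<circ> s) n) w) \<longlonglongrightarrow> inner x w"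
        using LIMSEQ_subseq_LIMSEQ[OF weak strict_mono_o[OF r s(1)], of w] by (simp add: o_def)
    qed
    then have "l = x" by (metis vector_eq_ldot inner_commute)
    with s show "\<exists>s. strict_mono s \<and> limitin euclidean (X \<circ> r \<circ> s) x sequentially" by auto
  qed simp
  then show ?thesis by simp
qed

text \<open>Density is wanted within S itself, which will be an epigraph, so the dense points are
  picked from the basic open sets that meet S.\<close>

lemma countable_dense_subset:
  fixes S :: "'b::second_countable_topology set"
  obtains D where "countable D" "D \<subseteq> S" "S \<subseteq> closure D"
proof -
  obtain B :: "'b set set" where B: "countable B" "topological_basis B"
    using ex_countable_basis by blast
  define f where "f b = (SOME x. x \<in> b \<inter> S)" for b
  have f: "f b \<in> b \<inter> S" if "b \<inter> S \<noteq> {}" for b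
    using that unfolding f_def by (metis ex_in_conv someI_ex)
  define D where "D = f ` {b \<in> B. b \<inter> S \<noteq> {}}"
  have "x \<in> closure D" if x: "x \<in> S" for x
    unfolding closure_iff_nhds_not_empty
  proof (intro allI impI)
    fix A V assume "V \<subseteq> A" "open V" "x \<in> V"
    then obtain b where b: "b \<in> B" "x \<in> b" "b \<subseteq> V" using B topological_basisE by metis
    then have "f b \<in> D \<inter> A" using f[of b] x \<open>V \<subseteq> A\<close> by (auto simp: D_def)
    then show "D \<inter> A \<noteq> {}" by blast
  qed
  moreover have "countable D" "D \<subseteq> S" using B f by (auto simp: D_def)
  ultimately show ?thesis using that by blast
qed

lemma L2ip_indicator_le:
  fixes v :: "real \<Rightarrow> 'a::{real_inner,banach,second_countable_topology}"
  assumes v: "v \<in> L2fun T" and A: "A \<in> sets (lebesgue_on {0..T})"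
  shows "(\<lambda>s. indicator A s *\<^sub>R v s) \<in> L2fun T"
    and "L2ip T (\<lambda>s. indicator A s *\<^sub>R v s) (\<lambda>s. indicator A s *\<^sub>R v s) \<le> L2ip T v v"
proof -
  have eq: "(norm (indicator A s *\<^sub>R v s))\<^sup>2 = indicator A s *\<^sub>R (norm (v s))\<^sup>2" for s
    by (auto simp: indicator_def)
  have int: "integrable (lebesgue_on {0..T}) (\<lambda>s. (norm (indicator A s *\<^sub>R v s))\<^sup>2)"
    unfolding eq using L2fun_integrable_nsq[OF v] A by (rule integrable_mult_indicator[rotated])
  then show "(\<lambda>s. indicator A s *\<^sub>R v s) \<in> L2fun T"
    using L2fun_measurable[OF v] A by (auto simp: L2fun_def)
  show "L2ip T (\<lambda>s. indicator A s *\<^sub>R v s) (\<lambda>s. indicator A s *\<^sub>R v s) \<le> L2ip T v v"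
    unfolding L2ip_self using int L2fun_integrable_nsq[OF v]
    by (rule integral_mono) (auto simp: indicator_def)
qed

lemma sconv_dominated:
  fixes Z :: "nat \<Rightarrow> real \<Rightarrow> 'a::{real_inner,banach,second_countable_topology}"
  assumes meas: "\<And>n. Z n \<in> borel_measurable (lebesgue_on {0..T})" "z \<in> borel_measurable (lebesgue_on {0..T})"
    and bd: "\<And>n t. t \<in> {0..T} \<Longrightarrow> norm (Z n t) \<le> B" "\<And>t. t \<in> {0..T} \<Longrightarrow> norm (z t) \<le> B"
    and lim: "\<And>t. t \<in> {0..T} \<Longrightarrow> (\<lambda>n. Z n t) \<longlonglongrightarrow> z t"
  shows "L2.sconv T Z z"
proof -
  note [measurable] = meas
  have "(\<lambda>n. LINT t|lebesgue_on {0..T}. (norm (Z n t - z t))\<^sup>2) \<longlonglongrightarrow> (LINT t|lebesgue_on {0..T}. 0)"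
  proof (rule integral_dominated_convergence[where w = "\<lambda>_. (2 * B)\<^sup>2"])
    show "AE t in lebesgue_on {0..T}. (\<lambda>n. (norm (Z n t - z t))\<^sup>2) \<longlonglongrightarrow> 0"
    proof (rule AE_I2)
      fix t assume "t \<in> space (lebesgue_on {0..T})"
      then have "(\<lambda>n. (norm (Z n t - z t))\<^sup>2) \<longlonglongrightarrow> (norm (z t - z t))\<^sup>2" by (intro tendsto_intros lim) simp
      then show "(\<lambda>n. (norm (Z n t - z t))\<^sup>2) \<longlonglongrightarrow> 0" by simp
    qed
    show "AE t in lebesgue_on {0..T}. norm ((norm (Z n t - z t))\<^sup>2) \<le> (2 * B)\<^sup>2" for n
    proof (rule AE_I2)
      fix t assume "t \<in> space (lebesgue_on {0..T})"
      then have "norm (Z n t - z t) \<le> 2 * B"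
        using norm_triangle_ineq4[of "Z n t" "z t"] bd(1)[of t n] bd(2)[of t] by simp
      then show "norm ((norm (Z n t - z t))\<^sup>2) \<le> (2 * B)\<^sup>2" using power_mono[of _ "2 * B" 2] by simp
    qed
  qed auto
  then show ?thesis by (simp add: L2.sconv_def L2ip_self L2comb_def)
qed

section \<open>Trajectories that obey the chain rule, and compactness for the De Giorgi
  functional\<close>

locale gradient_flow = energy +
  fixes T :: real and y0 :: 'a
  assumes T_pos: "T > 0" and chain: "chain_rule T \<phi>" and y0_dom: "y0 \<in> dom_fun \<phi>"
begin

text \<open>Infinite energy is sent to 0, so real-valued estimates are always accompanied by a proof
  that \<open>\<phi> z = ereal (ephi z)\<close>.\<close>

definition ephi :: "'a \<Rightarrow> real" where "ephi z = real_of_ereal (\<phi> z)"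

lemma ephi_measurable [measurable]: "ephi \<in> borel_measurable borel"
  unfolding ephi_def by measurable

lemma phi_y0: "\<phi> y0 = ereal (ephi y0)"
  using y0_dom phi_ninf[of y0] by (cases "\<phi> y0") (auto simp: ephi_def dom_fun_def)

text \<open>Exactly the premises of the chain rule. For square integrable u and y in
  \<open>H1fun\<close> with initial value y0, such a \<open>\<xi>\<close> exists iff
  \<open>G_DG\<close> is finite at (u, y).\<close>

definition flow_sel :: "(real \<Rightarrow> 'a) \<Rightarrow> (real \<Rightarrow> 'a) \<Rightarrow> bool" where
  "flow_sel y \<xi> \<longleftrightarrow> y \<in> H1fun T \<and> \<xi> \<in> L2fun T \<and> (AE t in lebesgue_on {0..T}. \<xi> t \<in> frechet_subdiff \<phi> (y t))"

lemma flow_sel_finite: "flow_sel y \<xi> \<Longrightarrow> t \<in> {0..T} \<Longrightarrow> \<phi> (y t) = ereal (ephi (y t))"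
  using chain unfolding chain_rule_def flow_sel_def ephi_def by (metis ereal_real')

lemma flow_sel_energy:
  assumes f: "flow_sel y \<xi>" and t: "t \<in> {0..T}"
  shows "ephi (y t) - ephi (y 0) = L2ip T \<xi> (\<lambda>s. indicator {0..t} s *\<^sub>R h1deriv T y s)"
proof -
  have y: "y \<in> H1fun T" and \<xi>: "\<xi> \<in> L2fun T" using f by (auto simp: flow_sel_def)
  have "abs_cont_on 0 T (\<lambda>t. ephi (y t))"
    and "AE t in lebesgue_on {0..T}. ((\<lambda>s. ephi (y s)) has_real_derivative inner (\<xi> t) (h1deriv T y t)) (at t within {0..T})"
    using chain f unfolding chain_rule_def flow_sel_def ephi_def by blast+
  from abs_cont_on_FTC[OF t this integrable_inner_L2fun[OF \<xi> h1deriv_L2fun[OF y]]]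
  show ?thesis by (simp add: L2ip_def)
qed

lemma flow_sel_energy_final:
  assumes f: "flow_sel y \<xi>"
  shows "ephi (y T) - ephi (y 0) = L2ip T \<xi> (h1deriv T y)"
proof -
  have "ephi (y T) - ephi (y 0) = L2ip T \<xi> (\<lambda>s. indicator {0..T} s *\<^sub>R h1deriv T y s)"
    using flow_sel_energy[OF f, of T] T_pos by simp
  also have "\<dots> = L2ip T \<xi> (h1deriv T y)"
    unfolding L2ip_def by (intro Bochner_Integration.integral_cong) auto
  finally show ?thesis .
qed

definition Gval :: "(real \<Rightarrow> 'a) \<Rightarrow> (real \<Rightarrow> 'a) \<Rightarrow> (real \<Rightarrow> 'a) \<Rightarrow> real" where
  "Gval u y \<xi> = L2ip T (h1deriv T y) (h1deriv T y) / 2 + L2ip T (\<lambda>t. \<xi> t - u t) (\<lambda>t. \<xi> t - u t) / 2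
     - L2ip T u (h1deriv T y) + ephi (y T) - ephi y0"

lemma G_DG_eq_Gval:
  assumes u: "u \<in> L2fun T" and f: "flow_sel y \<xi>" and y0: "y 0 = y0"
  shows "G_DG T \<phi> y0 (u, y) = ereal (Gval u y \<xi>)"
proof -
  let ?M = "lebesgue_on {0..T}"
  have y: "y \<in> H1fun T" and \<xi>: "\<xi> \<in> L2fun T" and ae: "AE t in ?M. \<xi> t \<in> frechet_subdiff \<phi> (y t)"
    using f by (auto simp: flow_sel_def)
  have dom: "AE t in ?M. y t \<in> dom_subdiff \<phi>" using ae by (auto simp: dom_subdiff_def elim: eventually_mono)
  note int = L2fun_integrable_nsq[OF h1deriv_L2fun[OF y]] L2fun_integrable_nsq[OF L2fun_diff[OF \<xi> u]]
  have "(\<integral>\<^sup>+ t. ennreal ((norm (h1deriv T y t))\<^sup>2 / 2 + (norm (subdiff_fun \<phi> (y t) - u t))\<^sup>2 / 2) \<partial>?M)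
      = (\<integral>\<^sup>+ t. ennreal ((norm (h1deriv T y t))\<^sup>2 / 2 + (norm (\<xi> t - u t))\<^sup>2 / 2) \<partial>?M)"
  proof (rule nn_integral_cong_AE)
    show "AE t in ?M. ennreal ((norm (h1deriv T y t))\<^sup>2 / 2 + (norm (subdiff_fun \<phi> (y t) - u t))\<^sup>2 / 2)
        = ennreal ((norm (h1deriv T y t))\<^sup>2 / 2 + (norm (\<xi> t - u t))\<^sup>2 / 2)"
      using ae by (rule eventually_mono) (simp add: subdiff_fun_eq)
  qed
  also have "\<dots> = ennreal (LINT t|?M. (norm (h1deriv T y t))\<^sup>2 / 2 + (norm (\<xi> t - u t))\<^sup>2 / 2)"
    using int by (intro nn_integral_eq_integral) auto
  also have "(LINT t|?M. (norm (h1deriv T y t))\<^sup>2 / 2 + (norm (\<xi> t - u t))\<^sup>2 / 2)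
      = L2ip T (h1deriv T y) (h1deriv T y) / 2 + L2ip T (\<lambda>t. \<xi> t - u t) (\<lambda>t. \<xi> t - u t) / 2"
    unfolding L2ip_self using int by simp
  finally have I: "enn2ereal (\<integral>\<^sup>+ t. ennreal ((norm (h1deriv T y t))\<^sup>2 / 2 + (norm (subdiff_fun \<phi> (y t) - u t))\<^sup>2 / 2) \<partial>?M)
      = ereal (L2ip T (h1deriv T y) (h1deriv T y) / 2 + L2ip T (\<lambda>t. \<xi> t - u t) (\<lambda>t. \<xi> t - u t) / 2)"
    by (simp add: enn2ereal_ennreal L2ip_self del: ennreal_plus)
  have "\<phi> (y T) = ereal (ephi (y T))" using flow_sel_finite[OF f, of T] T_pos by simp
  then show ?thesis
    unfolding G_DG_def Let_def fst_conv snd_conv I Gval_def L2ip_def[symmetric] using dom y0 phi_y0 by simp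
qed

text \<open>An infinite integral could not be offset, since \<open>\<phi> (y T)\<close> is never
  -\<infinity> and the other terms are real. A finite integral makes \<xi> - u square integrable,
  where \<xi> is measurable as the Borel selection composed with y.\<close>

lemma G_DG_finite_obtains:
  assumes u: "u \<in> L2fun T" and y: "y \<in> H1fun T" and G: "G_DG T \<phi> y0 (u, y) < \<infinity>"
  obtains \<xi> where "flow_sel y \<xi>" "y 0 = y0"
proof -
  let ?M = "lebesgue_on {0..T}"
  have dom: "AE t in ?M. y t \<in> dom_subdiff \<phi>" and y0: "y 0 = y0"
    using G by (auto simp: G_DG_def Let_def split: if_splits)
  define \<xi> where "\<xi> t = sel (y t)" for t
  note [measurable] = L2fun_measurable[OF u] L2fun_measurable[OF H1fun_L2fun[OF y]]
    L2fun_measurable[OF h1deriv_L2fun[OF y]]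
  have \<xi>m [measurable]: "\<xi> \<in> borel_measurable ?M"
    unfolding \<xi>_def by measurable
  have ae: "AE t in ?M. \<xi> t \<in> frechet_subdiff \<phi> (y t)"
    using dom by (rule eventually_mono) (simp add: \<xi>_def sel_in)
  define I where "I = (\<integral>\<^sup>+ t. ennreal ((norm (h1deriv T y t))\<^sup>2 / 2 + (norm (subdiff_fun \<phi> (y t) - u t))\<^sup>2 / 2) \<partial>?M)"
  have "I \<noteq> \<infinity>"
  proof
    assume "I = \<infinity>"
    then have "G_DG T \<phi> y0 (u, y) = \<infinity> + \<phi> (y T) - ereal (ephi y0)"
      unfolding G_DG_def Let_def fst_conv snd_conv I_def[symmetric] using dom y0 by (simp add: phi_y0)
    then show False using G phi_ninf[of "y T"] by simp
  qed
  moreover have "I = (\<integral>\<^sup>+ t. ennreal ((norm (h1deriv T y t))\<^sup>2 / 2 + (norm (\<xi> t - u t))\<^sup>2 / 2) \<partial>?M)"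
    unfolding I_def
  proof (rule nn_integral_cong_AE)
    show "AE t in ?M. ennreal ((norm (h1deriv T y t))\<^sup>2 / 2 + (norm (subdiff_fun \<phi> (y t) - u t))\<^sup>2 / 2)
        = ennreal ((norm (h1deriv T y t))\<^sup>2 / 2 + (norm (\<xi> t - u t))\<^sup>2 / 2)"
      using dom by (rule eventually_mono) (simp add: \<xi>_def sel_def)
  qed
  ultimately have fin: "(\<integral>\<^sup>+ t. ennreal ((norm (h1deriv T y t))\<^sup>2 / 2 + (norm (\<xi> t - u t))\<^sup>2 / 2) \<partial>?M) < \<infinity>"
    by (simp add: less_top)
  have "integrable ?M (\<lambda>t. (norm (h1deriv T y t))\<^sup>2 / 2 + (norm (\<xi> t - u t))\<^sup>2 / 2)"
    by (rule integrableI_bounded) (use fin in \<open>auto simp: abs_of_nonneg\<close>)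
  then have "integrable ?M (\<lambda>t. 2 * ((norm (h1deriv T y t))\<^sup>2 / 2 + (norm (\<xi> t - u t))\<^sup>2 / 2))"
    by (rule integrable_mult_right)
  then have "integrable ?M (\<lambda>t. (norm (\<xi> t - u t))\<^sup>2)"
    by (rule Bochner_Integration.integrable_bound) auto
  then have "(\<lambda>t. \<xi> t - u t) \<in> L2fun T" by (simp add: L2fun_def)
  from L2fun_add[OF this u] have "\<xi> \<in> L2fun T" by simp
  with ae y y0 show ?thesis using that by (auto simp: flow_sel_def)
qed

lemma Gval_nonneg:
  assumes u: "u \<in> L2fun T" and f: "flow_sel y \<xi>" and y0: "y 0 = y0"
  shows "0 \<le> Gval u y \<xi>"
proof -
  have y: "y \<in> H1fun T" and \<xi>: "\<xi> \<in> L2fun T" using f by (auto simp: flow_sel_def)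
  define v p where "v = h1deriv T y" and "p = (\<lambda>t. \<xi> t - u t)"
  have v: "v \<in> L2fun T" and p: "p \<in> L2fun T" unfolding v_def p_def by (intro h1deriv_L2fun y L2fun_diff \<xi> u)+
  have "ephi (y T) - ephi y0 - L2ip T u v = L2ip T v p"
    using flow_sel_energy_final[OF f] y0 L2.ip_comb_right[OF \<xi> u v, of 1 "-1"]
      L2.ip_commute[OF v u] L2.ip_commute[OF v \<xi>]
    by (simp add: v_def p_def L2comb_def)
  moreover have "0 \<le> L2ip T v v + 2 * L2ip T v p + L2ip T p p"
    using L2.ip_nonneg[OF L2.comb_in[OF v p], of 1 1] L2.nsq_comb[OF v p, of 1 1] by simp
  ultimately show ?thesis unfolding Gval_def v_def[symmetric] p_def[symmetric] by linarith
qed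

lemma G_DG_nonneg:
  assumes "x \<in> Xset T"
  shows "0 \<le> G_DG T \<phi> y0 x"
proof (cases "G_DG T \<phi> y0 x < \<infinity>")
  case True
  obtain u y where x: "x = (u, y)" "u \<in> L2fun T" "y \<in> H1fun T" using assms by (auto simp: Xset_def)
  obtain \<xi> where "flow_sel y \<xi>" "y 0 = y0" using G_DG_finite_obtains[OF x(2,3)] True x(1) by blast
  then show ?thesis using G_DG_eq_Gval[OF x(2)] Gval_nonneg[OF x(2)] x(1) by simp
qed auto

text \<open>Lower semicontinuity in the shape that Fatou's lemma consumes: subtracting a lower bound
  m of the energy moves it to the nonnegative extended reals. The complement of a sublevel is open,
  so strict lower bounds persist.\<close>

lemma ephi_liminf:
  assumes "zs \<longlonglongrightarrow> z" "\<And>n. \<phi> (zs n) = ereal (ephi (zs n))" "\<phi> z = ereal (ephi z)"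
  shows "ennreal (ephi z - m) \<le> liminf (\<lambda>n. ennreal (ephi (zs n) - m))"
  unfolding le_Liminf_iff
proof (intro allI impI)
  fix c assume c: "c < ennreal (ephi z - m)"
  then obtain a where a: "c = ennreal a" "0 \<le> a" by (cases c) auto
  have az: "a + m < ephi z" using c a by (simp add: ennreal_less_iff)
  have "open (- {x. \<phi> x \<le> ereal (a + m)})"
    using compact_imp_closed[OF sublevel] by (simp add: open_Compl)
  moreover have "z \<in> - {x. \<phi> x \<le> ereal (a + m)}" using az assms(3) by simp
  ultimately have "\<forall>\<^sub>F n in sequentially. zs n \<in> - {x. \<phi> x \<le> ereal (a + m)}"
    using topological_tendstoD[OF assms(1)] by blast
  then show "\<forall>\<^sub>F n in sequentially. c < ennreal (ephi (zs n) - m)"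
    by eventually_elim (use assms(2) a in \<open>auto simp: ennreal_less_iff\<close>)
qed

text \<open>The subgradient inequality is integrated over the set \<open>A\<close> where its limit fails, which Fatou
  shows to be null. A countable dense part of the epigraph of \<open>\<phi>1\<close> makes the exceptional set
  independent of the test point.\<close>

lemma flow_sel_closed:
  assumes f: "\<And>n. flow_sel (Y n) (\<Xi> n)" and lim: "\<And>t. t \<in> {0..T} \<Longrightarrow> (\<lambda>n. Y n t) \<longlonglongrightarrow> y t"
    and le: "\<And>n t. t \<in> {0..T} \<Longrightarrow> \<phi> (Y n t) \<le> ereal C"
    and y: "y \<in> H1fun T" and \<zeta>: "\<zeta> \<in> L2fun T" and weak: "L2.wconv T \<Xi> \<zeta>"
    and bd: "\<And>n. L2ip T (\<Xi> n) (\<Xi> n) \<le> M"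
  shows "flow_sel y \<zeta>"
proof -
  let ?M = "lebesgue_on {0..T}"
  define K where "K = {x. \<phi> x \<le> ereal C}"
  have K: "compact K" unfolding K_def by (rule sublevel)
  have Y: "Y n \<in> H1fun T" and \<Xi>: "\<Xi> n \<in> L2fun T" and ae\<Xi>: "AE t in ?M. \<Xi> n t \<in> frechet_subdiff \<phi> (Y n t)" for n
    using f[of n] by (auto simp: flow_sel_def)
  note [measurable] = L2fun_measurable[OF H1fun_L2fun[OF Y]] L2fun_measurable[OF \<Xi>]
    L2fun_measurable[OF H1fun_L2fun[OF y]] L2fun_measurable[OF \<zeta>]
  have YK: "Y n t \<in> K" if "t \<in> {0..T}" for n t using le[OF that] by (simp add: K_def)
  have yK: "y t \<in> K" if "t \<in> {0..T}" for t
    using closed_sequentially[OF compact_imp_closed[OF K] _ lim[OF that]] YK[OF that] by blast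
  obtain R where R: "\<And>z. z \<in> K \<Longrightarrow> norm z \<le> R"
    using compact_imp_bounded[OF K] unfolding bounded_iff by blast
  obtain m where m: "\<And>x. ereal m \<le> \<phi> x" using phi_lower_bound by blast
  have fin: "\<phi> z = ereal (ephi z)" if "z \<in> K" for z
    using that phi_ninf[of z] by (cases "\<phi> z") (auto simp: K_def ephi_def)
  have ephi_bd: "m \<le> ephi z" "ephi z \<le> C" if "z \<in> K" for z
    using m[of z] that fin[OF that] by (auto simp: K_def)
  note [measurable] = borel_measurable_continuous_onI[OF phi2_continuous] borel_measurable_continuous_onI[OF grad_cont]
  have step: "AE t in ?M. ephi (y t) \<le> q + \<phi>2 (y t) - inner (\<zeta> t - g (y t)) (w - y t)"
    if wq: "\<phi>1 w \<le> ereal q" for w q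
  proof -
    define h where "h z = q + \<phi>2 z + inner (g z) (w - z)" for z
    have h_cont: "continuous_on UNIV h"
      unfolding h_def by (intro continuous_intros phi2_continuous grad_cont)
    note [measurable] = borel_measurable_continuous_onI[OF h_cont]
    obtain H where H: "\<And>z. z \<in> K \<Longrightarrow> norm (h z) \<le> H"
      using compact_imp_bounded[OF compact_continuous_image[OF continuous_on_subset[OF h_cont] K]]
      unfolding bounded_iff by auto
    define c where "c t = h (y t) - inner (\<zeta> t) (w - y t)" for t
    define cn where "cn n t = h (Y n t) - inner (\<Xi> n t) (w - Y n t)" for n t
    define A where "A = {t \<in> space ?M. c t < ephi (y t)}"
    have A [measurable]: "A \<in> sets ?M" unfolding A_def c_def by measurable
    \<comment> \<open>The set A is fixed, so these test functions converge strongly and may be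
      paired with the weakly convergent subgradients.\<close>
    define D where "D n t = indicator A t *\<^sub>R (w - Y n t)" for n t
    define D' where "D' t = indicator A t *\<^sub>R (w - y t)" for t
    have Dm [measurable]: "D n \<in> borel_measurable ?M" "D' \<in> borel_measurable ?M" for n
      unfolding D_def D'_def by measurable
    have ind: "norm (indicator A t *\<^sub>R (w - z)) \<le> norm w + R" if "z \<in> K" for z t
      using norm_triangle_ineq4[of w z] R[OF that] order_trans[OF norm_ge_zero R[OF that]]
      by (auto simp: indicator_def)
    have Dbd: "norm (D n t) \<le> norm w + R" "norm (D' t) \<le> norm w + R" if "t \<in> {0..T}" for n t
      unfolding D_def D'_def using YK[OF that] yK[OF that] ind by auto
    have DL2: "D n \<in> L2fun T" "D' \<in> L2fun T" for n
      by (rule L2fun_bounded[of _ _ "norm w + R"]; use Dbd in simp)+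
    have "L2.sconv T D D'"
      by (rule sconv_dominated[of _ _ _ "norm w + R"])
        (use Dbd in \<open>auto simp: D_def D'_def intro!: tendsto_intros lim\<close>)
    then have lim1: "(\<lambda>n. L2ip T (\<Xi> n) (D n)) \<longlonglongrightarrow> L2ip T \<zeta> D'"
      by (intro L2.wconv_sconv_ip[OF \<Xi> DL2(1) DL2(2) bd weak])
    \<comment> \<open>The shift by the lower bound m makes the energies nonnegative for Fatou; it
      cancels in the final comparison.\<close>
    define hn where "hn n t = indicator A t * (h (Y n t) - m)" for n t
    define h' where "h' t = indicator A t * (h (y t) - m)" for t
    have hbd: "norm (indicator A t * (h z - m)) \<le> H + \<bar>m\<bar>" if "z \<in> K" for z t
      using H[OF that] abs_triangle_ineq4[of "h z" m] order_trans[OF norm_ge_zero H[OF that]]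
      by (auto simp: indicator_def)
    have hm [measurable]: "hn n \<in> borel_measurable ?M" "h' \<in> borel_measurable ?M" for n
      unfolding hn_def h'_def by measurable
    have h_int: "integrable ?M (hn n)" "integrable ?M h'" for n
      using YK yK hbd unfolding hn_def h'_def
      by (auto intro!: finite_measure.integrable_const_bound[OF finite_measure_interval, of _ "H + \<bar>m\<bar>"] AE_I2)
    have lim2: "(\<lambda>n. LINT t|?M. hn n t) \<longlonglongrightarrow> (LINT t|?M. h' t)"
    proof (rule integral_dominated_convergence[where w = "\<lambda>_. H + \<bar>m\<bar>"])
      show "AE t in ?M. (\<lambda>n. hn n t) \<longlonglongrightarrow> h' t"
      proof (rule AE_I2)
        fix t assume "t \<in> space ?M"
        then have "t \<in> {0..T}" by simp
        moreover have "isCont h (y t)" using h_cont by (simp add: continuous_on_eq_continuous_at)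
        ultimately have "(\<lambda>n. h (Y n t)) \<longlonglongrightarrow> h (y t)" using isCont_tendsto_compose lim by blast
        then show "(\<lambda>n. hn n t) \<longlonglongrightarrow> h' t" unfolding hn_def h'_def by (intro tendsto_intros)
      qed
      show "AE t in ?M. norm (hn n t) \<le> H + \<bar>m\<bar>" for n
        unfolding hn_def using YK hbd by (intro AE_I2) auto
    qed auto
    define J where "J n = (LINT t|?M. hn n t) - L2ip T (\<Xi> n) (D n)" for n
    define J' where "J' = (LINT t|?M. h' t) - L2ip T \<zeta> D'"
    have Jlim: "J \<longlonglongrightarrow> J'" unfolding J_def J'_def by (intro tendsto_diff lim1 lim2)
    have cn_int: "integrable ?M (\<lambda>t. indicator A t * (cn n t - m))"
      and J_eq: "J n = (LINT t|?M. indicator A t * (cn n t - m))" for n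
    proof -
      have eq: "(\<lambda>t. indicator A t * (cn n t - m)) = (\<lambda>t. hn n t - inner (\<Xi> n t) (D n t))"
        by (auto simp: cn_def hn_def D_def algebra_simps)
      show "integrable ?M (\<lambda>t. indicator A t * (cn n t - m))"
        unfolding eq by (intro Bochner_Integration.integrable_diff h_int integrable_inner_L2fun \<Xi> DL2)
      show "J n = (LINT t|?M. indicator A t * (cn n t - m))"
        unfolding eq J_def L2ip_def using h_int integrable_inner_L2fun[OF \<Xi> DL2(1)] by simp
    qed
    have c_int: "integrable ?M (\<lambda>t. indicator A t * (c t - m))"
      and J'_eq: "J' = (LINT t|?M. indicator A t * (c t - m))"
    proof -
      have eq: "(\<lambda>t. indicator A t * (c t - m)) = (\<lambda>t. h' t - inner (\<zeta> t) (D' t))"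
        by (auto simp: c_def h'_def D'_def algebra_simps)
      show "integrable ?M (\<lambda>t. indicator A t * (c t - m))"
        unfolding eq by (intro Bochner_Integration.integrable_diff h_int integrable_inner_L2fun \<zeta> DL2)
      show "J' = (LINT t|?M. indicator A t * (c t - m))"
        unfolding eq J'_def L2ip_def using h_int integrable_inner_L2fun[OF \<zeta> DL2(2)] by simp
    qed
    have cn_ge: "AE t in ?M. ephi (Y n t) \<le> cn n t" for n
      using ae\<Xi>[of n] AE_space
    proof eventually_elim
      case (elim t)
      then have "\<phi> (Y n t) = ereal (ephi (Y n t))" using fin YK by simp
      then have "\<phi>1 (Y n t) = ereal (ephi (Y n t) - \<phi>2 (Y n t))" by (rule phi1_eq)
      moreover have "\<phi>1 (Y n t) + ereal (inner (\<Xi> n t - g (Y n t)) (w - Y n t)) \<le> ereal q"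
        using elim(1) wq order_trans unfolding subdiff_iff by blast
      ultimately show ?case by (simp add: cn_def h_def inner_diff_left)
    qed
    have Yn_le: "(\<integral>\<^sup>+t. ennreal (indicator A t * (ephi (Y n t) - m)) \<partial>?M) \<le> ennreal (J n)" and J0: "0 \<le> J n" for n
    proof -
      have nn: "AE t in ?M. 0 \<le> indicator A t * (cn n t - m)"
        using cn_ge[of n] AE_space
      proof eventually_elim
        case (elim t)
        then have "m \<le> ephi (Y n t)" using ephi_bd(1)[OF YK] by simp
        then show ?case using elim(1) by (auto simp: indicator_def)
      qed
      have "(\<integral>\<^sup>+t. ennreal (indicator A t * (ephi (Y n t) - m)) \<partial>?M)
          \<le> (\<integral>\<^sup>+t. ennreal (indicator A t * (cn n t - m)) \<partial>?M)"
        by (rule nn_integral_mono_AE, rule eventually_mono[OF cn_ge[of n]])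
          (auto intro!: ennreal_leI simp: indicator_def)
      also have "\<dots> = ennreal (J n)"
        unfolding J_eq by (rule nn_integral_eq_integral[OF cn_int nn])
      finally show "(\<integral>\<^sup>+t. ennreal (indicator A t * (ephi (Y n t) - m)) \<partial>?M) \<le> ennreal (J n)" .
      show "0 \<le> J n" unfolding J_eq by (rule integral_nonneg_AE[OF nn])
    qed
    have J'0: "0 \<le> J'" by (rule LIMSEQ_le_const[OF Jlim]) (use J0 in auto)
    have e_int: "integrable ?M (\<lambda>t. indicator A t * (ephi (y t) - m))"
    proof (rule finite_measure.integrable_const_bound[OF finite_measure_interval])
      show "AE t in ?M. norm (indicator A t * (ephi (y t) - m)) \<le> \<bar>C\<bar> + \<bar>m\<bar>"
      proof (rule AE_I2)
        fix t assume "t \<in> space ?M"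
        then have "m \<le> ephi (y t)" "ephi (y t) \<le> C" using ephi_bd yK by auto
        then show "norm (indicator A t * (ephi (y t) - m)) \<le> \<bar>C\<bar> + \<bar>m\<bar>" by (auto simp: indicator_def)
      qed
    qed measurable
    have "ennreal (LINT t|?M. indicator A t * (ephi (y t) - m)) = (\<integral>\<^sup>+t. ennreal (indicator A t * (ephi (y t) - m)) \<partial>?M)"
      using ephi_bd yK by (intro nn_integral_eq_integral[OF e_int, symmetric]) (auto intro!: AE_I2)
    also have "\<dots> \<le> (\<integral>\<^sup>+t. liminf (\<lambda>n. ennreal (indicator A t * (ephi (Y n t) - m))) \<partial>?M)"
    proof (rule nn_integral_mono)
      fix t assume t: "t \<in> space ?M"
      show "ennreal (indicator A t * (ephi (y t) - m)) \<le> liminf (\<lambda>n. ennreal (indicator A t * (ephi (Y n t) - m)))"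
        using ephi_liminf[OF lim, of t m] fin YK yK t by (cases "t \<in> A") (auto simp: Liminf_const)
    qed
    also have "\<dots> \<le> liminf (\<lambda>n. \<integral>\<^sup>+t. ennreal (indicator A t * (ephi (Y n t) - m)) \<partial>?M)"
      by (rule nn_integral_liminf) measurable
    also have "\<dots> \<le> liminf (\<lambda>n. ennreal (J n))"
      by (rule Liminf_mono) (simp add: Yn_le)
    also have "\<dots> = ennreal J'"
      by (rule lim_imp_Liminf[OF sequentially_bot tendsto_ennrealI[OF Jlim]])
    finally have "(LINT t|?M. indicator A t * (ephi (y t) - m)) \<le> J'" using J'0 by simp
    \<comment> \<open>The integrand is strictly positive on A, so a nonpositive integral forces A to
      be null.\<close>
    moreover have "(LINT t|?M. indicator A t * (ephi (y t) - c t))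
        = (LINT t|?M. indicator A t * (ephi (y t) - m)) - J'"
      unfolding J'_eq Bochner_Integration.integral_diff[OF e_int c_int, symmetric]
      by (intro Bochner_Integration.integral_cong) (auto simp: algebra_simps)
    ultimately have le0: "(LINT t|?M. indicator A t * (ephi (y t) - c t)) \<le> 0" by simp
    have nn: "0 \<le> indicator A t * (ephi (y t) - c t)" for t
      by (auto simp: A_def indicator_def)
    have "integrable ?M (\<lambda>t. indicator A t * (ephi (y t) - c t))"
      using Bochner_Integration.integrable_diff[OF e_int c_int] by (simp add: algebra_simps)
    moreover have "(LINT t|?M. indicator A t * (ephi (y t) - c t)) = 0"
      using le0 Bochner_Integration.integral_nonneg[of ?M, OF nn] by (intro antisym) auto
    ultimately have "AE t in ?M. indicator A t * (ephi (y t) - c t) = 0"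
      using integral_nonneg_eq_0_iff_AE[of ?M "\<lambda>t. indicator A t * (ephi (y t) - c t)"] nn by auto
    then show ?thesis using AE_space
    proof eventually_elim
      case (elim t)
      then have "t \<notin> A" by (auto simp: A_def)
      then have "ephi (y t) \<le> c t" using elim(2) by (auto simp: A_def)
      then show ?case by (simp add: c_def h_def inner_diff_left)
    qed
  qed
  \<comment> \<open>Since \<open>\<phi>1\<close> need not be continuous, a dense set of points w
    would say nothing about \<open>\<phi>1\<close> at their limits; as a condition on the pair (w,
    q) the inequality is closed.\<close>
  define epi where "epi = {(w, q). \<phi>1 w \<le> ereal q}"
  obtain D where D: "countable D" "D \<subseteq> epi" "epi \<subseteq> closure D" by (rule countable_dense_subset)
  have "AE t in ?M. \<forall>d\<in>D. ephi (y t) \<le> snd d + \<phi>2 (y t) - inner (\<zeta> t - g (y t)) (fst d - y t)"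
    unfolding AE_ball_countable[OF D(1)] using step D(2) by (auto simp: epi_def)
  then have "AE t in ?M. \<zeta> t \<in> frechet_subdiff \<phi> (y t)"
    using AE_space
  proof eventually_elim
    case (elim t)
    define S where "S = {d. ephi (y t) \<le> snd d + \<phi>2 (y t) - inner (\<zeta> t - g (y t)) (fst d - y t)}"
    have "closed S" unfolding S_def by (intro closed_Collect_le continuous_intros)
    then have "epi \<subseteq> S" using D(3) closure_minimal[of D S] elim(1) by (auto simp: S_def)
    have \<phi>1y: "\<phi>1 (y t) = ereal (ephi (y t) - \<phi>2 (y t))" using phi1_eq[OF fin[OF yK]] elim(2) by simp
    have "\<phi>1 (y t) + ereal (inner (\<zeta> t - g (y t)) (w - y t)) \<le> \<phi>1 w" for w
    proof (cases "\<phi>1 w")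
      case (real q)
      then have "(w, q) \<in> S" using \<open>epi \<subseteq> S\<close> by (auto simp: epi_def)
      then show ?thesis by (simp add: \<phi>1y real S_def)
    qed (use phi1_ninf[of w] in auto)
    then show ?case by (simp add: subdiff_iff \<phi>1y)
  qed
  then show ?thesis using y \<zeta> by (simp add: flow_sel_def)
qed

text \<open>The coupling term is absorbed into the velocity by Young's inequality and the final
  energy is bounded below, which yields the L^2 bounds. The chain rule on [0, t] then bounds the
  energy at every time.\<close>

lemma G_DG_apriori_bounds:
  fixes us ys \<xi> :: "nat \<Rightarrow> real \<Rightarrow> 'a"
  assumes f: "\<And>n. flow_sel (ys n) (\<xi> n)" and y0: "\<And>n. ys n 0 = y0"
    and us: "\<And>n. us n \<in> L2fun T" and B: "\<And>n. L2ip T (us n) (us n) \<le> B"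
    and G: "\<And>n. Gval (us n) (ys n) (\<xi> n) \<le> C"
  shows "\<exists>M. \<forall>n. L2ip T (h1deriv T (ys n)) (h1deriv T (ys n)) \<le> M
    \<and> L2ip T (\<lambda>t. \<xi> n t - us n t) (\<lambda>t. \<xi> n t - us n t) \<le> M
    \<and> L2ip T (\<xi> n) (\<xi> n) \<le> M \<and> (\<forall>t\<in>{0..T}. \<phi> (ys n t) \<le> ereal M)"
proof -
  obtain m where m: "\<And>x. ereal m \<le> \<phi> x" using phi_lower_bound by blast
  have y: "ys n \<in> H1fun T" and \<xi>: "\<xi> n \<in> L2fun T" for n using f[of n] by (auto simp: flow_sel_def)
  define v p where "v n = h1deriv T (ys n)" and "p n = (\<lambda>t. \<xi> n t - us n t)" for n
  have v: "v n \<in> L2fun T" and p: "p n \<in> L2fun T" for n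
    unfolding v_def p_def by (intro h1deriv_L2fun y L2fun_diff \<xi> us)+
  note nn = L2.ip_nonneg[OF v] L2.ip_nonneg[OF p] L2.ip_nonneg[OF us] L2.ip_nonneg[OF \<xi>]
  \<comment> \<open>From \<open>Gval\<close> at most C, final energy at least m, and coupling term
    at most B plus a quarter of the squared velocity norm.\<close>
  define K where "K = C + B - m + ephi y0"
  have 1: "L2ip T (v n) (v n) / 4 + L2ip T (p n) (p n) / 2 \<le> K" for n
  proof -
    have "m \<le> ephi (ys n T)"
      using m[of "ys n T"] flow_sel_finite[OF f, of T n] T_pos by simp
    then show ?thesis
      using G[of n] L2.ip_le_nsq[OF us v, of n n] B[of n]
      unfolding Gval_def v_def[symmetric] p_def[symmetric] K_def by linarith
  qed
  have bv: "L2ip T (v n) (v n) \<le> 4 * K" and bp: "L2ip T (p n) (p n) \<le> 2 * K" for n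
    using 1[of n] nn(1)[of n] nn(2)[of n] by linarith+
  have b\<xi>: "L2ip T (\<xi> n) (\<xi> n) \<le> 4 * K + 2 * B" for n
  proof -
    have "L2comb 1 (p n) 1 (us n) = \<xi> n" by (auto simp: L2comb_def p_def)
    then show ?thesis using L2.nsq_add_le[OF p us, of n n] bp[of n] B[of n] by simp
  qed
  \<comment> \<open>Both constants dominate squared norms, hence are nonnegative, and one sum can
    serve as the bound for all four quantities.\<close>
  have K0: "0 \<le> K" and B0: "0 \<le> B" using bv[of 0] nn(1)[of 0] B[of 0] nn(3)[of 0] by linarith+
  have b\<phi>: "\<phi> (ys n t) \<le> ereal (\<bar>ephi y0\<bar> + (4 * K + 2 * B) + K)" if t: "t \<in> {0..T}" for n t
  proof -
    let ?w = "\<lambda>s. indicator {0..t} s *\<^sub>R v n s"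
    have w: "?w \<in> L2fun T" "L2ip T ?w ?w \<le> L2ip T (v n) (v n)"
      by (rule L2ip_indicator_le[OF v initial_interval_sets[OF t]])+
    have "ephi (ys n t) - ephi y0 = L2ip T (\<xi> n) ?w"
      using flow_sel_energy[OF f t] y0 by (simp add: v_def)
    also have "\<dots> \<le> L2ip T (\<xi> n) (\<xi> n) + L2ip T ?w ?w / 4" by (rule L2.ip_le_nsq[OF \<xi> w(1)])
    also have "\<dots> \<le> (4 * K + 2 * B) + K" using b\<xi>[of n] w(2) bv[of n] by linarith
    finally have "ephi (ys n t) \<le> \<bar>ephi y0\<bar> + (4 * K + 2 * B) + K" by linarith
    then show ?thesis using flow_sel_finite[OF f t] by simp
  qed
  show ?thesis
  proof (intro exI[of _ "\<bar>ephi y0\<bar> + (4 * K + 2 * B) + K"] allI conjI ballI)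
    fix n
    show "L2ip T (h1deriv T (ys n)) (h1deriv T (ys n)) \<le> \<bar>ephi y0\<bar> + (4 * K + 2 * B) + K"
      using bv[of n] K0 B0 unfolding v_def by linarith
    show "L2ip T (\<lambda>t. \<xi> n t - us n t) (\<lambda>t. \<xi> n t - us n t) \<le> \<bar>ephi y0\<bar> + (4 * K + 2 * B) + K"
      using bp[of n] K0 B0 unfolding p_def by linarith
    show "L2ip T (\<xi> n) (\<xi> n) \<le> \<bar>ephi y0\<bar> + (4 * K + 2 * B) + K"
      using b\<xi>[of n] K0 B0 by linarith
  qed (rule b\<phi>)
qed

text \<open>Pointwise strong convergence of the trajectories is free: the weak limit of the velocities
  determines the weak limit of every \<open>Y n t\<close>, and these points lie in a compact sublevel set.\<close>

lemma flow_convergence: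
  assumes f: "\<And>n. flow_sel (Y n) (\<Xi> n)" and y0: "\<And>n. Y n 0 = y0"
    and wv: "L2.wconv T (\<lambda>n. h1deriv T (Y n)) v" and v: "v \<in> L2fun T"
    and le: "\<And>n t. t \<in> {0..T} \<Longrightarrow> \<phi> (Y n t) \<le> ereal M"
  obtains y where "y \<in> H1fun T" "y 0 = y0" "limitin (H1w_top T) Y y sequentially"
    "\<And>t. t \<in> {0..T} \<Longrightarrow> (\<lambda>n. Y n t) \<longlonglongrightarrow> y t"
    "L2.wconv T (\<lambda>n. h1deriv T (Y n)) (h1deriv T y)"
proof -
  define y where "y = (\<lambda>t. if t \<in> {0..T} then y0 + integral\<^sup>L (lebesgue_on {0..t}) v else 0)"
  have y: "y \<in> H1fun T" "y 0 = y0" "AE t in lebesgue_on {0..T}. h1deriv T y t = v t"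
    unfolding y_def using indefinite_integral_H1fun[OF less_imp_le[OF T_pos] v, of y0] by auto
  have YH: "Y n \<in> H1fun T" for n using f[of n] by (simp add: flow_sel_def)
  have w: "L2.wconv T (\<lambda>n. h1deriv T (Y n)) (h1deriv T y)"
    unfolding L2.wconv_def
  proof
    fix z :: "real \<Rightarrow> 'a" assume z: "z \<in> L2fun T"
    have "L2ip T (h1deriv T y) z = L2ip T v z"
      by (rule L2ip_AE_cong) (use y z v h1deriv_L2fun in auto)
    then show "(\<lambda>n. L2ip T (h1deriv T (Y n)) z) \<longlonglongrightarrow> L2ip T (h1deriv T y) z"
      using wv z by (simp add: L2.wconv_def)
  qed
  have K: "compact {x. \<phi> x \<le> ereal M}" by (rule sublevel)
  have ptw: "(\<lambda>n. Y n t) \<longlonglongrightarrow> y t" if t: "t \<in> {0..T}" for t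
  proof (rule compact_weak_imp_strong[OF K])
    show "Y n t \<in> {x. \<phi> x \<le> ereal M}" for n using le[OF t] by simp
    fix w' :: 'a
    have "(\<lambda>s. indicator {0..t} s *\<^sub>R w') \<in> L2fun T"
      by (rule L2fun_indicator_const[OF initial_interval_sets[OF t]])
    then have "(\<lambda>n. inner y0 w' + L2ip T (h1deriv T (Y n)) (\<lambda>s. indicator {0..t} s *\<^sub>R w')) \<longlonglongrightarrow>
        inner y0 w' + L2ip T (h1deriv T y) (\<lambda>s. indicator {0..t} s *\<^sub>R w')"
      using w by (intro tendsto_intros) (simp add: L2.wconv_def)
    then show "(\<lambda>n. inner (Y n t) w') \<longlonglongrightarrow> inner (y t) w'"
      using inner_H1fun[OF YH t] inner_H1fun[OF y(1) t] y0 y(2) by simp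
  qed
  obtain R where R: "\<And>z. \<phi> z \<le> ereal M \<Longrightarrow> norm z \<le> R"
    using compact_imp_bounded[OF K] unfolding bounded_iff by auto
  have "L2.sconv T Y y"
  proof (rule sconv_dominated[of _ _ _ R])
    show "norm (Y n t) \<le> R" if "t \<in> {0..T}" for n t using R le that by blast
    show "norm (y t) \<le> R" if "t \<in> {0..T}" for t
      by (rule LIMSEQ_le_const2[OF tendsto_norm[OF ptw[OF that]]]) (use R le that in auto)
  qed (use ptw in \<open>auto intro!: L2fun_measurable H1fun_L2fun YH y(1)\<close>)
  then have sc: "L2.wconv T Y y"
    by (rule L2.sconv_imp_wconv[OF H1fun_L2fun[OF YH] H1fun_L2fun[OF y(1)]])
  have "limitin (H1w_top T) Y y sequentially"
    unfolding limitin_H1w_top_iff H1inner_L2ip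
    using sc w unfolding L2.wconv_def
    by (auto intro!: tendsto_add y(1) YH always_eventually dest: H1fun_L2fun h1deriv_L2fun)
  with y w ptw show ?thesis using that by blast
qed

text \<open>Velocity norm, slope norm and final energy are only lower semicontinuous, whereas the
  coupling term converges since controls converge strongly and velocities weakly. The control limit
  is prescribed and the limit l of the values is returned, so the lemma serves both existence and
  the liminf inequality.\<close>

lemma G_DG_compactness:
  assumes us: "\<And>n. us n \<in> L2fun T" and u: "u \<in> L2fun T" and lim: "(\<lambda>n. L2dist T u (us n)) \<longlonglongrightarrow> 0"
    and ys: "\<And>n. ys n \<in> H1fun T" and G: "\<And>n. G_DG T \<phi> y0 (us n, ys n) \<le> ereal C"
  obtains r y l where "strict_mono r" "y \<in> H1fun T" "limitin (H1w_top T) (ys \<circ> r) y sequentially"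
    "(\<lambda>n. G_DG T \<phi> y0 (us (r n), ys (r n))) \<longlonglongrightarrow> ereal l" "G_DG T \<phi> y0 (u, y) \<le> ereal l"
proof -
  have "\<exists>\<xi>. flow_sel (ys n) \<xi> \<and> ys n 0 = y0" for n
  proof -
    have "G_DG T \<phi> y0 (us n, ys n) < \<infinity>" by (rule le_less_trans[OF G]) simp
    from G_DG_finite_obtains[OF us ys this] show ?thesis by blast
  qed
  then obtain \<xi> where f: "\<And>n. flow_sel (ys n) (\<xi> n)" and y0: "\<And>n. ys n 0 = y0" by metis
  have Gv: "G_DG T \<phi> y0 (us n, ys n) = ereal (Gval (us n) (ys n) (\<xi> n))" for n
    by (rule G_DG_eq_Gval[OF us f y0])
  have \<xi>: "\<xi> n \<in> L2fun T" for n using f[of n] by (simp add: flow_sel_def)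
  have usc: "L2.sconv T us u" by (rule L2dist_tendsto_sconv[OF lim])
  have "Bseq (\<lambda>n. L2ip T (us n) (us n))"
    using L2.sconv_nsq[OF us u usc] by (intro convergent_imp_Bseq) (auto simp: convergent_def)
  then obtain B where B: "\<And>n. L2ip T (us n) (us n) \<le> B" unfolding Bseq_def by (auto simp: abs_le_iff)
  obtain M where M: "\<And>n. L2ip T (h1deriv T (ys n)) (h1deriv T (ys n)) \<le> M"
    "\<And>n. L2ip T (\<lambda>t. \<xi> n t - us n t) (\<lambda>t. \<xi> n t - us n t) \<le> M"
    "\<And>n. L2ip T (\<xi> n) (\<xi> n) \<le> M" "\<And>n t. t \<in> {0..T} \<Longrightarrow> \<phi> (ys n t) \<le> ereal M"
  proof -
    have "Gval (us n) (ys n) (\<xi> n) \<le> C" for n using G[of n] Gv[of n] by simp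
    from G_DG_apriori_bounds[of ys \<xi> us B C, OF f y0 us B this] show ?thesis using that by blast
  qed
  define p where "p n = L2comb 1 (\<xi> n) (-1) (us n)" for n
  have p_eq: "p n = (\<lambda>t. \<xi> n t - us n t)" for n by (simp add: p_def L2comb_def)
  have pL: "p n \<in> L2fun T" for n unfolding p_def by (rule L2.comb_in[OF \<xi> us])
  obtain m where m: "\<And>x. ereal m \<le> \<phi> x" using phi_lower_bound by blast
  have dL: "h1deriv T (ys n) \<in> L2fun T" for n by (rule h1deriv_L2fun[OF ys])
  obtain r1 v where r1: "strict_mono r1" "v \<in> L2fun T" "L2.wconv T ((\<lambda>n. h1deriv T (ys n)) \<circ> r1) v"
    using L2.weak_sequential_compactness[of "\<lambda>n. h1deriv T (ys n)" T M] dL M(1) by blast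
  obtain r2 \<zeta> where r2: "strict_mono r2" "\<zeta> \<in> L2fun T" "L2.wconv T ((\<xi> \<circ> r1) \<circ> r2) \<zeta>"
    using L2.weak_sequential_compactness[of "\<xi> \<circ> r1" T M] \<xi> M(3) by auto
  define r12 where "r12 = r1 \<circ> r2"
  \<comment> \<open>The three merely semicontinuous quantities form one sequence in a bounded box,
    so a single extraction makes all of them converge.\<close>
  define s where "s n = (L2ip T (h1deriv T (ys n)) (h1deriv T (ys n)), L2ip T (p n) (p n), ephi (ys n T))" for n
  have "s n \<in> {0..M} \<times> {0..M} \<times> {m..M}" for n
  proof -
    have "\<phi> (ys n T) = ereal (ephi (ys n T))" using flow_sel_finite[OF f, of T n] T_pos by simp
    then show ?thesis
      using M(1,2)[of n] M(4)[of T n] m[of "ys n T"] L2.ip_nonneg[OF dL] L2.ip_nonneg[OF pL] T_pos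
      by (auto simp: s_def p_eq)
  qed
  then have "range (s \<circ> r12) \<subseteq> {0..M} \<times> {0..M} \<times> {m..M}" by (intro image_subsetI) (simp only: o_apply)
  then have "bounded (range (s \<circ> r12))"
    by (rule bounded_subset[rotated]) (intro bounded_Times bounded_closed_interval)
  then obtain abp r3 where r3: "strict_mono r3" "((s \<circ> r12) \<circ> r3) \<longlonglongrightarrow> abp"
    using bounded_imp_convergent_subsequence by blast
  define r where "r = r12 \<circ> r3"
  obtain a b c where abp: "abp = (a, b, c)" by (cases abp)
  have r: "strict_mono r" unfolding r_def r12_def by (intro strict_mono_o r1 r2 r3)
  have lims: "(\<lambda>n. L2ip T (h1deriv T (ys (r n))) (h1deriv T (ys (r n)))) \<longlonglongrightarrow> a"
    "(\<lambda>n. L2ip T (p (r n)) (p (r n))) \<longlonglongrightarrow> b" "(\<lambda>n. ephi (ys (r n) T)) \<longlonglongrightarrow> c"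
    using tendsto_fst[OF r3(2)] tendsto_fst[OF tendsto_snd[OF r3(2)]] tendsto_snd[OF tendsto_snd[OF r3(2)]]
    by (simp_all add: s_def r_def o_def abp)
  have wv: "L2.wconv T (\<lambda>n. h1deriv T (ys (r n))) v"
    using L2.wconv_subseq[OF r1(3) strict_mono_o[OF r2(1) r3(1)]] by (simp add: r_def r12_def o_def)
  have w\<xi>: "L2.wconv T (\<lambda>n. \<xi> (r n)) \<zeta>"
    using L2.wconv_subseq[OF r2(3) r3(1)] by (simp add: r_def r12_def o_def)
  obtain y where y: "y \<in> H1fun T" "y 0 = y0" "limitin (H1w_top T) (\<lambda>n. ys (r n)) y sequentially"
    "\<And>t. t \<in> {0..T} \<Longrightarrow> (\<lambda>n. ys (r n) t) \<longlonglongrightarrow> y t"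
    "L2.wconv T (\<lambda>n. h1deriv T (ys (r n))) (h1deriv T y)"
    using flow_convergence[of "\<lambda>n. ys (r n)" "\<lambda>n. \<xi> (r n)" v M] f y0 wv r1(2) M(4) by blast
  have fy: "flow_sel y \<zeta>"
    by (rule flow_sel_closed[of "\<lambda>n. ys (r n)" "\<lambda>n. \<xi> (r n)" y M \<zeta> M]) (use f y r2 w\<xi> M in auto)
  have usr: "L2.sconv T (\<lambda>n. us (r n)) u" using L2.sconv_subseq[OF usc r] by (simp add: o_def)
  have wp: "L2.wconv T (\<lambda>n. p (r n)) (L2comb 1 \<zeta> (-1) u)"
    unfolding p_def using L2.sconv_imp_wconv[OF us u usr] w\<xi> \<xi> us r2(2) u by (intro L2.wconv_comb) auto
  have a_le: "L2ip T (h1deriv T y) (h1deriv T y) \<le> a"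
    by (rule L2.wconv_nsq_le[OF dL h1deriv_L2fun[OF y(1)] y(5) lims(1)])
  have b_le: "L2ip T (\<lambda>t. \<zeta> t - u t) (\<lambda>t. \<zeta> t - u t) \<le> b"
    using L2.wconv_nsq_le[OF pL L2.comb_in[OF r2(2) u] wp lims(2)] by (simp add: L2comb_def)
  have "(\<lambda>n. L2ip T (h1deriv T (ys (r n))) (us (r n))) \<longlonglongrightarrow> L2ip T (h1deriv T y) u"
    by (rule L2.wconv_sconv_ip[OF dL us u M(1) y(5) usr])
  then have ulim: "(\<lambda>n. L2ip T (us (r n)) (h1deriv T (ys (r n)))) \<longlonglongrightarrow> L2ip T u (h1deriv T y)"
    using L2.ip_commute[OF dL us] L2.ip_commute[OF h1deriv_L2fun[OF y(1)] u] by simp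
  have TT: "T \<in> {0..T}" using T_pos by simp
  have "\<phi> (y T) \<le> ereal c"
    using phi_lsc[OF y(4)[OF TT] lims(3)] flow_sel_finite[OF f TT] by simp
  then have c_le: "ephi (y T) \<le> c" using flow_sel_finite[OF fy TT] by simp
  define l where "l = a / 2 + b / 2 - L2ip T u (h1deriv T y) + c - ephi y0"
  have "(\<lambda>n. Gval (us (r n)) (ys (r n)) (\<xi> (r n))) \<longlonglongrightarrow> l"
    unfolding Gval_def l_def p_eq[symmetric] by (intro tendsto_intros lims ulim) simp_all
  then have "(\<lambda>n. G_DG T \<phi> y0 (us (r n), ys (r n))) \<longlonglongrightarrow> ereal l" by (simp add: Gv)
  moreover have "G_DG T \<phi> y0 (u, y) \<le> ereal l"
    unfolding G_DG_eq_Gval[OF u fy y(2)] Gval_def l_def using a_le b_le c_le by simp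
  ultimately show ?thesis using that[OF r y(1)] y(3) by (simp add: o_def)
qed

end

section \<open>Penalized control problems\<close>

lemma topspace_tau: "topspace (tau T) = Xset T"
  by (simp add: tau_def topspace_L2_top topspace_H1w_top Xset_def)

lemma limitin_tau_iff:
  "limitin (tau T) xs x sequentially \<longleftrightarrow>
     limitin (L2_top T) (fst \<circ> xs) (fst x) sequentially \<and> limitin (H1w_top T) (snd \<circ> xs) (snd x) sequentially"
  by (simp add: tau_def limitin_pairwise)

text \<open>Open strict superlevel sets contain the limit and hence eventually the sequence.\<close>

lemma lsc_top_liminf:
  assumes "lsc_top X F" "limitin X xs x sequentially"
  shows "enn2ereal (F x) \<le> liminf (\<lambda>n. enn2ereal (F (xs n)))"
  unfolding le_Liminf_iff
proof (intro allI impI)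
  fix c assume c: "c < enn2ereal (F x)"
  show "\<forall>\<^sub>F n in sequentially. c < enn2ereal (F (xs n))"
  proof (cases "0 \<le> c")
    case True
    define S where "S = {x \<in> topspace X. e2ennreal c < F x}"
    have "openin X S" using assms(1) by (simp add: lsc_top_def S_def)
    moreover have iff: "e2ennreal c < F z \<longleftrightarrow> c < enn2ereal (F z)" for z
      using True by (simp add: less_ennreal.rep_eq enn2ereal_e2ennreal)
    moreover have "x \<in> S" using assms(2) c by (simp add: limitin_def S_def iff)
    ultimately have "\<forall>\<^sub>F n in sequentially. xs n \<in> S"
      using assms(2) unfolding limitin_def by blast
    then show ?thesis by eventually_elim (simp add: iff S_def)
  \<comment> \<open>Negative levels are separated out because \<open>e2ennreal\<close> truncates
    them to 0; there the claim follows from nonnegativity of F.\<close>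
  next
    case False
    then have "c < enn2ereal (F (xs n))" for n using enn2ereal_nonneg[of "F (xs n)"] by (meson less_le_trans not_le)
    then show ?thesis by simp
  qed
qed

text \<open>\<open>L2dist\<close> does not distinguish a.e. equal controls, so \<open>tau\<close> is
  not Hausdorff and limits may be exchanged within an \<open>Xeq\<close> class. Uniqueness of the
  minimizer is understood in this sense.\<close>

lemma limitin_tau_Xeq:
  fixes x x' :: "(real \<Rightarrow> 'a::{real_inner,banach,second_countable_topology}) \<times> (real \<Rightarrow> 'a)"
  assumes l: "limitin (tau T) xs x' sequentially" and eq: "Xeq T x' x" and x: "x \<in> Xset T"
  shows "limitin (tau T) xs x sequentially"
proof -
  have 1: "fst x' \<in> L2fun T" "fst x \<in> L2fun T" using l x by (auto simp: limitin_tau_iff limitin_L2_top_iff Xset_def)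
  have "L2dist T (fst x) v = L2dist T (fst x') v" if "v \<in> L2fun T" for v
  proof -
    note [measurable] = L2fun_measurable[OF 1(1)] L2fun_measurable[OF 1(2)] L2fun_measurable[OF that]
    show ?thesis unfolding L2dist_def using eq
      by (intro arg_cong[where f = sqrt] integral_cong_AE) (auto simp: Xeq_def elim: eventually_mono)
  qed
  moreover have ev: "\<forall>\<^sub>F n in sequentially. (fst \<circ> xs) n \<in> L2fun T" and
    lim: "(\<lambda>n. L2dist T (fst x') ((fst \<circ> xs) n)) \<longlonglongrightarrow> 0"
    using l by (auto simp: limitin_tau_iff limitin_L2_top_iff)
  ultimately have "(\<lambda>n. L2dist T (fst x) ((fst \<circ> xs) n)) \<longlonglongrightarrow> 0"
    by (subst tendsto_cong[of _ "\<lambda>n. L2dist T (fst x') ((fst \<circ> xs) n)"]) (auto elim: eventually_mono)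
  with l 1 ev show ?thesis using eq by (simp add: limitin_tau_iff limitin_L2_top_iff Xeq_def)
qed

lemma limitin_H1w_top_unique:
  assumes T: "0 < T" and "limitin (H1w_top T) ys y sequentially" "limitin (H1w_top T) ys z sequentially"
  shows "y = z"
proof (rule H1inner_nondegenerate[OF T])
  show "y \<in> H1fun T" "z \<in> H1fun T" using assms by (auto simp: limitin_H1w_top_iff)
  show "H1inner T y w = H1inner T z w" if "w \<in> H1fun T" for w
    using assms that LIMSEQ_unique unfolding limitin_H1w_top_iff by blast
qed

section \<open>Existence of minimizers, Gamma-convergence and quasiminimizers\<close>

locale penalized_control = gradient_flow +
  fixes U :: "(real \<Rightarrow> 'a) set" and F :: "(real \<Rightarrow> 'a) \<times> (real \<Rightarrow> 'a) \<Rightarrow> ennreal"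
  assumes U_compact: "compactin (L2_top T) U" and F_lsc: "lsc_top (tau T) F"
    and F_fin: "(u, y) \<in> Xset T \<Longrightarrow> F (u, y) < \<infinity> \<Longrightarrow> u \<in> U"
begin

abbreviation "G \<equiv> G_DG T \<phi> y0"
abbreviation "E \<equiv> E_eps T \<phi> y0 F"
abbreviation "E0 \<equiv> E_0 T \<phi> y0 F"

lemma F_le_E: "x \<in> Xset T \<Longrightarrow> \<epsilon> > 0 \<Longrightarrow> enn2ereal (F x) \<le> E \<epsilon> x"
  unfolding E_eps_def using G_DG_nonneg[of x] by (simp add: ereal_le_add_self)

lemma G_le_E:
  assumes "x \<in> Xset T" "\<epsilon> > 0"
  shows "G x \<le> ereal \<epsilon> * E \<epsilon> x"
proof -
  have "ereal (1 / \<epsilon>) * G x \<le> E \<epsilon> x"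
    unfolding E_eps_def by (rule add_increasing) (simp_all add: enn2ereal_nonneg)
  then have "ereal \<epsilon> * (ereal (1 / \<epsilon>) * G x) \<le> ereal \<epsilon> * E \<epsilon> x"
    using assms by (intro ereal_mult_left_mono) auto
  moreover have "ereal \<epsilon> * (ereal (1 / \<epsilon>) * G x) = G x"
    using assms by (simp add: mult.assoc[symmetric])
  ultimately show ?thesis by simp
qed

lemma E_nonneg: "x \<in> Xset T \<Longrightarrow> \<epsilon> > 0 \<Longrightarrow> 0 \<le> E \<epsilon> x"
  using F_le_E order_trans enn2ereal_nonneg by blast

text \<open>Finite F puts the controls into the compact set U, which supplies the strong limit that
  the compactness of \<open>G_DG\<close> presupposes.\<close>

lemma compactness:
  assumes xs: "\<And>n::nat. xs n \<in> Xset T" and Ffin: "\<And>n. F (xs n) < \<infinity>" and Gb: "\<And>n. G (xs n) \<le> ereal C"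
  obtains r x l where "strict_mono r" "x \<in> Xset T" "limitin (tau T) (xs \<circ> r) x sequentially"
    "(\<lambda>n. G (xs (r n))) \<longlonglongrightarrow> ereal l" "G x \<le> ereal l"
    "enn2ereal (F x) \<le> liminf (\<lambda>n. enn2ereal (F (xs (r n))))"
proof -
  have uL: "fst (xs n) \<in> L2fun T" and yH: "snd (xs n) \<in> H1fun T" for n using xs[of n] by (auto simp: Xset_def)
  have "fst (xs n) \<in> U" for n using F_fin[of "fst (xs n)" "snd (xs n)"] xs Ffin by simp
  then obtain r1 u where r1: "strict_mono r1" "u \<in> U" "limitin (L2_top T) ((\<lambda>n. fst (xs n)) \<circ> r1) u sequentially"
    using compactin_L2_top_subsequence[OF U_compact, of "\<lambda>n. fst (xs n)"] by blast
  have u: "u \<in> L2fun T" and ulim: "(\<lambda>n. L2dist T u (fst (xs (r1 n)))) \<longlonglongrightarrow> 0"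
    using r1(3) by (auto simp: limitin_L2_top_iff o_def)
  have G1: "G (fst (xs (r1 n)), snd (xs (r1 n))) \<le> ereal C" for n using Gb by simp
  obtain r2 y l where r2: "strict_mono r2" "y \<in> H1fun T"
    "limitin (H1w_top T) ((\<lambda>n. snd (xs (r1 n))) \<circ> r2) y sequentially"
    "(\<lambda>n. G (fst (xs (r1 (r2 n))), snd (xs (r1 (r2 n))))) \<longlonglongrightarrow> ereal l" "G (u, y) \<le> ereal l"
    using G_DG_compactness[of "\<lambda>n. fst (xs (r1 n))" u "\<lambda>n. snd (xs (r1 n))" C, OF uL u ulim yH G1]
    by blast
  define r where "r = r1 \<circ> r2"
  have r: "strict_mono r" unfolding r_def by (intro strict_mono_o r1 r2)
  have lim: "limitin (tau T) (xs \<circ> r) (u, y) sequentially"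
    unfolding limitin_tau_iff using r2(3) limitin_subsequence[OF r2(1) r1(3)] by (simp add: r_def o_def)
  show ?thesis
  proof (rule that[OF r _ lim])
    show "(u, y) \<in> Xset T" using u r2 by (simp add: Xset_def)
    show "(\<lambda>n. G (xs (r n))) \<longlonglongrightarrow> ereal l" using r2(4) by (simp add: r_def)
    show "enn2ereal (F (u, y)) \<le> liminf (\<lambda>n. enn2ereal (F (xs (r n))))"
      using lsc_top_liminf[OF F_lsc lim] by (simp add: o_def)
  qed (rule r2(5))
qed

lemma minimizer_exists:
  assumes \<epsilon>: "\<epsilon> > 0"
  shows "\<exists>x. is_minimizer (Xset T) (E \<epsilon>) x"
proof -
  define I where "I = (INF x\<in>Xset T. E \<epsilon> x)"
  have I_le: "I \<le> E \<epsilon> x" if "x \<in> Xset T" for x unfolding I_def using that by (rule INF_lower)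
  have I0: "0 \<le> I" unfolding I_def by (intro INF_greatest E_nonneg \<epsilon>)
  show ?thesis
  proof (cases "I = \<infinity>")
    case True
    \<comment> \<open>If the functional is identically infinite, any point minimizes it; the zero
      pair shows that there is one.\<close>
    have "((\<lambda>_. 0), (\<lambda>_. 0)) \<in> Xset T" by (simp add: Xset_def zero_L2fun zero_H1fun)
    then show ?thesis unfolding is_minimizer_def using I_le True by (metis ereal_infty_less_eq(1))
  next
    case False
    then obtain i where i: "I = ereal i" "0 \<le> i" using I0 by (cases I) auto
    have "\<exists>x\<in>Xset T. E \<epsilon> x < ereal (i + 1 / real (Suc n))" for n
    proof -
      have "I < ereal (i + 1 / real (Suc n))" by (simp add: i)
      then show ?thesis unfolding I_def by (simp add: INF_less_iff)
    qed
    then obtain xs where xs: "\<And>n. xs n \<in> Xset T" "\<And>n. E \<epsilon> (xs n) < ereal (i + 1 / real (Suc n))" by metis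
    have Elim: "(\<lambda>n. E \<epsilon> (xs n)) \<longlonglongrightarrow> ereal i"
    proof (rule tendsto_sandwich[of "\<lambda>_. ereal i"])
      have "(\<lambda>n. i + inverse (real (Suc n))) \<longlonglongrightarrow> i + 0" by (intro tendsto_intros LIMSEQ_inverse_real_of_nat)
      then show "(\<lambda>n. ereal (i + 1 / real (Suc n))) \<longlonglongrightarrow> ereal i" by (simp add: inverse_eq_divide)
      show "\<forall>\<^sub>F n in sequentially. ereal i \<le> E \<epsilon> (xs n)" using I_le[OF xs(1)] i by simp
      show "\<forall>\<^sub>F n in sequentially. E \<epsilon> (xs n) \<le> ereal (i + 1 / real (Suc n))" 
        using less_imp_le[OF xs(2)] by (intro always_eventually) blast
    qed simp
    have Eb: "E \<epsilon> (xs n) \<le> ereal (i + 1)" for n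
    proof (rule order_trans[OF less_imp_le[OF xs(2)]])
      show "ereal (i + 1 / real (Suc n)) \<le> ereal (i + 1)" by simp
    qed
    have Ffin: "F (xs n) < \<infinity>" for n
    proof -
      have "enn2ereal (F (xs n)) < \<infinity>"
        using order_trans[OF F_le_E[OF xs(1) \<epsilon>] Eb] by (rule le_less_trans) simp
      then show ?thesis by (simp add: less_ennreal.rep_eq top_ennreal.rep_eq)
    qed
    have Gb: "G (xs n) \<le> ereal (\<epsilon> * (i + 1))" for n
    proof -
      have "ereal \<epsilon> * E \<epsilon> (xs n) \<le> ereal \<epsilon> * ereal (i + 1)" using Eb \<epsilon> by (intro ereal_mult_left_mono) auto
      then show ?thesis using order_trans[OF G_le_E[OF xs(1) \<epsilon>]] by simp
    qed
    obtain r x l where r: "strict_mono r" "x \<in> Xset T" "(\<lambda>n. G (xs (r n))) \<longlonglongrightarrow> ereal l" "G x \<le> ereal l"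
      "enn2ereal (F x) \<le> liminf (\<lambda>n. enn2ereal (F (xs (r n))))"
      using compactness[of xs, OF xs(1) Ffin Gb] by blast
    have Glim: "(\<lambda>n. ereal (1 / \<epsilon>) * G (xs (r n))) \<longlonglongrightarrow> ereal (1 / \<epsilon>) * ereal l"
      by (intro tendsto_cmult_ereal r(3)) simp
    have "E \<epsilon> x \<le> liminf (\<lambda>n. enn2ereal (F (xs (r n)))) + liminf (\<lambda>n. ereal (1 / \<epsilon>) * G (xs (r n)))"
      unfolding E_eps_def lim_imp_Liminf[OF sequentially_bot Glim]
      using \<epsilon> r(4,5) by (intro add_mono ereal_mult_left_mono) auto
    also have "\<dots> \<le> liminf (\<lambda>n. E \<epsilon> (xs (r n)))"
      unfolding E_eps_def
      by (rule ereal_liminf_add_mono) (simp add: lim_imp_Liminf[OF sequentially_bot Glim])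
    also have "\<dots> = ereal i"
      using LIMSEQ_subseq_LIMSEQ[OF Elim r(1)] by (intro lim_imp_Liminf) (auto simp: o_def)
    finally show ?thesis unfolding is_minimizer_def using r(2) I_le i by (metis order_trans)
  qed
qed

text \<open>If the liminf were below some c < \<open>E0 x\<close>, a subsequence would satisfy F
  \<le> c and G \<le> \<epsilon> c, which tends to 0. Lower semicontinuity then gives
  \<open>F x\<close> \<le> c and \<open>G x\<close> = 0, hence \<open>E0 x\<close> \<le> c.\<close>

lemma gamma_liminf:
  assumes \<epsilon>: "\<And>n. \<epsilon> n > 0" "\<epsilon> \<longlonglongrightarrow> 0" and xs: "\<And>n. xs n \<in> Xset T"
    and lim: "limitin (tau T) xs x sequentially"
  shows "E0 x \<le> liminf (\<lambda>n. E (\<epsilon> n) (xs n))"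
proof (rule ccontr)
  assume "\<not> ?thesis"
  then have lt: "liminf (\<lambda>n. E (\<epsilon> n) (xs n)) < E0 x" by simp
  then obtain c where c: "liminf (\<lambda>n. E (\<epsilon> n) (xs n)) < ereal c" "ereal c < E0 x"
    using ereal_dense2 by blast
  have "\<exists>\<^sub>F n in sequentially. E (\<epsilon> n) (xs n) < ereal c"
    using c(1) Liminf_bounded[of "ereal c" "\<lambda>n. E (\<epsilon> n) (xs n)" sequentially]
    by (auto simp: frequently_def not_less)
  then have inf: "infinite {n. E (\<epsilon> n) (xs n) < ereal c}"
    by (simp add: frequently_cofinite[symmetric] cofinite_eq_sequentially)
  define k where "k = enumerate {n. E (\<epsilon> n) (xs n) < ereal c}"
  have k: "strict_mono k" unfolding k_def by (rule strict_mono_enumerate[OF inf])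
  have Ek: "E (\<epsilon> (k n)) (xs (k n)) < ereal c" for n
    using enumerate_in_set[OF inf, of n] unfolding k_def by simp
  have c0: "0 \<le> c" using order_trans[OF E_nonneg[OF xs \<epsilon>(1)] less_imp_le[OF Ek[of 0]]] by simp
  have Ffin: "enn2ereal (F (xs (k n))) \<le> ereal c" for n
    using order_trans[OF F_le_E[OF xs \<epsilon>(1)] less_imp_le[OF Ek]] .
  have Fx: "enn2ereal (F x) \<le> ereal c"
  proof -
    have "enn2ereal (F x) \<le> liminf (\<lambda>n. enn2ereal (F (xs (k n))))"
      using lsc_top_liminf[OF F_lsc limitin_subsequence[OF k lim]] by (simp add: o_def)
    also have "\<dots> \<le> liminf (\<lambda>n. ereal c)" using Ffin by (intro Liminf_mono) simp
    finally show ?thesis by (simp add: Liminf_const)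
  qed
  have Gk: "G (xs (k n)) \<le> ereal (\<epsilon> (k n) * c)" for n
  proof -
    have "ereal (\<epsilon> (k n)) * E (\<epsilon> (k n)) (xs (k n)) \<le> ereal (\<epsilon> (k n)) * ereal c"
      using Ek \<epsilon>(1) less_imp_le by (intro ereal_mult_left_mono) (auto intro: less_imp_le)
    then show ?thesis using order_trans[OF G_le_E[OF xs \<epsilon>(1)]] by simp
  qed
  have "(\<lambda>n. \<epsilon> (k n)) \<longlonglongrightarrow> 0" using LIMSEQ_subseq_LIMSEQ[OF \<epsilon>(2) k] by (simp add: o_def)
  then have ek: "(\<lambda>n. \<epsilon> (k n) * c) \<longlonglongrightarrow> 0" by (rule tendsto_mult_left_zero)
  then have "Bseq (\<lambda>n. \<epsilon> (k n) * c)" by (intro convergent_imp_Bseq) (auto simp: convergent_def)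
  then obtain C where C: "\<And>n. \<epsilon> (k n) * c \<le> C" unfolding Bseq_def by (auto simp: abs_le_iff)
  have GC: "G (xs (k n)) \<le> ereal C" for n using order_trans[OF Gk] C by simp
  have FF: "F (xs (k n)) < \<infinity>" for n
  proof -
    have "enn2ereal (F (xs (k n))) < \<infinity>" using Ffin by (rule le_less_trans) simp
    then show ?thesis by (simp add: less_ennreal.rep_eq top_ennreal.rep_eq)
  qed
  have lim1: "limitin (L2_top T) (fst \<circ> xs) (fst x) sequentially" and lim2: "limitin (H1w_top T) (snd \<circ> xs) (snd x) sequentially"
    using lim by (auto simp: limitin_tau_iff)
  have ux: "fst x \<in> L2fun T" "(\<lambda>n. L2dist T (fst x) (fst (xs (k n)))) \<longlonglongrightarrow> 0"
    using limitin_subsequence[OF k lim1] by (auto simp: limitin_L2_top_iff o_def)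
  have uyk: "fst (xs (k n)) \<in> L2fun T" "snd (xs (k n)) \<in> H1fun T" for n using xs[of "k n"] by (auto simp: Xset_def)
  have G1: "G (fst (xs (k n)), snd (xs (k n))) \<le> ereal C" for n using GC by simp
  \<comment> \<open>Compactness provides its own limit trajectory y; uniqueness of weak limits
    identifies it with \<open>snd x\<close>, while the control limit \<open>fst x\<close> was
    prescribed.\<close>
  obtain r y l where r: "strict_mono r" "limitin (H1w_top T) ((\<lambda>n. snd (xs (k n))) \<circ> r) y sequentially"
    "(\<lambda>n. G (fst (xs (k (r n))), snd (xs (k (r n))))) \<longlonglongrightarrow> ereal l" "G (fst x, y) \<le> ereal l"
    using G_DG_compactness[of "\<lambda>n. fst (xs (k n))" "fst x" "\<lambda>n. snd (xs (k n))" C, OF uyk(1) ux uyk(2) G1]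
    by blast
  have "limitin (H1w_top T) ((\<lambda>n. snd (xs (k n))) \<circ> r) (snd x) sequentially"
    using limitin_subsequence[OF strict_mono_o[OF k r(1)] lim2] by (simp add: o_def)
  then have "y = snd x" using limitin_H1w_top_unique[OF T_pos r(2)] by blast
  moreover have "ereal l \<le> ereal 0"
  proof (rule LIMSEQ_le[OF r(3)])
    show "(\<lambda>n. ereal (\<epsilon> (k (r n)) * c)) \<longlonglongrightarrow> ereal 0"
      using tendsto_ereal[OF LIMSEQ_subseq_LIMSEQ[OF ek r(1)]] by (simp add: o_def)
    show "\<exists>N. \<forall>n\<ge>N. G (fst (xs (k (r n))), snd (xs (k (r n)))) \<le> ereal (\<epsilon> (k (r n)) * c)" using Gk by simp
  qed
  ultimately have "G x \<le> 0" using order_trans[OF r(4), of "ereal 0"] by (simp add: zero_ereal_def)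
  moreover have "x \<in> Xset T" using lim by (simp add: limitin_def topspace_tau)
  ultimately have "G x = 0" using G_DG_nonneg by (intro antisym) auto
  then have "E0 x \<le> ereal c" using Fx by (simp add: E_0_def)
  then show False using c(2) by simp
qed

text \<open>Finite \<open>E0 x\<close> means \<open>G x = 0\<close>, so the penalty vanishes for
  every parameter.\<close>

lemma E_eq_E0: "E0 x < \<infinity> \<Longrightarrow> E \<epsilon> x = E0 x"
  by (auto simp: E_0_def E_eps_def split: if_splits)

lemma gamma_convergence: "gamma_conv (tau T) E E0"
  unfolding gamma_conv_def topspace_tau
proof (intro allI impI conjI ballI)
  fix \<epsilon> :: "nat \<Rightarrow> real" and x :: "(real \<Rightarrow> 'a) \<times> (real \<Rightarrow> 'a)" and xs
  assume "(\<forall>n. 0 < \<epsilon> n) \<and> \<epsilon> \<longlonglongrightarrow> 0" "(\<forall>n. xs n \<in> Xset T) \<and> limitin (tau T) xs x sequentially"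
  then show "E0 x \<le> liminf (\<lambda>n. E (\<epsilon> n) (xs n))" using gamma_liminf by blast
next
  fix \<epsilon> :: "nat \<Rightarrow> real" and x :: "(real \<Rightarrow> 'a) \<times> (real \<Rightarrow> 'a)" assume x: "x \<in> Xset T"
  show "\<exists>xs. (\<forall>n. xs n \<in> Xset T) \<and> limitin (tau T) xs x sequentially \<and> limsup (\<lambda>n. E (\<epsilon> n) (xs n)) \<le> E0 x"
  proof (intro exI[of _ "\<lambda>_. x"] conjI allI x)
    show "limitin (tau T) (\<lambda>_. x) x sequentially" using x by (simp add: limitin_def topspace_tau)
    show "limsup (\<lambda>n. E (\<epsilon> n) x) \<le> E0 x"
      by (cases "E0 x = \<infinity>") (auto simp: E_eq_E0 Limsup_const)
  qed
qed

lemma quasiminimizers_compact: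
  assumes q: "quasimin_seq (Xset T) E \<epsilon> xs"
  shows "\<exists>r x. strict_mono r \<and> is_minimizer (Xset T) E0 x \<and> limitin (tau T) (xs \<circ> r) x sequentially"
proof -
  have \<epsilon>: "\<And>n. \<epsilon> n > 0" "\<epsilon> \<longlonglongrightarrow> 0" and xs: "\<And>n. xs n \<in> Xset T"
    and Efin: "\<forall>\<^sub>F n in sequentially. E (\<epsilon> n) (xs n) < \<infinity>"
    and diff: "(\<lambda>n. E (\<epsilon> n) (xs n) - (INF x\<in>Xset T. E (\<epsilon> n) x)) \<longlonglongrightarrow> 0"
    using q by (auto simp: quasimin_seq_def)
  define I where "I n = (INF x\<in>Xset T. E (\<epsilon> n) x)" for n
  have I_le: "I n \<le> E (\<epsilon> n) x" if "x \<in> Xset T" for x n unfolding I_def using that by (rule INF_lower)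
  have I0: "0 \<le> I n" for n unfolding I_def by (intro INF_greatest E_nonneg \<epsilon>)
  obtain N1 where N1: "\<And>n. n \<ge> N1 \<Longrightarrow> E (\<epsilon> n) (xs n) < \<infinity>" using Efin by (auto simp: eventually_sequentially)
  have quasi: "\<forall>\<^sub>F n in sequentially. E (\<epsilon> n) (xs n) \<le> I n + ereal d" if d: "d > 0" for d
  proof -
    have "\<forall>\<^sub>F n in sequentially. E (\<epsilon> n) (xs n) - I n < ereal d"
      using order_tendstoD(2)[OF diff, of "ereal d"] d unfolding I_def by simp
    with Efin show ?thesis
    proof eventually_elim
      case (elim n)
      \<comment> \<open>Only with a finite infimum can the extended real difference be rearranged
        into an upper bound.\<close>
      have "I n < \<infinity>" using I_le[OF xs, of n n] elim(1) by (rule le_less_trans)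
      then obtain i where "I n = ereal i" using I0[of n] by (cases "I n") auto
      then show ?case using elim(2) by (cases "E (\<epsilon> n) (xs n)") auto
    qed
  qed
  \<comment> \<open>A competitor independent of n: finite energy for one parameter makes F and G
    finite at z, hence \<open>E (\<epsilon> n) z\<close> finite for all n.\<close>
  define z where "z = xs N1"
  have zX: "z \<in> Xset T" by (simp add: z_def xs)
  have Ez: "E (\<epsilon> N1) z < \<infinity>" unfolding z_def by (rule N1) simp
  obtain fz where fz: "enn2ereal (F z) = ereal fz" "0 \<le> fz"
    using le_less_trans[OF F_le_E[OF zX \<epsilon>(1)] Ez] enn2ereal_nonneg[of "F z"] by (cases "enn2ereal (F z)") auto
  have "G z < \<infinity>"
    using Ez \<epsilon>(1)[of N1] by (cases "G z") (auto simp: E_eps_def fz)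
  then obtain gz where gz: "G z = ereal gz" "0 \<le> gz" using G_DG_nonneg[OF zX] by (cases "G z") auto
  have Ezn: "E (\<epsilon> n) z = ereal (fz + gz / \<epsilon> n)" for n by (simp add: E_eps_def fz gz)
  have "\<forall>\<^sub>F n in sequentially. \<epsilon> n < 1" using order_tendstoD(2)[OF \<epsilon>(2), of 1] by simp
  then have "\<forall>\<^sub>F n in sequentially. F (xs n) < \<infinity> \<and> G (xs n) \<le> ereal (fz + gz + 1)"
    using quasi[OF zero_less_one] Efin
  proof eventually_elim
    case (elim n)
    have "enn2ereal (F (xs n)) < \<infinity>" using F_le_E[OF xs \<epsilon>(1)] elim(3) by (rule le_less_trans)
    then have "F (xs n) < \<infinity>" by (simp add: less_ennreal.rep_eq top_ennreal.rep_eq)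
    moreover have "G (xs n) \<le> ereal (fz + gz + 1)"
    proof -
      have "E (\<epsilon> n) (xs n) \<le> ereal (fz + gz / \<epsilon> n + 1)"
        using order_trans[OF elim(2) add_right_mono[OF I_le[OF zX, of n], of "ereal 1"]] by (simp add: Ezn)
      then have "ereal (\<epsilon> n) * E (\<epsilon> n) (xs n) \<le> ereal (\<epsilon> n) * ereal (fz + gz / \<epsilon> n + 1)"
        using \<epsilon>(1)[of n] by (intro ereal_mult_left_mono) auto
      \<comment> \<open>Multiplication by \<open>\<epsilon> n\<close> cancels the blow-up of the
        penalty at z, leaving a bound uniform in n once \<open>\<epsilon> n < 1\<close>.\<close>
      also have "\<dots> = ereal (\<epsilon> n * (fz + 1) + gz)" using \<epsilon>(1)[of n] by (simp add: field_simps)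
      also have "\<dots> \<le> ereal (1 * (fz + 1) + gz)"
        using elim(1) fz(2) unfolding ereal_less_eq(3) by (intro add_right_mono mult_right_mono) auto
      finally show ?thesis using order_trans[OF G_le_E[OF xs \<epsilon>(1)]] by (simp add: algebra_simps)
    qed
    ultimately show ?case by blast
  qed
  then obtain N where N: "\<And>n. n \<ge> N \<Longrightarrow> F (xs n) < \<infinity>" "\<And>n. n \<ge> N \<Longrightarrow> G (xs n) \<le> ereal (fz + gz + 1)"
    by (auto simp: eventually_sequentially)
  have "F (xs (n + N)) < \<infinity>" "G (xs (n + N)) \<le> ereal (fz + gz + 1)" for n using N[of "n + N"] by auto
  from compactness[of "\<lambda>n. xs (n + N)", OF xs this]
  obtain r x where r: "strict_mono r" "x \<in> Xset T" "limitin (tau T) ((\<lambda>n. xs (n + N)) \<circ> r) x sequentially"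
    by blast
  define k where "k n = r n + N" for n
  have k: "strict_mono k" using r(1) by (simp add: k_def strict_mono_def)
  have lim: "limitin (tau T) (xs \<circ> k) x sequentially" using r(3) by (simp add: k_def o_def)
  have ek: "(\<lambda>n. \<epsilon> (k n)) \<longlonglongrightarrow> 0" using LIMSEQ_subseq_LIMSEQ[OF \<epsilon>(2) k] by (simp add: o_def)
  \<comment> \<open>Competitors of infinite value are trivial, which covers the case of an
    identically infinite limit; for the others \<open>E\<close> equals \<open>E0\<close> and
    quasiminimality compares directly.\<close>
  have "E0 x \<le> E0 x'" if x': "x' \<in> Xset T" for x'
  proof (cases "E0 x' < \<infinity>")
    case True
    have "E0 x \<le> E0 x' + ereal d" if d: "d > 0" for d
    proof -
      have "E0 x \<le> liminf (\<lambda>n. E (\<epsilon> (k n)) ((xs \<circ> k) n))"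
        using gamma_liminf[of "\<lambda>n. \<epsilon> (k n)" "xs \<circ> k" x] \<epsilon>(1) ek xs lim by simp
      also have "\<dots> \<le> liminf (\<lambda>n. E0 x' + ereal d)"
      proof (rule Liminf_mono)
        have "\<forall>\<^sub>F n in sequentially. E (\<epsilon> (k n)) (xs (k n)) \<le> I (k n) + ereal d"
          using eventually_compose_filterlim[OF quasi[OF d] filterlim_subseq[OF k]] .
        then show "\<forall>\<^sub>F n in sequentially. E (\<epsilon> (k n)) ((xs \<circ> k) n) \<le> E0 x' + ereal d"
        proof eventually_elim
          case (elim n)
          have "I (k n) + ereal d \<le> E0 x' + ereal d"
            using add_right_mono[OF I_le[OF x', of "k n"], of "ereal d"] by (simp add: E_eq_E0[OF True])
          with elim show ?case by simp
        qed
      qed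
      finally show ?thesis by (simp add: Liminf_const)
    qed
    then show ?thesis by (rule ereal_le_epsilon2)
  qed simp
  then have "is_minimizer (Xset T) E0 x" using r(2) by (simp add: is_minimizer_def)
  with k lim show ?thesis by blast
qed

text \<open>Subsequences of quasiminimizing sequences are quasiminimizing, so each has a further
  subsequence converging to some minimizer, which represents the same point as x.\<close>

lemma quasiminimizers_converge:
  assumes unique: "\<And>x'. is_minimizer (Xset T) E0 x' \<Longrightarrow> Xeq T x' x"
    and x: "x \<in> Xset T" and q: "quasimin_seq (Xset T) E \<epsilon> xs"
  shows "limitin (tau T) xs x sequentially"
proof (rule limitin_subsequenceI)
  show "x \<in> topspace (tau T)" by (simp add: topspace_tau x)
  fix r :: "nat \<Rightarrow> nat" assume r: "strict_mono r"
  have "quasimin_seq (Xset T) E (\<epsilon> \<circ> r) (xs \<circ> r)"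
    using q LIMSEQ_subseq_LIMSEQ[OF _ r, of \<epsilon> 0]
      LIMSEQ_subseq_LIMSEQ[OF _ r, of "\<lambda>n. E (\<epsilon> n) (xs n) - (INF x\<in>Xset T. E (\<epsilon> n) x)" 0]
      eventually_subseq[OF r, of "\<lambda>n. E (\<epsilon> n) (xs n) < \<infinity>"]
    by (simp add: quasimin_seq_def o_def)
  then obtain s x' where s: "strict_mono s" "is_minimizer (Xset T) E0 x'" "limitin (tau T) (xs \<circ> r \<circ> s) x' sequentially"
    using quasiminimizers_compact by blast
  have "limitin (tau T) (xs \<circ> r \<circ> s) x sequentially"
    by (rule limitin_tau_Xeq[OF s(3) unique[OF s(2)] x])
  with s show "\<exists>s. strict_mono s \<and> limitin (tau T) (xs \<circ> r \<circ> s) x sequentially" by blast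
qed

end

lemma Xeq_sym_trans:
  "Xeq T x z \<Longrightarrow> Xeq T y z \<Longrightarrow> Xeq T x y"
  unfolding Xeq_def by (auto elim: eventually_elim2)

theorem theorem4p1:
  fixes \<phi> \<phi>1 :: "'a::{real_inner,banach,second_countable_topology} \<Rightarrow> ereal"
    and \<phi>2 :: "'a \<Rightarrow> real"
    and T :: real and y0 :: 'a
    and U :: "(real \<Rightarrow> 'a) set"
    and F :: "(real \<Rightarrow> 'a) \<times> (real \<Rightarrow> 'a) \<Rightarrow> ennreal"
  assumes T_pos: "T > 0"
    and phi_def: "\<phi> = (\<lambda>x. \<phi>1 x + ereal (\<phi>2 x))"
    and phi1_proper: "proper_fun \<phi>1"
    and phi1_convex: "convex_fun \<phi>1"
    and phi1_lsc: "lsc_fun \<phi>1"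
    and phi1_single: "\<forall>y \<xi> \<eta>. \<xi> \<in> frechet_subdiff \<phi>1 y \<and> \<eta> \<in> frechet_subdiff \<phi>1 y \<longrightarrow> \<xi> = \<eta>"
    and phi2_C11: "C11 \<phi>2"
    and compact_sublevel: "\<forall>c::real. compact {x. \<phi> x \<le> ereal c}"
    and chain: "chain_rule T \<phi>"
    and y0_dom: "y0 \<in> dom_fun \<phi>"
    and U_ne: "U \<noteq> {}"
    and U_compact: "compactin (L2_top T) U"
    and F_lsc: "lsc_top (tau T) F"
    and F_fin: "\<forall>u y. (u, y) \<in> Xset T \<and> F (u, y) < \<infinity> \<longrightarrow> u \<in> U"
  shows "(\<forall>\<epsilon>>0. \<exists>x. is_minimizer (Xset T) (E_eps T \<phi> y0 F \<epsilon>) x)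
     \<and> gamma_conv (tau T) (E_eps T \<phi> y0 F) (E_0 T \<phi> y0 F)
     \<and> (\<forall>\<epsilon> xs. quasimin_seq (Xset T) (E_eps T \<phi> y0 F) \<epsilon> xs \<longrightarrow>
          (\<exists>r x. strict_mono r \<and> is_minimizer (Xset T) (E_0 T \<phi> y0 F) x \<and>
                 limitin (tau T) (xs \<circ> r) x sequentially))
     \<and> ((\<exists>x. is_minimizer (Xset T) (E_0 T \<phi> y0 F) x \<and>
            (\<forall>x'. is_minimizer (Xset T) (E_0 T \<phi> y0 F) x' \<longrightarrow> Xeq T x' x)) \<longrightarrow>
        (\<forall>x \<epsilon> xs. is_minimizer (Xset T) (E_0 T \<phi> y0 F) x \<and>
                   quasimin_seq (Xset T) (E_eps T \<phi> y0 F) \<epsilon> xs \<longrightarrow>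
                   limitin (tau T) xs x sequentially))"
proof -
  obtain g where g: "\<And>x. (\<phi>2 has_derivative (\<lambda>h. inner (g x) h)) (at x)" "continuous_on UNIV g"
    using C11_gradient[OF phi2_C11] by blast
  interpret penalized_control \<phi> \<phi>1 \<phi>2 g T y0 U F
  proof
    show "\<phi>1 x \<noteq> - \<infinity>" for x using phi1_proper by (simp add: proper_fun_def)
    show "\<xi> = \<eta>" if "\<xi> \<in> frechet_subdiff \<phi>1 y" "\<eta> \<in> frechet_subdiff \<phi>1 y" for \<xi> \<eta> y
      using phi1_single that by blast
    show "compact {x. \<phi> x \<le> ereal c}" for c using compact_sublevel by blast
    show "u \<in> U" if "(u, y) \<in> Xset T" "F (u, y) < \<infinity>" for u y using F_fin that by blast
  qed (fact phi_def phi1_convex g T_pos chain y0_dom U_compact F_lsc)+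
  show ?thesis
  proof (intro conjI allI impI)
    fix x \<epsilon> xs
    assume "\<exists>x. is_minimizer (Xset T) E0 x \<and> (\<forall>x'. is_minimizer (Xset T) E0 x' \<longrightarrow> Xeq T x' x)"
      and h: "is_minimizer (Xset T) E0 x \<and> quasimin_seq (Xset T) E \<epsilon> xs"
    then obtain z where z: "\<And>x'. is_minimizer (Xset T) E0 x' \<Longrightarrow> Xeq T x' z" by blast
    show "limitin (tau T) xs x sequentially"
    proof (rule quasiminimizers_converge)
      \<comment> \<open>Uniqueness is given relative to some minimizer z, while x is an arbitrary
        one; both x' and x agree with z up to \<open>Xeq\<close>.\<close>
      show "Xeq T x' x" if "is_minimizer (Xset T) E0 x'" for x'
        using Xeq_sym_trans[OF z[OF that]] z h by blast
    qed (use h in \<open>auto simp: is_minimizer_def\<close>)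
  qed (use minimizer_exists gamma_convergence quasiminimizers_compact in blast)+
qed

end
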